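(* Let $N\ge 1$, let $P_j$ and $Q_j$ be Laurent polynomials belonging to $L^1(\mathbb{D},dA)$ for $j=1,\ldots,N$, and let $H\in L^1(\mathbb{D},dA)$. Then $\sum_{j=1}^{N}T_{P_j}T_{\overline{Q_j}}-T_H$ has finite rank if and only if $H$ extends to a differentiable function on $\mathbb{C}\setminus\{0\}$ (that is, $H$ agrees almost everywhere on $\mathbb{D}$ with such a function, again denoted $H$) that solves the system of differential equations $$\frac{\partial H}{\partial z}=\sum_{j=1}^{N}P_j'(z)\,\overline{Q_j\!\left(\tfrac{1}{\bar z}\right)},\qquad \frac{\partial H}{\partial\bar z}=\sum_{j=1}^{N}P_j\!\left(\tfrac{1}{\bar z}\right)\overline{Q_j'(z)}$$ subject to the constraint $H(1)=\sum_{j=1}^{N}P_j(1)\,\overline{Q_j(1)}$.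
   Context: $\mathbb{D}$ is the open unit disk in $\mathbb{C}$, $dA$ is normalized Lebesgue area measure on $\mathbb{D}$, and $A^2$ is the Bergman space of holomorphic functions on $\mathbb{D}$ that are square integrable with respect to $dA$. A Laurent polynomial is a finite linear combination of $\{z^m:m\in\mathbb{Z}\}$ with complex coefficients. The operators $\partial/\partial z$ and $\partial/\partial\bar z$ are the Wirtinger derivatives, and differentiability is in the real sense. For $f\in L^1(\mathbb{D},dA)$, the Toeplitz operator $T_f$ is defined (at least) on holomorphic polynomials $h$ by $T_f(h)(z)=\int_{\mathbb{D}}\frac{f(w)h(w)}{(1-\bar w z)^2}\,dA(w)$, $z\in\mathbb{D}$. Toeplitz operators whose symbols are finite sums of integrable functions of the form $\phi(r)e^{im\theta}$ ($m\in\mathbb{Z}$) map holomorphic polynomials to holomorphic polynomials, so products of two such operators are defined on holomorphic polynomials. A finite sum of products of such (possibly unbounded) operators, whose domain contains the holomorphic polynomials, is said to have finite rank if the image of the space of holomorphic polynomials is finite dimensional. *)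

theory Defs
  imports
    "HOL-Analysis.Analysis"
    "HOL-Computational_Algebra.Polynomial"
    "HOL-Library.Function_Algebras"
begin

text \<open>The measure lives on all of the complex plane but gives mass zero to the complement of the
  unit disk, so integrability and almost-everywhere statements only concern the disk.\<close>

definition dA :: "complex measure" where
  "dA = uniform_measure lebesgue (ball 0 1)"

text \<open>Negative powers of \<open>0\<close> are \<open>0\<close> in HOL; this value at the origin is never relevant below.\<close>

definition laurent_polynomial :: "(complex \<Rightarrow> complex) \<Rightarrow> bool" where
  "laurent_polynomial f \<longleftrightarrow>
     (\<exists>(S :: int set) (a :: int \<Rightarrow> complex). finite S \<and> f = (\<lambda>z. \<Sum>m\<in>S. a m * z powi m))"

text \<open>A function on the unit disk is represented by its extension by \<open>0\<close> to the plane, so that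
  equality and linear dependence of such functions mean equality and dependence on the disk.\<close>

definition toeplitz :: "(complex \<Rightarrow> complex) \<Rightarrow> (complex \<Rightarrow> complex) \<Rightarrow> complex \<Rightarrow> complex" where
  "toeplitz f h z =
     (if z \<in> ball 0 1 then \<integral>w. f w * h w / (1 - cnj w * z)\<^sup>2 \<partial>dA else 0)"

definition fun_scale :: "complex \<Rightarrow> (complex \<Rightarrow> complex) \<Rightarrow> complex \<Rightarrow> complex" where
  "fun_scale c f = (\<lambda>z. c * f z)"

lemma vector_space_fun_scale: "vector_space fun_scale"
  by unfold_locales (auto simp: fun_scale_def fun_eq_iff algebra_simps)

text \<open>The image of the polynomials under a linear map is a linear subspace, and it is finite
  dimensional precisely when it lies in the span of a finite set.\<close>

definition finite_rank :: "((complex \<Rightarrow> complex) \<Rightarrow> complex \<Rightarrow> complex) \<Rightarrow> bool" where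
  "finite_rank L \<longleftrightarrow>
     (\<exists>B. finite B \<and> L ` range (poly :: complex poly \<Rightarrow> complex \<Rightarrow> complex)
            \<subseteq> module.span fun_scale B)"

text \<open>The Wirtinger derivatives \<open>(\<partial>\<^sub>x - \<i> \<partial>\<^sub>y) / 2\<close> and \<open>(\<partial>\<^sub>x + \<i> \<partial>\<^sub>y) / 2\<close>; the real Frechet
  derivative applied to \<open>1\<close> and \<open>\<i>\<close> gives the two real partial derivatives.\<close>

definition wirtinger_z :: "(complex \<Rightarrow> complex) \<Rightarrow> complex \<Rightarrow> complex" where
  "wirtinger_z G z =
     (frechet_derivative G (at z) 1 - \<i> * frechet_derivative G (at z) \<i>) / 2"

definition wirtinger_zbar :: "(complex \<Rightarrow> complex) \<Rightarrow> complex \<Rightarrow> complex" where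
  "wirtinger_zbar G z =
     (frechet_derivative G (at z) 1 + \<i> * frechet_derivative G (at z) \<i>) / 2"

end

theory Submission
  imports
    Defs
    "HOL-Complex_Analysis.Complex_Analysis"
    "HOL-Probability.Probability_Measure"
    "Jordan_Normal_Form.Determinant"
begin

text \<open>
  The system of differential equations has an explicit solution. If \<open>P\<close> has the coefficients
  \<open>p a\<close> and \<open>Q\<close> the coefficients \<open>q b\<close>, then \<open>P'(z) cnj (Q (1 / cnj z))\<close> is the sum of
  \<open>p a cnj (q b) a z^(a-b-1)\<close>, which is holomorphic in \<open>z\<close>, and the second right-hand side is the
  corresponding antiholomorphic sum. Integrating term by term, with \<open>ln |z|^2\<close> for the terms with
  \<open>a = b\<close>, gives the functions \<open>symbol_term a b\<close>, normalised to \<open>1\<close> at the point \<open>1\<close>. Since the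
  punctured plane is connected, their combination \<open>G0\<close> (the \<open>defect_symbol\<close>) is the only solution
  that satisfies the constraint (\<open>wirtinger_determines_function\<close>). So the right-hand side of the
  theorem says that \<open>H = G0\<close> almost everywhere on the disk.

  On the operator side, the product of the Toeplitz operators with symbols \<open>z^a\<close> and \<open>cnj z^b\<close> maps
  \<open>z^n\<close> to \<open>(n - b + 1) / (n + 1) z^(n+a-b)\<close> once \<open>n\<close> is large, and a computation of moments shows
  that the Toeplitz operator with symbol \<open>symbol_term a b\<close> does the same. Hence on \<open>z^n\<close> with \<open>n\<close>
  large the operator of the theorem acts as the Toeplitz operator with symbol \<open>G0 - H\<close>
  (\<open>toeplitz_defect_power\<close>). If \<open>H = G0\<close>, then all but finitely many powers of \<open>z\<close> are mapped to \<open>0\<close>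
  and the rank is finite.

  Conversely, if the rank is finite and \<open>n0\<close> is large, the function \<open>F = (G0 - H) z^n0\<close> is integrable
  on the disk and its Toeplitz operator has finite rank. By Luecking's theorem such an \<open>F\<close> vanishes
  (\<open>finite_rank_moments_imp_AE_zero\<close>). For integrable functions there is the following direct
  proof. The moment matrix \<open>m(n,k)\<close>, the integral of \<open>F w^n cnj w^k\<close>, has finite rank. Choose a
  nonvanishing minor of maximal size \<open>s\<close>, with rows \<open>n_i\<close> and columns \<open>k_j\<close>, and form the
  determinant \<open>D(l,m)\<close> of the integrals of \<open>F w^n_i e^(l w) cnj (w^k_j e^(m w))\<close>. Finite rank makes
  it factor: \<open>D(l,m) D(0,0) = D(l,0) D(0,m)\<close>. For \<open>m = -l\<close> the two exponentials combine to the
  unimodular function \<open>e^(2 i Im (l w))\<close>, so \<open>D(l,-l)\<close> is bounded, and by the Riemann-Lebesgue lemma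
  it tends to \<open>0\<close> along \<open>l = 1, 2, 3, \<dots>\<close> unless \<open>s = 0\<close>. But \<open>D(l,0) cnj (D(0,-l))\<close> is entire
  in \<open>l\<close> and has the modulus of the bounded function \<open>D(l,-l) D(0,0)\<close>. So it is constant by
  Liouville's theorem, and its value at \<open>l = 0\<close> is nonzero. Therefore \<open>s = 0\<close>,
  all moments vanish, and \<open>F = 0\<close> by the Stone-Weierstrass theorem.
\<close>


section \<open>The normalized area measure of the disk\<close>

lemma sets_dA [measurable_cong]: "sets dA = sets lebesgue"
  by (simp add: dA_def uniform_measure_def)

lemma space_dA [simp]: "space dA = UNIV"
  by (simp add: dA_def uniform_measure_def)

lemma emeasure_unit_disk: "emeasure lebesgue (ball (0::complex) 1) = ennreal pi"
  by (simp add: emeasure_ball unit_ball_vol_2)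

lemma prob_space_dA: "prob_space dA"
  unfolding dA_def by (rule prob_space_uniform_measure) (auto simp: emeasure_unit_disk)

text \<open>The measure is defined on Lebesgue sets, whereas the concrete functions below are Borel; this is the
  bridge between the two.\<close>

lemma borel_measurable_dA: "f \<in> borel_measurable borel \<Longrightarrow> f \<in> borel_measurable dA"
  by (metis measurable_completion measurable_cong_sets sets_dA sets_lborel measurable_lborel1)

lemma AE_dA_iff: "(AE w in dA. R w) \<longleftrightarrow> (AE w in lebesgue. w \<in> ball 0 1 \<longrightarrow> R w)"
  unfolding dA_def by (rule AE_uniform_measure) (auto simp: emeasure_unit_disk)

lemma AE_dA_disk: "AE w in dA. norm w < 1"
  by (simp add: AE_dA_iff)

lemma AE_dA_nonzero: "AE w in dA. w \<noteq> 0"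
proof -
  have "AE w in (lebesgue :: complex measure). w \<noteq> 0"
    by (rule AE_completion) (rule AE_lborel_singleton)
  then show ?thesis unfolding AE_dA_iff by eventually_elim auto
qed

text \<open>The origin is excluded because negative powers of \<open>0\<close> and \<open>ln 0\<close> have default values.\<close>

lemma integrable_dA_bounded:
  fixes f :: "complex \<Rightarrow> complex"
  assumes "f \<in> borel_measurable dA" and "\<And>w. norm w < 1 \<Longrightarrow> w \<noteq> 0 \<Longrightarrow> norm (f w) \<le> b"
  shows "integrable dA f"
proof -
  interpret prob_space dA by (rule prob_space_dA)
  have "AE w in dA. norm (f w) \<le> b"
    using AE_dA_disk AE_dA_nonzero by eventually_elim (use assms(2) in auto)
  then show ?thesis by (rule integrable_const_bound) (rule assms(1))
qed

lemma integrable_dA_mult_bounded: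
  fixes f g :: "complex \<Rightarrow> complex"
  assumes f: "integrable dA f" and g: "g \<in> borel_measurable dA"
    and b: "\<And>w. norm w < 1 \<Longrightarrow> w \<noteq> 0 \<Longrightarrow> norm (g w) \<le> b"
  shows "integrable dA (\<lambda>w. f w * g w)"
proof (rule Bochner_Integration.integrable_bound)
  show "integrable dA (\<lambda>w. of_real b * f w)" using f by simp
  show "(\<lambda>w. f w * g w) \<in> borel_measurable dA"
    using borel_measurable_integrable[OF f] g by simp
  show "AE w in dA. norm (f w * g w) \<le> norm (of_real b * f w)"
    using AE_dA_disk AE_dA_nonzero
  proof eventually_elim
    case (elim w)
    have "norm (g w) \<le> \<bar>b\<bar>" using b[OF elim] by linarith
    then have "norm (f w) * norm (g w) \<le> norm (f w) * \<bar>b\<bar>" by (intro mult_left_mono) auto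
    then show ?case by (simp add: norm_mult mult.commute)
  qed
qed

lemma measurable_powi [measurable]:
  "(\<lambda>w::complex. w powi i) \<in> borel_measurable borel"
  by (cases "i \<ge> 0") (simp_all add: power_int_def)

lemma measurable_cnj [measurable]: "cnj \<in> borel_measurable borel"
  by (intro borel_measurable_continuous_onI continuous_intros)

text \<open>The image of Lebesgue measure under a rotation is again translation invariant, and a translation
  invariant measure is determined by its value on one set. The usual proof of that uniqueness by
  Fubini's theorem is carried out for the disk, on which both measures agree by rotational symmetry.\<close>

lemma lborel_rotate:
  fixes \<zeta> :: complex
  assumes "norm \<zeta> = 1"
  shows "distr lborel borel (\<lambda>w. \<zeta> * w) = lborel"
proof (rule measure_eqI)
  show "sets (distr lborel borel (\<lambda>w. \<zeta> * w)) = sets lborel" by simp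
next
  fix A assume "A \<in> sets (distr lborel borel (\<lambda>w. \<zeta> * w))"
  then have A [measurable]: "A \<in> sets borel" by simp
  have z0: "\<zeta> \<noteq> 0" using assms by auto
  let ?D = "ball (0::complex) 1"
  let ?a = "indicator A :: complex \<Rightarrow> ennreal" and ?d = "indicator ?D :: complex \<Rightarrow> ennreal"
  have tr: "(\<integral>\<^sup>+y. f (y + c) \<partial>lborel) = (\<integral>\<^sup>+y. f y \<partial>lborel)"
    if [measurable]: "f \<in> borel_measurable borel" for f :: "complex \<Rightarrow> ennreal" and c
    by (subst (2) lborel_distr_plus[of c, symmetric]) (simp add: nn_integral_distr add.commute)
  have refl: "(\<integral>\<^sup>+y. f (c - y) \<partial>lborel) = (\<integral>\<^sup>+y. f y \<partial>lborel)"
    if [measurable]: "f \<in> borel_measurable borel" for f :: "complex \<Rightarrow> ennreal" and c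
  proof -
    have "lborel = density (distr lborel borel (\<lambda>y::complex. c + (-1) *\<^sub>R y)) (\<lambda>_. 1)"
      using lborel_affine[of "-1" c] by simp
    then have "(\<integral>\<^sup>+y. f y \<partial>lborel) = (\<integral>\<^sup>+y. f y \<partial>distr lborel borel (\<lambda>y. c + (-1) *\<^sub>R y))"
      by (metis density_1)
    then show ?thesis by (simp add: nn_integral_distr)
  qed
  have [measurable]: "?d \<in> borel_measurable borel" "?a \<in> borel_measurable borel"
    by (rule borel_measurable_indicator, simp)+
  have d_rot: "?d (\<zeta> * x) = ?d x" for x
    using assms by (simp add: indicator_def norm_mult)
  \<comment> \<open>Both sides of the claim, multiplied by the area of the disk, are double integrals. They are turned
    into each other by translations and a reflection in one variable at a time.\<close>
  have "emeasure (distr lborel borel (\<lambda>w. \<zeta> * w)) A * emeasure lborel ?D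
      = (\<integral>\<^sup>+x. ?a (\<zeta> * x) \<partial>lborel) * (\<integral>\<^sup>+y. ?d y \<partial>lborel)"
  proof -
    have "emeasure (distr lborel borel (\<lambda>w. \<zeta> * w)) A = (\<integral>\<^sup>+x. ?a x \<partial>distr lborel borel (\<lambda>w. \<zeta> * w))"
      by simp
    also have "\<dots> = (\<integral>\<^sup>+x. ?a (\<zeta> * x) \<partial>lborel)"
      by (rule nn_integral_distr) auto
    finally show ?thesis by simp
  qed
  also have "\<dots> = (\<integral>\<^sup>+x. (\<integral>\<^sup>+y. ?a (\<zeta> * x) * ?d y \<partial>lborel) \<partial>lborel)"
  proof -
    have "(\<integral>\<^sup>+x. (\<integral>\<^sup>+y. ?a (\<zeta> * x) * ?d y \<partial>lborel) \<partial>lborel)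
      = (\<integral>\<^sup>+x. ?a (\<zeta> * x) * (\<integral>\<^sup>+y. ?d y \<partial>lborel) \<partial>lborel)"
      by (intro nn_integral_cong nn_integral_cmult borel_measurable_indicator) simp
    also have "\<dots> = (\<integral>\<^sup>+x. ?a (\<zeta> * x) \<partial>lborel) * (\<integral>\<^sup>+y. ?d y \<partial>lborel)"
      by (rule nn_integral_multc) simp
    finally show ?thesis by simp
  qed
  also have "\<dots> = (\<integral>\<^sup>+x. (\<integral>\<^sup>+y. ?a (\<zeta> * x) * ?d (y + \<zeta> * x) \<partial>lborel) \<partial>lborel)"
  proof (rule nn_integral_cong)
    fix x
    show "(\<integral>\<^sup>+y. ?a (\<zeta> * x) * ?d y \<partial>lborel) = (\<integral>\<^sup>+y. ?a (\<zeta> * x) * ?d (y + \<zeta> * x) \<partial>lborel)"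
      by (rule tr[symmetric]) simp
  qed
  also have "\<dots> = (\<integral>\<^sup>+y. (\<integral>\<^sup>+x. ?a (\<zeta> * x) * ?d (y + \<zeta> * x) \<partial>lborel) \<partial>lborel)"
    by (rule lborel_pair.Fubini'[symmetric]) simp
  also have "\<dots> = (\<integral>\<^sup>+y. (\<integral>\<^sup>+x. ?a (\<zeta> * x - y) * ?d (\<zeta> * x) \<partial>lborel) \<partial>lborel)"
  proof (rule nn_integral_cong)
    fix y
    show "(\<integral>\<^sup>+x. ?a (\<zeta> * x) * ?d (y + \<zeta> * x) \<partial>lborel) = (\<integral>\<^sup>+x. ?a (\<zeta> * x - y) * ?d (\<zeta> * x) \<partial>lborel)"
      using tr[of "\<lambda>x. ?a (\<zeta> * x) * ?d (y + \<zeta> * x)" "- y / \<zeta>"] z0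
      by (simp add: algebra_simps)
  qed
  also have "\<dots> = (\<integral>\<^sup>+x. (\<integral>\<^sup>+y. ?a (\<zeta> * x - y) * ?d (\<zeta> * x) \<partial>lborel) \<partial>lborel)"
    by (rule lborel_pair.Fubini') simp
  also have "\<dots> = (\<integral>\<^sup>+x. emeasure lborel A * ?d x \<partial>lborel)"
    by (simp add: nn_integral_multc refl d_rot)
  also have "\<dots> = emeasure lborel A * emeasure lborel ?D"
    by (simp add: nn_integral_cmult)
  finally have eq: "emeasure (distr lborel borel (\<lambda>w. \<zeta> * w)) A * ennreal pi = emeasure lborel A * ennreal pi"
    by (simp add: emeasure_ball unit_ball_vol_2)
  have cancel: "x * ennreal pi / ennreal pi = x" for x
    by (rule mult_divide_eq_ennreal) auto
  show "emeasure (distr lborel borel (\<lambda>w. \<zeta> * w)) A = emeasure lborel A"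
    using arg_cong[OF eq, of "\<lambda>x. x / ennreal pi"] by (simp only: cancel)
qed

lemma emeasure_dA_borel:
  "A \<in> sets borel \<Longrightarrow> emeasure dA A = emeasure lborel (ball 0 1 \<inter> A) / ennreal pi"
  unfolding dA_def by (simp add: emeasure_unit_disk)

lemma dA_rotate:
  fixes f :: "complex \<Rightarrow> complex"
  assumes z: "norm \<zeta> = 1" and f [measurable]: "f \<in> borel_measurable borel"
  shows "(\<integral>w. f (\<zeta> * w) \<partial>dA) = (\<integral>w. f w \<partial>dA)"
proof -
  have m [measurable]: "(\<lambda>w. \<zeta> * w) \<in> measurable dA borel" "(\<lambda>w. w) \<in> measurable dA borel"
    by (rule borel_measurable_dA; simp)+
  have "distr dA borel (\<lambda>w. \<zeta> * w) = distr dA borel (\<lambda>w. w)"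
  proof (rule measure_eqI)
    fix A assume "A \<in> sets (distr dA borel (\<lambda>w. \<zeta> * w))"
    then have A [measurable]: "A \<in> sets borel" by simp
    have p [measurable]: "(\<lambda>w. \<zeta> * w) -` A \<in> sets borel"
      using measurable_sets[of "\<lambda>w. \<zeta> * w" borel borel A] by simp
    have "emeasure lborel (ball 0 1 \<inter> (\<lambda>w. \<zeta> * w) -` A)
        = emeasure (distr lborel borel (\<lambda>w. \<zeta> * w)) (ball 0 1 \<inter> A)"
      using z by (simp add: emeasure_distr norm_mult vimage_def Int_def)
    also have "\<dots> = emeasure lborel (ball 0 1 \<inter> A)"
      by (simp add: lborel_rotate[OF z])
    finally show "emeasure (distr dA borel (\<lambda>w. \<zeta> * w)) A = emeasure (distr dA borel (\<lambda>w. w)) A"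
      by (simp add: emeasure_distr emeasure_dA_borel)
  qed simp
  then have "(\<integral>w. f w \<partial>distr dA borel (\<lambda>w. \<zeta> * w)) = (\<integral>w. f w \<partial>distr dA borel (\<lambda>w. w))" by simp
  then show ?thesis by (simp add: integral_distr)
qed

text \<open>The disk of radius \<open>r\<close> has normalized area \<open>r^2\<close>, so the squared modulus is uniformly distributed.
  This replaces polar coordinates.\<close>

lemma dA_radial_distr: "distr dA borel (\<lambda>w. (norm w)\<^sup>2) = uniform_measure lborel {0..1::real}"
proof (rule measure_eqI_lessThan)
  interpret A: prob_space dA by (rule prob_space_dA)
  have m [measurable]: "(\<lambda>w::complex. (norm w)\<^sup>2) \<in> measurable dA borel"
    by (rule borel_measurable_dA) simp
  show "sets (distr dA borel (\<lambda>w. (norm w)\<^sup>2)) = sets borel" by simp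
  show "sets (uniform_measure lborel {0..1::real}) = sets borel" by simp
  fix t :: real
  have eq: "emeasure (distr dA borel (\<lambda>w. (norm w)\<^sup>2)) {t<..} = emeasure dA {w. (norm w)\<^sup>2 > t}"
    by (simp add: emeasure_distr vimage_def)
  show "emeasure (distr dA borel (\<lambda>w. (norm w)\<^sup>2)) {t<..} < \<infinity>"
    unfolding eq using A.emeasure_finite by (simp add: less_top[symmetric])
  have me: "measure dA {w. (norm w)\<^sup>2 > t} = measure lebesgue (ball 0 1 \<inter> {w::complex. (norm w)\<^sup>2 > t}) / pi"
    unfolding dA_def by (subst measure_uniform_measure)
      (auto simp: emeasure_unit_disk measure_def)
  have ms: "{w::complex. (norm w)\<^sup>2 > t} \<in> sets borel" by measurable
  have mu: "measure dA {w. (norm w)\<^sup>2 > t} = (if t < 0 then 1 else if t < 1 then 1 - t else 0)"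
  proof -
    consider "t < 0" | "0 \<le> t" "t < 1" | "t \<ge> 1" by linarith
    then show ?thesis
    proof cases
      case 1
      then have "{w::complex. (norm w)\<^sup>2 > t} = UNIV" by (auto intro: less_le_trans)
      then show ?thesis using 1 A.prob_space by simp
    next
      case 2
      have "ball 0 1 \<inter> {w::complex. (norm w)\<^sup>2 > t} = ball 0 1 - cball 0 (sqrt t)"
        using 2 by (auto simp: not_le real_less_lsqrt real_sqrt_less_iff) (metis abs_norm_cancel not_less real_sqrt_abs real_sqrt_le_iff, metis abs_norm_cancel not_less real_sqrt_abs real_sqrt_less_iff)
      moreover have "cball 0 (sqrt t) \<subseteq> ball (0::complex) 1"
        using 2 by (auto simp: le_less_trans)
      ultimately have "measure lebesgue (ball 0 1 \<inter> {w::complex. (norm w)\<^sup>2 > t}) =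
        measure lebesgue (ball (0::complex) 1) - measure lebesgue (cball (0::complex) (sqrt t))"
        by (simp add: measure_Diff emeasure_unit_disk)
      also have "\<dots> = pi - pi * t"
        using 2 by (simp add: content_ball content_cball unit_ball_vol_2)
      finally show ?thesis using 2 by (simp add: me field_simps)
    next
      case 3
      have "(norm w)\<^sup>2 < 1" if "norm w < 1" for w :: complex
        using that by (simp add: power_less_one_iff abs_square_less_1)
      with 3 have "ball 0 1 \<inter> {w::complex. (norm w)\<^sup>2 > t} = {}" by fastforce
      then show ?thesis using 3 by (simp add: me)
    qed
  qed
  have "emeasure (uniform_measure lborel {0..1::real}) {t<..} = emeasure lborel ({0..1} \<inter> {t<..})"
    by (simp add: divide_ennreal_def)
  also have "{0..1} \<inter> {t<..} = (if t < 0 then {0..1} else if t < 1 then {t<..1} else {})"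
    by auto
  also have "emeasure lborel \<dots> = ennreal (if t < 0 then 1 else if t < 1 then 1 - t else 0)"
    by auto
  finally show "emeasure (distr dA borel (\<lambda>w. (norm w)\<^sup>2)) {t<..} = emeasure (uniform_measure lborel {0..1::real}) {t<..}"
    unfolding eq A.emeasure_eq_measure mu by simp
qed

text \<open>The bound may fail at \<open>0\<close>, which allows integrands with a logarithm.\<close>

lemma dA_radial_integral:
  fixes \<phi> :: "real \<Rightarrow> real"
  assumes [measurable]: "\<phi> \<in> borel_measurable borel"
    and b: "\<And>t. 0 < t \<Longrightarrow> t \<le> 1 \<Longrightarrow> \<bar>\<phi> t\<bar> \<le> b"
    and I: "(\<phi> has_integral I) {0..1}"
  shows "(\<integral>w. \<phi> ((norm w)\<^sup>2) \<partial>dA) = I"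
proof -
  have m [measurable]: "(\<lambda>w::complex. (norm w)\<^sup>2) \<in> measurable dA borel"
    by (rule borel_measurable_dA) simp
  have "(\<integral>w. \<phi> ((norm w)\<^sup>2) \<partial>dA) = (\<integral>t. \<phi> t \<partial>uniform_measure lborel {0..1})"
    by (simp add: dA_radial_distr[symmetric] integral_distr)
  also have "\<dots> = (LBINT t:{0..1}. \<phi> t)"
  proof -
    have "uniform_measure lborel {0..1} = density lborel (\<lambda>t::real. ennreal (indicator {0..1} t))"
      unfolding uniform_measure_def
      by (intro density_cong) (auto simp: indicator_def divide_ennreal simp flip: ennreal_1)
    then show ?thesis
      unfolding set_lebesgue_integral_def by (simp add: integral_density)
  qed
  also have "set_integrable lborel {0..1} \<phi>"
    unfolding set_integrable_def
  proof (rule Bochner_Integration.integrable_bound)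
    show "integrable lborel (\<lambda>t::real. indicator {0..1} t *\<^sub>R b :: real)"
      by (rule integrable_scaleR_left) (rule integrable_real_indicator, auto)
    show "AE t in lborel. norm (indicator {0..1} t *\<^sub>R \<phi> t) \<le> norm (indicator {0..1} t *\<^sub>R b)"
      using AE_lborel_singleton[of 0]
    proof eventually_elim
      case (elim t)
      then show ?case using b[of t] by (auto simp: indicator_def)
    qed
  qed simp
  then have "(LBINT t:{0..1}. \<phi> t) = I"
    using set_borel_integral_eq_integral(2) I by (metis integral_unique)
  finally show ?thesis .
qed

section \<open>Moments of monomials\<close>

lemma has_integral_power: "((\<lambda>t::real. t ^ n) has_integral 1 / (n + 1)) {0..1}"
proof -
  have "((\<lambda>t::real. t ^ n) has_integral 1 ^ (n + 1) / (n + 1) - 0 ^ (n + 1) / (n + 1)) {0..1}"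
  proof (rule fundamental_theorem_of_calculus)
    fix t :: real
    have "((\<lambda>t::real. t ^ (n + 1) / (n + 1)) has_real_derivative t ^ n) (at t within {0..1})"
      using DERIV_cdivide[OF DERIV_pow[of "n + 1" t "{0..1}"], of "n + 1"]
      by (simp add: add.commute add_nonneg_eq_0_iff)
    then show "((\<lambda>t::real. t ^ (n + 1) / (n + 1)) has_vector_derivative t ^ n) (at t within {0..1})"
      by (simp add: has_real_derivative_iff_has_vector_derivative)
  qed simp
  then show ?thesis by (simp add: add.commute)
qed

lemma has_integral_power_ln:
  assumes n: "n \<ge> 1"
  shows "((\<lambda>t::real. t ^ n * ln t) has_integral - (1 / (n + 1)\<^sup>2)) {0..1}"
proof -
  define F where "F t = t ^ n * (t * ln t) / (n + 1) - t ^ (n + 1) / (n + 1)\<^sup>2" for t :: real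
  have "((\<lambda>t::real. t * ln t) \<longlongrightarrow> 0) (at_right 0)" by real_asymp
  then have c0: "continuous (at 0 within {0..1::real}) (\<lambda>t. t * ln t)"
    by (simp add: continuous_within at_within_Icc_at_right)
  have "continuous_on {0..1::real} (\<lambda>t. t * ln t)"
    unfolding continuous_on_eq_continuous_within
  proof
    fix t :: real assume t: "t \<in> {0..1}"
    show "continuous (at t within {0..1}) (\<lambda>t. t * ln t)"
    proof (cases "t = 0")
      case False
      with t show ?thesis by (intro continuous_intros) auto
    qed (use c0 in simp)
  qed
  then have "continuous_on {0..1} (\<lambda>t::real. t ^ n * (t * ln t))"
    by (rule continuous_on_mult[OF continuous_on_power[OF continuous_on_id]])
  then have cF: "continuous_on {0..1} F"
    unfolding F_def by (intro continuous_on_diff continuous_on_divide continuous_on_power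
      continuous_on_id continuous_on_const) auto
  have dF: "(F has_vector_derivative t ^ n * ln t) (at t)" if "t \<in> {0<..<1}" for t
  proof -
    have t: "t > 0" using that by simp
    let ?c = "real (n + 1)"
    have d: "((\<lambda>t. t ^ (n + 1)) has_real_derivative ?c * t ^ n) (at t)"
      using DERIV_pow[of "n + 1" t UNIV] by simp
    have l: "(ln has_real_derivative 1 / t) (at t)" using t by (rule DERIV_ln_divide)
    have "((\<lambda>t. t ^ (n + 1) * ln t / ?c - t ^ (n + 1) / ?c\<^sup>2) has_real_derivative
        (?c * t ^ n * ln t + 1 / t * t ^ (n + 1)) / ?c - ?c * t ^ n / ?c\<^sup>2) (at t)"
      by (intro DERIV_diff DERIV_cdivide DERIV_mult d l)
    also have "(?c * t ^ n * ln t + 1 / t * t ^ (n + 1)) / ?c - ?c * t ^ n / ?c\<^sup>2 = t ^ n * ln t"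
    proof -
      have "(c * p * l + 1 / t * (t * p)) / c - c * p / c\<^sup>2 = p * l" if "c \<noteq> 0" for c p l :: real
        using that t by (simp add: field_simps power2_eq_square)
      from this[of ?c "t ^ n" "ln t"] show ?thesis by simp
    qed
    also have "(\<lambda>t. t ^ (n + 1) * ln t / ?c - t ^ (n + 1) / ?c\<^sup>2) = F"
      by (simp add: F_def fun_eq_iff)
    finally have "(F has_real_derivative t ^ n * ln t) (at t)" .
    then show ?thesis by (simp add: has_real_derivative_iff_has_vector_derivative)
  qed
  have "((\<lambda>t. t ^ n * ln t) has_integral F 1 - F 0) {0..1}"
    by (rule fundamental_theorem_of_calculus_interior) (use cF dF in auto)
  then show ?thesis using n by (simp add: F_def add.commute)
qed

lemma abs_power_ln_le:
  fixes t :: real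
  assumes "0 < t" "t \<le> 1" "n \<ge> 1"
  shows "\<bar>t ^ n * ln t\<bar> \<le> 1"
proof -
  have "- ln t \<le> 1 / t"
    using ln_le_minus_one[of "1 / t"] assms by (simp add: ln_div)
  then have "\<bar>ln t\<bar> \<le> 1 / t" using assms by simp
  then have "t ^ n * \<bar>ln t\<bar> \<le> t * (1 / t)"
    using assms power_decreasing[of 1 n t] by (intro mult_mono) auto
  then show ?thesis using assms by (simp add: abs_mult)
qed

lemma powi_cnj_powi_self: "w powi int n * cnj w powi int n = of_real (((norm w)\<^sup>2) ^ n)"
  by (simp add: power_mult_distrib[symmetric] complex_norm_square[symmetric])

lemma dA_integral_odd_rotation:
  fixes f :: "complex \<Rightarrow> complex"
  assumes "f \<in> borel_measurable borel" "norm \<zeta> = 1" "\<And>w. f (\<zeta> * w) = - f w"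
  shows "(\<integral>w. f w \<partial>dA) = 0"
proof -
  have "(\<integral>w. f w \<partial>dA) = (\<integral>w. f (\<zeta> * w) \<partial>dA)" using dA_rotate[OF assms(2,1)] by simp
  also have "\<dots> = - (\<integral>w. f w \<partial>dA)" by (simp add: assms(3))
  finally show ?thesis by simp
qed

text \<open>Rotating by the angle \<open>pi / (i - j)\<close> changes the sign of the integrand, and the measure is invariant
  under rotations.\<close>

lemma dA_integral_radial_times_monomial_offdiag:
  fixes g :: "real \<Rightarrow> complex"
  assumes [measurable]: "g \<in> borel_measurable borel" and ij: "i \<noteq> j"
  shows "(\<integral>w. g (norm w) * (w powi i * cnj w powi j) \<partial>dA) = 0"
proof -
  \<comment> \<open>chosen so that \<open>\<zeta> powi (i - j) = -1\<close>\<close>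
  define \<zeta> where "\<zeta> = cis (pi / of_int (i - j))"
  have n: "norm \<zeta> = 1" by (simp add: \<zeta>_def)
  have c: "cnj \<zeta> = inverse \<zeta>" by (simp add: \<zeta>_def cis_cnj)
  have "\<zeta> powi (i - j) = -1"
    using ij by (simp add: \<zeta>_def cis_power_int del: of_int_diff)
  then have e: "\<zeta> powi i * cnj \<zeta> powi j = -1"
    unfolding c using n by (subst (asm) power_int_diff) (auto simp: power_int_inverse field_simps)
  have [measurable]: "(\<lambda>w::complex. g (norm w) * (w powi i * cnj w powi j)) \<in> borel_measurable borel"
    by measurable
  show ?thesis
  proof (rule dA_integral_odd_rotation[OF _ n])
    fix w
    have "(\<zeta> * w) powi i * cnj (\<zeta> * w) powi j = (\<zeta> powi i * cnj \<zeta> powi j) * (w powi i * cnj w powi j)"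
      by (simp add: power_int_mult_distrib)
    then show "g (norm (\<zeta> * w)) * ((\<zeta> * w) powi i * cnj (\<zeta> * w) powi j) = - (g (norm w) * (w powi i * cnj w powi j))"
      by (simp add: norm_mult n e)
  qed measurable
qed

text \<open>The exponents are integers because symbols contain negative powers; \<open>i + j \<ge> 0\<close> makes the
  integrand bounded and forces \<open>i \<ge> 0\<close> on the diagonal.\<close>

lemma moment_monomial:
  assumes "i + j \<ge> 0"
  shows "(\<integral>w. w powi i * cnj w powi j \<partial>dA) = (if i = j then 1 / of_int (i + 1) else 0)"
proof (cases "i = j")
  case True
  with assms obtain n where n: "i = int n" "j = int n" by (metis nonneg_int_cases zero_le_double_add_iff_zero_le_single_add)
  have "(\<integral>w. w powi i * cnj w powi j \<partial>dA) = of_real (\<integral>w. ((norm w)\<^sup>2) ^ n \<partial>dA)"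
    unfolding n powi_cnj_powi_self by (rule integral_complex_of_real)
  also have "(\<integral>w. ((norm w)\<^sup>2) ^ n \<partial>dA) = 1 / (n + 1)"
    by (rule dA_radial_integral[where b = 1]) (use has_integral_power[of n] in \<open>auto simp: power_le_one add.commute\<close>)
  finally show ?thesis using n by simp
next
  case False
  then show ?thesis
    using dA_integral_radial_times_monomial_offdiag[of "\<lambda>_. 1" i j] by simp
qed

lemma moment_log_monomial:
  assumes "i + j \<ge> 1"
  shows "(\<integral>w. of_real (ln ((norm w)\<^sup>2)) * (w powi i * cnj w powi j) \<partial>dA)
      = (if i = j then - 1 / (of_int (i + 1))\<^sup>2 else 0)"
proof (cases "i = j")
  case True
  with assms obtain n where n: "i = int n" "j = int n" by (metis nonneg_int_cases zero_le_double_add_iff_zero_le_single_add zle_add1_eq_le zero_less_one order_trans le_add1 of_nat_0_le_iff int_one_le_iff_zero_less less_imp_le)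
  with assms have n1: "n \<ge> 1" by simp
  have "(\<integral>w. of_real (ln ((norm w)\<^sup>2)) * (w powi i * cnj w powi j) \<partial>dA)
     = of_real (\<integral>w. ((norm w)\<^sup>2) ^ n * ln ((norm w)\<^sup>2) \<partial>dA)"
    unfolding n powi_cnj_powi_self of_real_mult[symmetric]
    by (subst integral_complex_of_real) (simp add: mult.commute)
  also have "(\<integral>w. ((norm w)\<^sup>2) ^ n * ln ((norm w)\<^sup>2) \<partial>dA) = - (1 / (n + 1)\<^sup>2)"
    by (rule dA_radial_integral[where b = 1])
      (use n1 has_integral_power_ln[of n] abs_power_ln_le in \<open>auto simp: add.commute\<close>)
  finally show ?thesis using n by (simp add: add.commute)
next
  case False
  have [measurable]: "(\<lambda>x::real. complex_of_real (ln (x\<^sup>2))) \<in> borel_measurable borel" by measurable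
  show ?thesis
    using dA_integral_radial_times_monomial_offdiag[of "\<lambda>x. of_real (ln (x\<^sup>2))" i j] False by simp
qed

lemma norm_powi_cnj_powi_le:
  assumes "norm w < 1" "w \<noteq> 0" "i + j \<ge> 0"
  shows "norm (w powi i * cnj w powi j) \<le> 1"
proof -
  have "norm (w powi i * cnj w powi j) = norm w powi (i + j)"
    using assms by (simp add: norm_mult norm_power_int power_int_add)
  then show ?thesis using assms by (simp add: power_int_le_one)
qed

section \<open>Integrals against the Bergman kernel\<close>

text \<open>The Bergman projection extended to integrable functions, as an unrestricted integral: unlike
  \<open>toeplitz\<close> it is not cut off outside the disk, which keeps the algebra free of case distinctions.\<close>

definition bergman_integral :: "(complex \<Rightarrow> complex) \<Rightarrow> complex \<Rightarrow> complex" where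
  "bergman_integral E z = (\<integral>w. E w / (1 - cnj w * z)\<^sup>2 \<partial>dA)"

lemma toeplitz_eq_bergman_integral:
  "norm z < 1 \<Longrightarrow> toeplitz f h z = bergman_integral (\<lambda>w. f w * h w) z"
  by (simp add: toeplitz_def bergman_integral_def)

lemma toeplitz_outside: "\<not> norm z < 1 \<Longrightarrow> toeplitz f h z = 0"
  by (simp add: toeplitz_def)

lemma measurable_pow_cnj [measurable]:
  "(\<lambda>w. cnj w ^ k) \<in> borel_measurable dA" "(\<lambda>w. w ^ k) \<in> borel_measurable dA"
  by (rule borel_measurable_dA, simp)+

lemma integrable_mult_cnj_power:
  "integrable dA E \<Longrightarrow> integrable dA (\<lambda>w. E w * cnj w ^ k)"
  by (rule integrable_dA_mult_bounded[where b = 1]) (auto simp: norm_power power_le_one)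

lemma integrable_mult_power:
  "integrable dA E \<Longrightarrow> integrable dA (\<lambda>w. E w * w ^ k)"
  by (rule integrable_dA_mult_bounded[where b = 1]) (auto simp: norm_power power_le_one)

lemma integrable_mult_bergman_kernel:
  assumes E: "integrable dA E" and z: "norm z < 1"
  shows "integrable dA (\<lambda>w. E w / (1 - cnj w * z)\<^sup>2)"
proof -
  have "integrable dA (\<lambda>w. E w * (1 / (1 - cnj w * z)\<^sup>2))"
  proof (rule integrable_dA_mult_bounded[OF E])
    show "(\<lambda>w. 1 / (1 - cnj w * z)\<^sup>2) \<in> borel_measurable dA"
      by (rule borel_measurable_dA) measurable
    fix w :: complex assume w: "norm w < 1"
    have "norm (cnj w * z) \<le> norm z"
      using w by (simp add: norm_mult mult_left_le_one_le)
    then have "1 - norm z \<le> norm (1 - cnj w * z)"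
      using norm_triangle_ineq2[of 1 "cnj w * z"] by simp
    then have "(1 - norm z)\<^sup>2 \<le> (norm (1 - cnj w * z))\<^sup>2"
      using z by (intro power_mono) auto
    then show "norm (1 / (1 - cnj w * z)\<^sup>2) \<le> 1 / (1 - norm z)\<^sup>2"
      using z by (simp add: norm_divide norm_power frac_le)
  qed
  then show ?thesis by simp
qed

lemma bergman_integral_cong:
  assumes "AE w in dA. f w = g w" "f \<in> borel_measurable dA" "g \<in> borel_measurable dA"
  shows "bergman_integral f z = bergman_integral g z"
proof -
  have [measurable]: "(\<lambda>w. (1 - cnj w * z)\<^sup>2) \<in> borel_measurable dA"
    by (rule borel_measurable_dA) measurable
  show ?thesis unfolding bergman_integral_def
    by (rule integral_cong_AE) (use assms in \<open>auto elim: eventually_mono\<close>)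
qed

lemma bergman_integral_linear:
  assumes "\<And>x. x \<in> X \<Longrightarrow> integrable dA (f x)" "norm z < 1"
  shows "bergman_integral (\<lambda>w. \<Sum>x\<in>X. c x * f x w) z = (\<Sum>x\<in>X. c x * bergman_integral (f x) z)"
proof -
  have "bergman_integral (\<lambda>w. \<Sum>x\<in>X. c x * f x w) z
    = (\<integral>w. (\<Sum>x\<in>X. c x * (f x w / (1 - cnj w * z)\<^sup>2)) \<partial>dA)"
    by (simp add: bergman_integral_def sum_divide_distrib)
  also have "\<dots> = (\<Sum>x\<in>X. \<integral>w. c x * (f x w / (1 - cnj w * z)\<^sup>2) \<partial>dA)"
    by (rule Bochner_Integration.integral_sum)
       (auto intro!: integrable_mult_right integrable_mult_bergman_kernel assms)
  finally show ?thesis by (simp only: bergman_integral_def integral_mult_right_zero)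
qed

text \<open>Expanding the kernel as the derivative of a geometric series and integrating termwise shows that the moments
  against powers of \<open>cnj w\<close> are, up to the factors \<open>k + 1\<close>, the Taylor coefficients.\<close>

lemma bergman_integral_sums:
  assumes E: "integrable dA E" and z: "norm z < 1"
  shows "(\<lambda>k. (of_nat (Suc k) * (\<integral>w. E w * cnj w ^ k \<partial>dA)) * z ^ k) sums bergman_integral E z"
proof -
  let ?f = "\<lambda>k w. E w * (of_nat (Suc k) * (cnj w * z) ^ k)"
  have geom: "summable (\<lambda>k. of_nat (Suc k) * norm u ^ k :: real)" if "norm u < 1" for u :: complex
    using geometric_deriv_sums[of "norm u"] that by (simp add: sums_iff)
  have ptw: "(\<lambda>k. ?f k w) sums (E w / (1 - cnj w * z)\<^sup>2)" if "norm w < 1" for w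
  proof -
    have "norm (cnj w * z) \<le> norm z"
      using that by (simp add: norm_mult mult_left_le_one_le)
    with z have "norm (cnj w * z) < 1" by linarith
    then show ?thesis
      using sums_mult[OF geometric_deriv_sums, of "cnj w * z" "E w"] by simp
  qed
  have eq: "?f k w = (E w * cnj w ^ k) * (of_nat (Suc k) * z ^ k)" for k w
    by (simp add: power_mult_distrib)
  have int: "integrable dA (?f k)" for k
    unfolding eq by (intro integrable_mult_left integrable_mult_cnj_power E)
  have bound: "norm (?f k w) \<le> norm (E w) * (of_nat (Suc k) * norm z ^ k)" if "norm w < 1" for k w
  proof -
    have "norm w ^ k \<le> 1" using that by (simp add: power_le_one)
    then have "norm (E w) * (of_nat (Suc k) * (norm w ^ k * norm z ^ k))
      \<le> norm (E w) * (of_nat (Suc k) * (1 * norm z ^ k))"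
      by (intro mult_left_mono mult_right_mono) auto
    then show ?thesis by (simp add: norm_mult norm_power power_mult_distrib del: of_nat_Suc)
  qed
  have "(\<lambda>k. integral\<^sup>L dA (?f k)) sums (\<integral>w. (\<Sum>k. ?f k w) \<partial>dA)"
  proof (rule sums_integral[OF int])
    show "AE w in dA. summable (\<lambda>k. norm (?f k w))"
      using AE_dA_disk
    proof eventually_elim
      case (elim w)
      show ?case
        by (rule summable_comparison_test[OF _ summable_mult[OF geom[OF z], of "norm (E w)"]])
           (use bound[OF elim] in auto)
    qed
    have "norm (LINT w|dA. norm (?f k w)) \<le> (LINT w|dA. norm (E w)) * (of_nat (Suc k) * norm z ^ k)" for k
    proof -
      have "(LINT w|dA. norm (?f k w)) \<le> (LINT w|dA. norm (E w) * (of_nat (Suc k) * norm z ^ k))"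
        by (rule integral_mono_AE)
           (use int E bound AE_dA_disk in \<open>auto elim!: eventually_mono intro!: integrable_norm\<close>)
      then show ?thesis by simp
    qed
    then show "summable (\<lambda>k. LINT w|dA. norm (?f k w))"
      by (intro summable_comparison_test[OF _ summable_mult[OF geom[OF z], of "LINT w|dA. norm (E w)"]]) blast
  qed
  also have "(\<integral>w. (\<Sum>k. ?f k w) \<partial>dA) = bergman_integral E z"
    unfolding bergman_integral_def
  proof (rule integral_cong_AE)
    show "AE w in dA. (\<Sum>k. ?f k w) = E w / (1 - cnj w * z)\<^sup>2"
      using AE_dA_disk by eventually_elim (use ptw in \<open>auto simp: sums_iff\<close>)
    show "(\<lambda>w. \<Sum>k. ?f k w) \<in> borel_measurable dA"
      by (rule borel_measurable_suminf) (use int in auto)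
    show "(\<lambda>w. E w / (1 - cnj w * z)\<^sup>2) \<in> borel_measurable dA"
      using integrable_mult_bergman_kernel[OF E z] by auto
  qed
  also have "(\<lambda>k. integral\<^sup>L dA (?f k)) = (\<lambda>k. (of_nat (Suc k) * (\<integral>w. E w * cnj w ^ k \<partial>dA)) * z ^ k)"
  proof
    fix k
    have "integral\<^sup>L dA (?f k) = (\<integral>w. E w * cnj w ^ k \<partial>dA) * (of_nat (Suc k) * z ^ k)"
      unfolding eq by (rule integral_mult_left_zero)
    then show "integral\<^sup>L dA (?f k) = (of_nat (Suc k) * (\<integral>w. E w * cnj w ^ k \<partial>dA)) * z ^ k"
      by (simp only: mult_ac)
  qed
  finally show ?thesis .
qed

lemma power_series_eq_0:
  fixes a :: "nat \<Rightarrow> complex"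
  assumes "\<And>z. norm z < 1 \<Longrightarrow> (\<lambda>k. a k * z ^ k) sums 0"
  shows "a k = 0"
proof (rule ccontr)
  assume k: "a k \<noteq> 0"
  show False
  proof (cases "k = 0")
    case True
    have "a 0 = 0" using assms[of 0] powser_sums_zero_iff[of a 0] by simp
    with k True show False by simp
  next
    case False
    show False
    proof (rule powser_0_nonzero[of 1 0 a "\<lambda>_. 0" k])
      fix s :: real
      assume "0 < s" and "\<And>z. z \<in> cball 0 s - {0::complex} \<Longrightarrow> (0::complex) \<noteq> 0"
      then have "complex_of_real s \<notin> cball 0 s - {0}" by blast
      with \<open>0 < s\<close> show False by simp
    qed (use assms k False in auto)
  qed
qed

text \<open>An integrand that is homogeneous under rotations has at most one nonzero moment, so that the
  integral is a monomial. An integer degree \<open>d\<close> covers the case in which it is \<open>0\<close>.\<close>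

lemma bergman_integral_single:
  assumes E: "integrable dA E" and z: "norm z < 1"
    and m: "\<And>k. (\<integral>w. E w * cnj w ^ k \<partial>dA) = (if int k = d then c else 0)"
  shows "bergman_integral E z = (if d \<ge> 0 then of_int (d + 1) * c * z powi d else 0)"
proof (cases "d \<ge> 0")
  case True
  then obtain n where n: "d = int n" by (metis nonneg_int_cases)
  let ?g = "\<lambda>k. of_nat (Suc k) * c * z ^ k"
  have "(of_nat (Suc k) * (\<integral>w. E w * cnj w ^ k \<partial>dA)) * z ^ k = (if k = n then ?g k else 0)" for k
    by (simp only: m n of_nat_eq_iff) simp
  then have "(\<lambda>k. if k = n then ?g k else 0) sums bergman_integral E z"
    using bergman_integral_sums[OF E z] by presburger
  from sums_unique2[OF this sums_single[of n ?g]]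
  have "bergman_integral E z = ?g n" .
  moreover have "of_int (d + 1) = (of_nat (Suc n) :: complex)" by (simp add: n)
  ultimately show ?thesis using True by (simp only: n power_int_of_nat if_True)
next
  case False
  have "(of_nat (Suc k) * (\<integral>w. E w * cnj w ^ k \<partial>dA)) * z ^ k = 0" for k
    using False by (simp add: m)
  then have "(\<lambda>k. 0) sums bergman_integral E z"
    using bergman_integral_sums[OF E z] by presburger
  from sums_unique2[OF this sums_zero] show ?thesis using False by simp
qed

lemma measurable_monomial [measurable]:
  "(\<lambda>w. w powi i * cnj w powi j) \<in> borel_measurable dA"
  by (rule borel_measurable_dA) measurable

lemma integrable_monomial:
  "i + j \<ge> 0 \<Longrightarrow> integrable dA (\<lambda>w. w powi i * cnj w powi j)"
  by (rule integrable_dA_bounded[OF measurable_monomial norm_powi_cnj_powi_le])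

lemma bergman_integral_monomial:
  assumes ij: "i + j \<ge> 0" and z: "norm z < 1"
  shows "bergman_integral (\<lambda>w. w powi i * cnj w powi j) z
    = (if i \<ge> j then of_int (i - j + 1) / of_int (i + 1) * z powi (i - j) else 0)"
proof -
  have "(\<integral>w. (w powi i * cnj w powi j) * cnj w ^ k \<partial>dA) = (if int k = i - j then 1 / of_int (i + 1) else 0)" for k
  proof -
    have "(\<integral>w. (w powi i * cnj w powi j) * cnj w ^ k \<partial>dA) = (\<integral>w. w powi i * cnj w powi (j + int k) \<partial>dA)"
    proof (rule integral_cong_AE)
      show "AE w in dA. (w powi i * cnj w powi j) * cnj w ^ k = w powi i * cnj w powi (j + int k)"
        using AE_dA_nonzero by eventually_elim (simp add: power_int_add)
    qed (intro borel_measurable_times measurable_monomial measurable_pow_cnj)+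
    also have "\<dots> = (if int k = i - j then 1 / of_int (i + 1) else 0)"
      using ij by (subst moment_monomial) auto
    finally show ?thesis .
  qed
  then have "bergman_integral (\<lambda>w. w powi i * cnj w powi j) z
    = (if i - j \<ge> 0 then of_int (i - j + 1) * (1 / of_int (i + 1)) * z powi (i - j) else 0)"
    by (rule bergman_integral_single[OF integrable_monomial[OF ij] z])
  then show ?thesis by (simp only: diff_ge_0_iff_ge times_divide_eq_right mult_1_right)
qed

lemma norm_log_monomial_le:
  assumes w: "norm w < 1" "w \<noteq> 0" and n: "n \<ge> 1"
  shows "norm (complex_of_real (ln ((norm w)\<^sup>2)) * w ^ n) \<le> 2"
proof -
  have "norm (complex_of_real (ln ((norm w)\<^sup>2)) * w ^ n) = 2 * \<bar>norm w ^ n * ln (norm w)\<bar>"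
    using w by (simp add: norm_mult norm_power ln_realpow abs_mult)
  moreover have "\<bar>norm w ^ n * ln (norm w)\<bar> \<le> 1"
    by (rule abs_power_ln_le) (use w n in auto)
  ultimately show ?thesis by linarith
qed

lemma integrable_log_monomial:
  assumes "n \<ge> 1"
  shows "integrable dA (\<lambda>w. complex_of_real (ln ((norm w)\<^sup>2)) * w ^ n)"
proof (rule integrable_dA_bounded[where b = 2])
  show "(\<lambda>w. complex_of_real (ln ((norm w)\<^sup>2)) * w ^ n) \<in> borel_measurable dA"
    by (rule borel_measurable_dA) simp
next
  fix w :: complex assume "norm w < 1" "w \<noteq> 0"
  then show "norm (complex_of_real (ln ((norm w)\<^sup>2)) * w ^ n) \<le> 2"
    using assms by (rule norm_log_monomial_le)
qed

lemma bergman_integral_log_monomial: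
  assumes n: "n \<ge> 1" and z: "norm z < 1"
  shows "bergman_integral (\<lambda>w. complex_of_real (ln ((norm w)\<^sup>2)) * w ^ n) z = - (z ^ n) / of_nat (n + 1)"
proof -
  have "(\<integral>w. (complex_of_real (ln ((norm w)\<^sup>2)) * w ^ n) * cnj w ^ k \<partial>dA)
     = (if int k = int n then - 1 / (of_nat (n + 1))\<^sup>2 else 0)" for k
  proof -
    have "(\<integral>w. (complex_of_real (ln ((norm w)\<^sup>2)) * w ^ n) * cnj w ^ k \<partial>dA)
      = (\<integral>w. of_real (ln ((norm w)\<^sup>2)) * (w powi int n * cnj w powi int k) \<partial>dA)"
      by (simp only: power_int_of_nat mult.assoc)
    also have "\<dots> = (if int n = int k then - 1 / (of_int (int n + 1))\<^sup>2 else 0)"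
      by (rule moment_log_monomial) (use n in linarith)
    also have "of_int (int n + 1) = (of_nat (n + 1) :: complex)" by simp
    also have "(int n = int k) = (int k = int n)" by (rule eq_commute)
    finally show ?thesis .
  qed
  then have "bergman_integral (\<lambda>w. complex_of_real (ln ((norm w)\<^sup>2)) * w ^ n) z
    = (if 0 \<le> int n then of_int (int n + 1) * (- 1 / (of_nat (n + 1))\<^sup>2) * z powi (int n) else 0)"
    by (intro bergman_integral_single[where d = "int n" and c = "- 1 / (of_nat (n + 1))\<^sup>2"]
      integrable_log_monomial n z)
  also have "\<dots> = of_nat (n + 1) * (- 1 / (of_nat (n + 1))\<^sup>2) * z ^ n"
  proof -
    have "of_int (int n + 1) = (of_nat (n + 1) :: complex)" by simp
    then show ?thesis by (simp only: of_nat_0_le_iff if_True power_int_of_nat)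
  qed
  also have "\<dots> = - (z ^ n) / of_nat (n + 1)"
  proof -
    have "c * (- 1 / c\<^sup>2) * z ^ n = - (z ^ n) / c" if "c \<noteq> 0" for c :: complex
      using that by (simp add: power2_eq_square)
    moreover have "(of_nat (n + 1) :: complex) \<noteq> 0" by (simp only: of_nat_eq_0_iff)
    ultimately show ?thesis by blast
  qed
  finally show ?thesis .
qed

section \<open>The symbol of a product of Toeplitz operators\<close>

text \<open>The solution of \<open>G_z = a z^(a-b-1)\<close>, \<open>G_zbar = b (cnj z)^(b-a-1)\<close> with value \<open>1\<close> at \<open>1\<close>.
  The logarithm is the limiting case \<open>b \<longrightarrow> a\<close> of the general formula.\<close>

definition symbol_term :: "int \<Rightarrow> int \<Rightarrow> complex \<Rightarrow> complex" where
  "symbol_term a b w =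
     (if a = b then 1 + of_int a * of_real (ln ((norm w)\<^sup>2))
      else (of_int a * w powi (a - b) - of_int b * cnj w powi (b - a)) / of_int (a - b))"

lemma measurable_symbol_term: "symbol_term a b \<in> borel_measurable borel"
  unfolding symbol_term_def by (cases "a = b") simp_all

lemma symbol_term_times_power:
  assumes w: "w \<noteq> 0"
  shows "symbol_term a b w * w ^ n =
     (if a = b then w powi int n * cnj w powi 0 + of_int a * (of_real (ln ((norm w)\<^sup>2)) * w ^ n)
      else of_int a / of_int (a - b) * (w powi (int n + a - b) * cnj w powi 0)
         - of_int b / of_int (a - b) * (w powi int n * cnj w powi (b - a)))"
proof (cases "a = b")
  case False
  have "w powi (int n + a - b) = w powi (a - b) * w ^ n"
    using w by (simp add: power_int_add[symmetric] flip: power_int_of_nat) (simp add: algebra_simps)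
  then show ?thesis using False by (simp add: symbol_term_def diff_divide_distrib left_diff_distrib right_diff_distrib mult_ac)
qed (simp add: symbol_term_def field_simps)

lemma bergman_integral_add:
  assumes "integrable dA f" "integrable dA g" "norm z < 1"
  shows "bergman_integral (\<lambda>w. c * f w + d * g w) z = c * bergman_integral f z + d * bergman_integral g z"
  using bergman_integral_linear[of "{True, False}" "\<lambda>x. if x then f else g" z "\<lambda>x. if x then c else d"] assms
  by simp

text \<open>For \<open>a \<noteq> b\<close> the two monomials contribute \<open>a / (a - b)\<close> and \<open>- b (n + 1 + a - b) / ((a - b) (n + 1))\<close>
  to the coefficient, and for \<open>a = b\<close> the constant and the logarithm contribute \<open>1\<close> and \<open>- a / (n + 1)\<close>;
  both sums equal \<open>(n - b + 1) / (n + 1)\<close>. The bound on \<open>n\<close> makes every integrand bounded and every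
  image a nonnegative power.\<close>

lemma symbol_term_power:
  assumes n: "int n \<ge> \<bar>a\<bar> + \<bar>b\<bar> + 1"
  shows integrable_symbol_term_power: "integrable dA (\<lambda>w. symbol_term a b w * w ^ n)"
    and bergman_integral_symbol_term_power:
      "norm z < 1 \<Longrightarrow> bergman_integral (\<lambda>w. symbol_term a b w * w ^ n) z
         = of_int (int n - b + 1) / of_int (int n + 1) * z powi (int n + a - b)"
proof -
  \<comment> \<open>a common shape \<open>c f + d g\<close> for the two cases of the definition\<close>
  define f where "f w = w powi (if a = b then int n else int n + a - b) * cnj w powi 0" for w :: complex
  define g where "g w = (if a = b then of_real (ln ((norm w)\<^sup>2)) * w ^ n else w powi int n * cnj w powi (b - a))"
    for w :: complex
  define c d :: complex where "c = (if a = b then 1 else of_int a / of_int (a - b))"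
    and "d = (if a = b then of_int a else - of_int b / of_int (a - b))"
  have n1: "n \<ge> 1" using n by linarith
  have f: "integrable dA f"
    unfolding f_def by (rule integrable_monomial) (use n in auto)
  have g: "integrable dA g"
  proof (cases "a = b")
    case True
    then have "g = (\<lambda>w. of_real (ln ((norm w)\<^sup>2)) * w ^ n)" by (simp add: g_def fun_eq_iff)
    then show ?thesis using integrable_log_monomial[OF n1] by simp
  next
    case False
    have "integrable dA (\<lambda>w. w powi int n * cnj w powi (b - a))"
      by (rule integrable_monomial) (use n in auto)
    moreover have "g = (\<lambda>w. w powi int n * cnj w powi (b - a))" using False by (simp add: g_def fun_eq_iff)
    ultimately show ?thesis by simp
  qed
  have cfdg: "integrable dA (\<lambda>w. c * f w + d * g w)"
    by (intro Bochner_Integration.integrable_add integrable_mult_right f g)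
  have eq: "symbol_term a b w * w ^ n = c * f w + d * g w" if "w \<noteq> 0" for w
    unfolding symbol_term_times_power[OF that] by (simp add: c_def d_def f_def g_def)
  have ae: "AE w in dA. symbol_term a b w * w ^ n = c * f w + d * g w"
    using AE_dA_nonzero by eventually_elim (rule eq)
  have meas: "(\<lambda>w. symbol_term a b w * w ^ n) \<in> borel_measurable dA"
    by (intro borel_measurable_times borel_measurable_dA[OF measurable_symbol_term] measurable_pow_cnj)
  show "integrable dA (\<lambda>w. symbol_term a b w * w ^ n)"
    by (rule integrable_cong_AE_imp[OF cfdg meas]) (use ae in \<open>auto elim: eventually_mono\<close>)
  assume z: "norm z < 1"
  have "bergman_integral (\<lambda>w. symbol_term a b w * w ^ n) z = c * bergman_integral f z + d * bergman_integral g z"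
    by (subst bergman_integral_cong[OF ae meas borel_measurable_integrable[OF cfdg]])
       (rule bergman_integral_add[OF f g z])
  also have "\<dots> = of_int (int n - b + 1) / of_int (int n + 1) * z powi (int n + a - b)"
  proof (cases "a = b")
    case True
    have f_eq: "f = (\<lambda>w. w powi int n * cnj w powi 0)"
      and g_eq: "g = (\<lambda>w. of_real (ln ((norm w)\<^sup>2)) * w ^ n)"
      using True by (simp_all add: f_def g_def fun_eq_iff)
    have "bergman_integral f z = of_int (int n - 0 + 1) / of_int (int n + 1) * z powi (int n - 0)"
      using bergman_integral_monomial[of "int n" 0 z] z by (simp only: f_eq) simp
    then have "bergman_integral f z = z ^ n"
      using of_nat_neq_0[of n, where 'a = complex] by (simp add: add.commute)
    moreover have "bergman_integral g z = - (z ^ n) / of_nat (n + 1)"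
      unfolding g_eq by (rule bergman_integral_log_monomial[OF n1 z])
    moreover have "x + k * (- x / m) = (m - k) / m * x" if "m \<noteq> 0" for x k m :: complex
      using that by (simp add: field_simps)
    from this[of "of_nat (n + 1)" "z ^ n" "of_int b"] have
      "z ^ n + of_int b * (- (z ^ n) / of_nat (n + 1)) = (of_nat (n + 1) - of_int b) / of_nat (n + 1) * z ^ n"
      using of_nat_neq_0[of n] by simp
    ultimately show ?thesis using True by (simp add: c_def d_def algebra_simps)
  next
    case False
    have nz: "of_int (int n + 1) \<noteq> (0 :: complex)" "of_int (a - b) \<noteq> (0 :: complex)"
      using False by (simp_all only: of_int_eq_0_iff)
    have pos: "int n + a - b + 1 > 0" using n by linarith
    then have nz2: "of_int (int n + a - b + 1) \<noteq> (0 :: complex)"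
      by (simp only: of_int_eq_0_iff)
    have f_eq: "f = (\<lambda>w. w powi (int n + a - b) * cnj w powi 0)"
      and g_eq: "g = (\<lambda>w. w powi int n * cnj w powi (b - a))"
      using False by (simp_all add: f_def g_def fun_eq_iff)
    have "bergman_integral f z
      = of_int (int n + a - b - 0 + 1) / of_int (int n + a - b + 1) * z powi (int n + a - b - 0)"
      unfolding f_eq by (subst bergman_integral_monomial) (use n z in auto)
    then have "bergman_integral f z = z powi (int n + a - b)"
      using nz2 by (simp only: diff_0_right divide_self[OF nz2] mult_1)
    moreover have "bergman_integral g z
      = (of_int (int n + 1) + of_int (a - b)) / of_int (int n + 1) * z powi (int n + a - b)"
    proof -
      have "bergman_integral g z
        = of_int (int n - (b - a) + 1) / of_int (int n + 1) * z powi (int n - (b - a))"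
        unfolding g_eq by (subst bergman_integral_monomial) (use n z in auto)
      also have "int n - (b - a) = int n + a - b" by simp
      also have "of_int (int n + a - b + 1) = of_int (int n + 1) + (of_int (a - b) :: complex)" by simp
      finally show ?thesis .
    qed
    moreover have "A / e * x + - B / e * ((m + e) / m * x) = (m - B) / m * x"
      if "m \<noteq> 0" "e \<noteq> 0" "e = A - B" for A B e m x :: complex
    proof -
      have "A = e + B" using that by simp
      then show ?thesis using that(1,2) by (simp add: field_simps)
    qed
    from this[OF nz, of "of_int a" "of_int b" "z powi (int n + a - b)"] have
      "of_int a / of_int (a - b) * z powi (int n + a - b) + - of_int b / of_int (a - b) *
        ((of_int (int n + 1) + of_int (a - b)) / of_int (int n + 1) * z powi (int n + a - b))
       = (of_int (int n + 1) - of_int b) / of_int (int n + 1) * z powi (int n + a - b)"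
      by simp
    ultimately show ?thesis using False by (simp add: c_def d_def algebra_simps)
  qed
  finally show "bergman_integral (\<lambda>w. symbol_term a b w * w ^ n) z
         = of_int (int n - b + 1) / of_int (int n + 1) * z powi (int n + a - b)" .
qed

definition laurent :: "int set \<Rightarrow> (int \<Rightarrow> complex) \<Rightarrow> complex \<Rightarrow> complex" where
  "laurent S p z = (\<Sum>m\<in>S. p m * z powi m)"

text \<open>The degree \<open>n - b\<close> is nonnegative for every exponent \<open>b\<close> of \<open>Q\<close>, so no term is annihilated.\<close>

lemma toeplitz_cnj_laurent_power:
  assumes "finite R" and n: "\<And>b. b \<in> R \<Longrightarrow> int n \<ge> \<bar>b\<bar>" and z: "norm z < 1"
  shows "toeplitz (\<lambda>w. cnj (laurent R q w)) (\<lambda>w. w ^ n) z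
    = (\<Sum>b\<in>R. cnj (q b) * (of_int (int n - b + 1) / of_int (int n + 1) * z powi (int n - b)))"
proof -
  have "(\<lambda>w. cnj (laurent R q w) * w ^ n) = (\<lambda>w. \<Sum>b\<in>R. cnj (q b) * (w powi int n * cnj w powi b))"
    by (simp add: laurent_def sum_distrib_left mult_ac fun_eq_iff)
  then have "toeplitz (\<lambda>w. cnj (laurent R q w)) (\<lambda>w. w ^ n) z
    = bergman_integral (\<lambda>w. \<Sum>b\<in>R. cnj (q b) * (w powi int n * cnj w powi b)) z"
    using z by (simp add: toeplitz_eq_bergman_integral)
  also have "\<dots> = (\<Sum>b\<in>R. cnj (q b) * bergman_integral (\<lambda>w. w powi int n * cnj w powi b) z)"
    by (rule bergman_integral_linear[OF integrable_monomial z]) (use n in force)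
  also have "\<dots> = (\<Sum>b\<in>R. cnj (q b) * (of_int (int n - b + 1) / of_int (int n + 1) * z powi (int n - b)))"
  proof (rule sum.cong[OF refl])
    fix b assume b: "b \<in> R"
    have "int n + b \<ge> 0" "b \<le> int n" using n[OF b] by linarith+
    then show "cnj (q b) * bergman_integral (\<lambda>w. w powi int n * cnj w powi b) z
      = cnj (q b) * (of_int (int n - b + 1) / of_int (int n + 1) * z powi (int n - b))"
      by (simp only: bergman_integral_monomial[OF _ z] if_True)
  qed
  finally show ?thesis .
qed

lemma toeplitz_laurent_sum_powi:
  assumes "finite S" "finite R" and n: "\<And>a b. a \<in> S \<Longrightarrow> b \<in> R \<Longrightarrow> int n \<ge> \<bar>a\<bar> + \<bar>b\<bar>"
    and z: "norm z < 1" and h: "\<And>w. norm w < 1 \<Longrightarrow> h w = (\<Sum>b\<in>R. c b * w powi (int n - b))"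
    and hm: "h \<in> borel_measurable dA"
  shows "toeplitz (laurent S p) h z = (\<Sum>a\<in>S. \<Sum>b\<in>R. p a * c b * z powi (int n + a - b))"
proof -
  let ?t = "\<lambda>x w. w powi (int n + fst x - snd x) * cnj w powi 0"
  have int: "integrable dA (?t x)" if "x \<in> S \<times> R" for x
    by (rule integrable_monomial) (use n[of "fst x" "snd x"] that in auto)
  have ae: "AE w in dA. laurent S p w * h w = (\<Sum>x\<in>S \<times> R. p (fst x) * c (snd x) * ?t x w)"
    using AE_dA_disk AE_dA_nonzero
  proof eventually_elim
    case (elim w)
    have "w powi a * w powi (int n - b) = w powi (int n + a - b)" for a b
      using elim by (simp add: power_int_add[symmetric] algebra_simps)
    then show ?case
      using elim by (simp add: h laurent_def sum_product sum.cartesian_product mult_ac case_prod_unfold)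
  qed
  have "toeplitz (laurent S p) h z = bergman_integral (\<lambda>w. laurent S p w * h w) z"
    by (rule toeplitz_eq_bergman_integral[OF z])
  also have "\<dots> = bergman_integral (\<lambda>w. \<Sum>x\<in>S \<times> R. p (fst x) * c (snd x) * ?t x w) z"
  proof (rule bergman_integral_cong[OF ae])
    have "laurent S p \<in> borel_measurable dA"
      unfolding laurent_def by (rule borel_measurable_dA) simp
    then show "(\<lambda>w. laurent S p w * h w) \<in> borel_measurable dA"
      using hm by (rule borel_measurable_times)
    show "(\<lambda>w. \<Sum>x\<in>S \<times> R. p (fst x) * c (snd x) * ?t x w) \<in> borel_measurable dA"
      by (rule borel_measurable_dA) simp
  qed
  also have "\<dots> = (\<Sum>x\<in>S \<times> R. p (fst x) * c (snd x) * bergman_integral (?t x) z)"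
    by (rule bergman_integral_linear[OF int z])
  also have "\<dots> = (\<Sum>x\<in>S \<times> R. p (fst x) * c (snd x) * z powi (int n + fst x - snd x))"
  proof (rule sum.cong[OF refl])
    fix x assume x: "x \<in> S \<times> R"
    then have k: "int n + fst x - snd x + 0 \<ge> 0" using n[of "fst x" "snd x"] by auto
    then have nz: "of_int (int n + fst x - snd x + 1) \<noteq> (0 :: complex)"
      by (simp only: of_int_eq_0_iff)
    have "bergman_integral (?t x) z = z powi (int n + fst x - snd x)"
      using bergman_integral_monomial[OF k z] k nz by simp
    then show "p (fst x) * c (snd x) * bergman_integral (?t x) z
      = p (fst x) * c (snd x) * z powi (int n + fst x - snd x)" by simp
  qed
  also have "\<dots> = (\<Sum>a\<in>S. \<Sum>b\<in>R. p a * c b * z powi (int n + a - b))"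
    by (simp add: sum.cartesian_product case_prod_unfold)
  finally show ?thesis .
qed

definition product_symbol ::
  "int set \<Rightarrow> (int \<Rightarrow> complex) \<Rightarrow> int set \<Rightarrow> (int \<Rightarrow> complex) \<Rightarrow> complex \<Rightarrow> complex" where
  "product_symbol S p R q w = (\<Sum>a\<in>S. \<Sum>b\<in>R. p a * cnj (q b) * symbol_term a b w)"

lemma product_symbol_power:
  assumes fin: "finite S" "finite R" and n: "\<And>a b. a \<in> S \<Longrightarrow> b \<in> R \<Longrightarrow> int n \<ge> \<bar>a\<bar> + \<bar>b\<bar> + 1"
  shows integrable_product_symbol_power: "integrable dA (\<lambda>w. product_symbol S p R q w * w ^ n)"
    and bergman_integral_product_symbol_power:
      "norm z < 1 \<Longrightarrow> bergman_integral (\<lambda>w. product_symbol S p R q w * w ^ n) z =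
        (\<Sum>a\<in>S. \<Sum>b\<in>R. p a * cnj (q b) * (of_int (int n - b + 1) / of_int (int n + 1) * z powi (int n + a - b)))"
proof -
  let ?t = "\<lambda>x w. symbol_term (fst x) (snd x) w * w ^ n"
  have eq: "(\<lambda>w. product_symbol S p R q w * w ^ n) = (\<lambda>w. \<Sum>x\<in>S \<times> R. p (fst x) * cnj (q (snd x)) * ?t x w)"
    by (simp add: product_symbol_def sum_distrib_right sum.cartesian_product case_prod_unfold mult.assoc)
  have int: "integrable dA (?t x)" if "x \<in> S \<times> R" for x
    by (rule integrable_symbol_term_power) (use n that in auto)
  show "integrable dA (\<lambda>w. product_symbol S p R q w * w ^ n)"
    unfolding eq by (intro Bochner_Integration.integrable_sum integrable_mult_right int)
  assume z: "norm z < 1"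
  have "bergman_integral (\<lambda>w. product_symbol S p R q w * w ^ n) z
     = (\<Sum>x\<in>S \<times> R. p (fst x) * cnj (q (snd x)) * bergman_integral (?t x) z)"
    unfolding eq by (rule bergman_integral_linear[OF int z])
  also have "\<dots> = (\<Sum>x\<in>S \<times> R. p (fst x) * cnj (q (snd x)) *
      (of_int (int n - snd x + 1) / of_int (int n + 1) * z powi (int n + fst x - snd x)))"
  proof (rule sum.cong[OF refl])
    fix x assume "x \<in> S \<times> R"
    then have "int n \<ge> \<bar>fst x\<bar> + \<bar>snd x\<bar> + 1" using n by auto
    from bergman_integral_symbol_term_power[OF this z]
    show "p (fst x) * cnj (q (snd x)) * bergman_integral (?t x) z = p (fst x) * cnj (q (snd x)) *
      (of_int (int n - snd x + 1) / of_int (int n + 1) * z powi (int n + fst x - snd x))" by (simp only:)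
  qed
  finally show "bergman_integral (\<lambda>w. product_symbol S p R q w * w ^ n) z =
        (\<Sum>a\<in>S. \<Sum>b\<in>R. p a * cnj (q b) * (of_int (int n - b + 1) / of_int (int n + 1) * z powi (int n + a - b)))"
    by (simp add: sum.cartesian_product case_prod_unfold)
qed

text \<open>Both sides have the coefficients \<open>p a cnj (q b) (n - b + 1) / (n + 1)\<close>: composing with the operator of
  symbol \<open>z^a\<close> only shifts the exponent. The assumptions with and without \<open>a\<close> are separate because
  \<open>S\<close> may be empty.\<close>

lemma toeplitz_product_power:
  assumes fin: "finite S" "finite R" and n: "\<And>a b. a \<in> S \<Longrightarrow> b \<in> R \<Longrightarrow> int n \<ge> \<bar>a\<bar> + \<bar>b\<bar> + 1"
    and n': "\<And>b. b \<in> R \<Longrightarrow> int n \<ge> \<bar>b\<bar>" and z: "norm z < 1"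
  shows "toeplitz (laurent S p) (toeplitz (\<lambda>w. cnj (laurent R q w)) (\<lambda>w. w ^ n)) z
    = bergman_integral (\<lambda>w. product_symbol S p R q w * w ^ n) z"
proof -
  let ?c = "\<lambda>b. cnj (q b) * (of_int (int n - b + 1) / of_int (int n + 1))"
  let ?h = "toeplitz (\<lambda>w. cnj (laurent R q w)) (\<lambda>w. w ^ n)"
  have h: "?h w = (\<Sum>b\<in>R. ?c b * w powi (int n - b))" if "norm w < 1" for w
    using toeplitz_cnj_laurent_power[OF fin(2) n' that] by (simp only: mult.assoc)
  have "?h = (\<lambda>w. if norm w < 1 then \<Sum>b\<in>R. ?c b * w powi (int n - b) else 0)"
    using h toeplitz_outside by fastforce
  moreover have "\<dots> \<in> borel_measurable dA"
    by (rule borel_measurable_dA) simp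
  ultimately have hm: "?h \<in> borel_measurable dA" by simp
  have "toeplitz (laurent S p) ?h z = (\<Sum>a\<in>S. \<Sum>b\<in>R. p a * ?c b * z powi (int n + a - b))"
    by (rule toeplitz_laurent_sum_powi[OF fin _ z h hm]) (use n in fastforce)
  also have "\<dots> = bergman_integral (\<lambda>w. product_symbol S p R q w * w ^ n) z"
    by (subst bergman_integral_product_symbol_power[OF fin n z]) (simp_all only: mult.assoc)
  finally show ?thesis .
qed

section \<open>The system of differential equations\<close>

lemma wirtinger_of_has_derivative:
  assumes "(f has_derivative (\<lambda>h. A * h + B * cnj h)) (at z)"
  shows "f differentiable (at z)" "wirtinger_z f z = A" "wirtinger_zbar f z = B"
proof -
  show "f differentiable (at z)" using assms by (rule differentiableI)
  have "frechet_derivative f (at z) = (\<lambda>h. A * h + B * cnj h)"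
    using frechet_derivative_at[OF assms] by simp
  then show "wirtinger_z f z = A" "wirtinger_zbar f z = B"
    by (simp_all add: wirtinger_z_def wirtinger_zbar_def algebra_simps)
qed

text \<open>A real-linear map of the plane is determined by its values at \<open>1\<close> and \<open>\<i>\<close>, hence a real derivative by
  the two Wirtinger derivatives.\<close>

lemma has_derivative_of_wirtinger:
  assumes "f differentiable (at z)"
  shows "(f has_derivative (\<lambda>h. wirtinger_z f z * h + wirtinger_zbar f z * cnj h)) (at z)"
proof -
  let ?D = "frechet_derivative f (at z)"
  have D: "(f has_derivative ?D) (at z)" using assms by (simp add: frechet_derivative_works)
  then have lin: "linear ?D" by (rule has_derivative_linear)
  have "?D h = wirtinger_z f z * h + wirtinger_zbar f z * cnj h" for h
  proof -
    have "h = Re h *\<^sub>R 1 + Im h *\<^sub>R \<i>" by (simp add: complex_eq_iff)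
    then have "?D h = Re h *\<^sub>R ?D 1 + Im h *\<^sub>R ?D \<i>"
      by (metis linear_add[OF lin] linear_scale[OF lin])
    moreover have "cnj h = of_real (Re h) - \<i> * of_real (Im h)" "h = of_real (Re h) + \<i> * of_real (Im h)"
      by (simp_all add: complex_eq_iff)
    moreover have "of_real x * d + of_real y * e = (d - \<i> * e) / 2 * (of_real x + \<i> * of_real y) +
        (d + \<i> * e) / 2 * (of_real x - \<i> * of_real y)" for x y :: real and d e :: complex
      by (simp add: field_simps)
    ultimately show ?thesis
      by (metis wirtinger_z_def wirtinger_zbar_def scaleR_conv_of_real)
  qed
  then have "?D = (\<lambda>h. wirtinger_z f z * h + wirtinger_zbar f z * cnj h)" by blast
  with D show ?thesis by simp
qed

text \<open>The difference has derivative \<open>0\<close> on the punctured plane, which is connected.\<close>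

lemma wirtinger_determines_function:
  assumes f: "\<And>z. z \<noteq> 0 \<Longrightarrow> f differentiable (at z)" and g: "\<And>z. z \<noteq> 0 \<Longrightarrow> g differentiable (at z)"
    and eq: "\<And>z. z \<noteq> 0 \<Longrightarrow> wirtinger_z f z = wirtinger_z g z"
      "\<And>z. z \<noteq> 0 \<Longrightarrow> wirtinger_zbar f z = wirtinger_zbar g z"
    and "f 1 = g 1" "z \<noteq> 0"
  shows "f z = g z"
proof -
  have "f z - g z = f 1 - g 1"
  proof (rule has_derivative_zero_unique_connected[where f = "\<lambda>z. f z - g z" and s = "- {0}"])
    show "connected (- {0::complex})" by (rule connected_punctured_universe) simp
    fix x :: complex assume "x \<in> - {0}"
    then have x: "x \<noteq> 0" by simp
    show "((\<lambda>z. f z - g z) has_derivative (\<lambda>x. 0)) (at x)"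
      using has_derivative_diff[OF has_derivative_of_wirtinger[OF f[OF x]] has_derivative_of_wirtinger[OF g[OF x]]]
      by (simp add: eq[OF x])
  qed (use assms in auto)
  with assms show ?thesis by simp
qed

lemma has_derivative_powi_complex:
  assumes "z \<noteq> (0::complex)"
  shows "((\<lambda>w. w powi m) has_derivative (\<lambda>h. of_int m * z powi (m - 1) * h)) (at z)"
    and "((\<lambda>w. cnj w powi m) has_derivative (\<lambda>h. of_int m * cnj z powi (m - 1) * cnj h)) (at z)"
proof -
  have "((\<lambda>w. w powi m) has_field_derivative of_int m * w powi (m - 1)) (at w)" if "w \<noteq> 0" for w :: complex
    using that by (auto intro!: derivative_eq_intros)
  then have *: "((\<lambda>w. w powi m) has_derivative (\<lambda>h. of_int m * w powi (m - 1) * h)) (at w)"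
    if "w \<noteq> 0" for w :: complex
    using that by (simp add: has_field_derivative_def)
  show "((\<lambda>w. w powi m) has_derivative (\<lambda>h. of_int m * z powi (m - 1) * h)) (at z)"
    by (rule *[OF assms])
  show "((\<lambda>w. cnj w powi m) has_derivative (\<lambda>h. of_int m * cnj z powi (m - 1) * cnj h)) (at z)"
    using has_derivative_compose[OF has_derivative_cnj[OF has_derivative_ident] *] assms by simp
qed

lemma has_derivative_ln_norm_square:
  assumes z: "z \<noteq> (0::complex)"
  shows "((\<lambda>w. complex_of_real (ln ((norm w)\<^sup>2))) has_derivative (\<lambda>h. h / z + cnj h / cnj z)) (at z)"
proof -
  have "((\<lambda>w. w \<bullet> w) has_derivative (\<lambda>h. 2 * (z \<bullet> h))) (at z)"
    by (auto intro!: derivative_eq_intros simp: inner_commute)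
  then have "((\<lambda>w. ln (w \<bullet> w)) has_derivative (\<lambda>h. 2 * (z \<bullet> h) * inverse (z \<bullet> z))) (at z)"
    by (rule has_derivative_ln[rotated]) (use z in auto)
  then have "((\<lambda>w. complex_of_real (ln (w \<bullet> w))) has_derivative
      (\<lambda>h. of_real (2 * (z \<bullet> h) * inverse (z \<bullet> z)))) (at z)"
    by (rule has_derivative_of_real)
  moreover have "complex_of_real (2 * (z \<bullet> h) * inverse (z \<bullet> z)) = h / z + cnj h / cnj z" for h
  proof -
    have "complex_of_real (2 * (z \<bullet> h)) = h * cnj z + cnj h * z"
      by (simp add: complex_eq_iff inner_complex_def)
    moreover have "complex_of_real (z \<bullet> z) = z * cnj z"
      by (simp add: complex_eq_iff inner_complex_def)
    ultimately have "complex_of_real (2 * (z \<bullet> h) * inverse (z \<bullet> z)) = (h * cnj z + cnj h * z) / (z * cnj z)"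
      by (simp add: divide_inverse)
    then show ?thesis using z by (simp add: field_simps)
  qed
  ultimately show ?thesis by (simp add: dot_square_norm)
qed

lemma has_derivative_symbol_term:
  assumes z: "z \<noteq> 0"
  shows "(symbol_term a b has_derivative (\<lambda>h. of_int a * z powi (a - b - 1) * h +
     of_int b * cnj z powi (b - a - 1) * cnj h)) (at z)"
proof (cases "a = b")
  case True
  have "((\<lambda>w. 1 + of_int a * complex_of_real (ln ((norm w)\<^sup>2))) has_derivative
     (\<lambda>h. 0 + of_int a * (h / z + cnj h / cnj z))) (at z)"
    by (intro has_derivative_add has_derivative_const has_derivative_mult_right has_derivative_ln_norm_square z)
  moreover have "symbol_term a b = (\<lambda>w. 1 + of_int a * complex_of_real (ln ((norm w)\<^sup>2)))"
    using True by (simp add: symbol_term_def fun_eq_iff)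
  ultimately show ?thesis using True
    by (simp add: distrib_left divide_inverse power_int_minus mult_ac)
next
  case False
  have nz: "of_int (a - b) \<noteq> (0::complex)" using False by (simp only: of_int_eq_0_iff)
  have "((\<lambda>w. (of_int a * w powi (a - b) - of_int b * cnj w powi (b - a)) / of_int (a - b)) has_derivative
     (\<lambda>h. (of_int a * (of_int (a - b) * z powi (a - b - 1) * h)
        - of_int b * (of_int (b - a) * cnj z powi (b - a - 1) * cnj h)) / of_int (a - b))) (at z)"
    unfolding divide_inverse
    by (intro has_derivative_mult_left has_derivative_diff has_derivative_mult_right has_derivative_powi_complex z)
  moreover have "symbol_term a b = (\<lambda>w. (of_int a * w powi (a - b) - of_int b * cnj w powi (b - a)) / of_int (a - b))"
    using False by (simp add: symbol_term_def fun_eq_iff)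
  moreover have "(A * (e * x) - B * (- e * y)) / e = A * x + B * y" if "e \<noteq> 0" for A B e x y :: complex
    using that by (simp add: field_simps)
  from this[OF nz, of "of_int a" _ "of_int b"]
  have "(of_int a * (of_int (a - b) * z powi (a - b - 1) * h)
        - of_int b * (of_int (b - a) * cnj z powi (b - a - 1) * cnj h)) / of_int (a - b)
     = of_int a * z powi (a - b - 1) * h + of_int b * cnj z powi (b - a - 1) * cnj h" for h
    by (simp add: mult.assoc)
  ultimately show ?thesis by simp
qed

lemma symbol_term_1: "symbol_term a b 1 = 1"
proof (cases "a = b")
  case False
  have "of_int (a - b) \<noteq> (0::complex)" using False by (simp only: of_int_eq_0_iff)
  then show ?thesis using False by (simp add: symbol_term_def)
qed (simp add: symbol_term_def)

text \<open>On expanding the product \<open>P'(z) cnj (Q (1 / cnj z))\<close>, the two factors contribute \<open>z^(a-1)\<close> and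
  \<open>z^(-b)\<close>, because \<open>1 / cnj z\<close> is conjugated again. Thus the right-hand sides of the system are
  sums of the derivatives of the \<open>symbol_term\<close>s.\<close>

lemma has_derivative_product_symbol:
  assumes z: "z \<noteq> 0"
  shows "(product_symbol S p R q has_derivative
     (\<lambda>h. (deriv (laurent S p) z * cnj (laurent R q (1 / cnj z))) * h
       + (laurent S p (1 / cnj z) * cnj (deriv (laurent R q) z)) * cnj h)) (at z)"
proof -
  have der: "deriv (laurent S p) z = (\<Sum>a\<in>S. p a * (of_int a * z powi (a - 1)))" for S p
    unfolding laurent_def
    by (rule DERIV_imp_deriv) (use z in \<open>auto intro!: derivative_eq_intros simp: mult_ac\<close>)
  have inv: "(1 / cnj z) powi m = cnj z powi (- m)" for m
    by (simp add: power_int_minus power_int_divide_distrib divide_inverse power_int_inverse)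
  have inv': "(1 / z) powi m = z powi (- m)" for m
    by (simp add: power_int_minus power_int_divide_distrib divide_inverse power_int_inverse)
  have e1: "deriv (laurent S p) z * cnj (laurent R q (1 / cnj z))
     = (\<Sum>a\<in>S. \<Sum>b\<in>R. p a * cnj (q b) * (of_int a * z powi (a - b - 1)))"
    unfolding der sum_product laurent_def cnj_sum
    by (intro sum.cong refl)
       (use z in \<open>simp add: inv' power_int_minus power_int_diff power_int_inverse divide_inverse mult_ac\<close>)
  have e2: "laurent S p (1 / cnj z) * cnj (deriv (laurent R q) z)
     = (\<Sum>a\<in>S. \<Sum>b\<in>R. p a * cnj (q b) * (of_int b * cnj z powi (b - a - 1)))"
    unfolding der sum_product laurent_def cnj_sum
    by (intro sum.cong refl)
       (use z in \<open>simp add: inv power_int_minus power_int_diff power_int_inverse divide_inverse mult_ac\<close>)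
  have "((\<lambda>w. \<Sum>a\<in>S. \<Sum>b\<in>R. p a * cnj (q b) * symbol_term a b w) has_derivative
     (\<lambda>h. \<Sum>a\<in>S. \<Sum>b\<in>R. p a * cnj (q b) * (of_int a * z powi (a - b - 1) * h +
     of_int b * cnj z powi (b - a - 1) * cnj h))) (at z)"
    by (intro has_derivative_sum has_derivative_mult_right has_derivative_symbol_term z)
  moreover have "(\<Sum>a\<in>S. \<Sum>b\<in>R. p a * cnj (q b) * (of_int a * z powi (a - b - 1) * h +
     of_int b * cnj z powi (b - a - 1) * cnj h))
     = (deriv (laurent S p) z * cnj (laurent R q (1 / cnj z))) * h
       + (laurent S p (1 / cnj z) * cnj (deriv (laurent R q) z)) * cnj h" for h
    unfolding e1 e2 by (simp add: sum_distrib_left sum_distrib_right sum.distrib algebra_simps)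
  moreover have "product_symbol S p R q = (\<lambda>w. \<Sum>a\<in>S. \<Sum>b\<in>R. p a * cnj (q b) * symbol_term a b w)"
    by (simp add: product_symbol_def fun_eq_iff)
  ultimately show ?thesis by simp
qed

lemma product_symbol_1: "product_symbol S p R q 1 = laurent S p 1 * cnj (laurent R q 1)"
  by (simp add: product_symbol_def laurent_def symbol_term_1 sum_product)

section \<open>An integrable function is determined by its moments\<close>

text \<open>Inner regularity in a form suited to dominated convergence. It reduces statements about measurable
  sets to compact ones, whose indicators are limits of continuous functions.\<close>

lemma lebesgue_set_compact_approximation:
  fixes A :: "complex set"
  assumes "A \<in> sets lebesgue"
  obtains K where "\<And>m::nat. compact (K m)" "\<And>m. K m \<subseteq> A"
    "AE x in lebesgue. (\<lambda>m. indicat_real (K m) x) \<longlonglongrightarrow> indicat_real A x"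
proof -
  obtain C T where CT: "fsigma C" "T \<in> null_sets lebesgue" "C \<union> T = A"
    using lebesgue_set_almost_fsigma[OF assms] by metis
  then obtain F :: "nat \<Rightarrow> complex set" where F: "range F \<subseteq> Collect compact" "C = \<Union>(range F)"
    using fsigma_Union_compact by metis
  show thesis
  proof (rule that[of "\<lambda>m. \<Union>i\<le>m. F i"])
    show "compact (\<Union>i\<le>m. F i)" for m using F(1) by (intro compact_UN) auto
    show "(\<Union>i\<le>m. F i) \<subseteq> A" for m using F(2) CT(3) by auto
    have "AE x in lebesgue. x \<notin> T" using CT(2) by (rule AE_not_in)
    then show "AE x in lebesgue. (\<lambda>m. indicat_real (\<Union>i\<le>m. F i) x) \<longlonglongrightarrow> indicat_real A x"
    proof eventually_elim
      case (elim x)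
      show ?case
      proof (cases "x \<in> A")
        case True
        with elim CT(3) F(2) obtain i where i: "x \<in> F i" by auto
        have "eventually (\<lambda>m. indicat_real (\<Union>i\<le>m. F i) x = indicat_real A x) sequentially"
          using eventually_ge_at_top[of i] by eventually_elim (use i True in \<open>auto simp: indicator_def\<close>)
        then show ?thesis by (rule tendsto_eventually)
      next
        case False
        then have "x \<notin> (\<Union>i\<le>m. F i)" for m using F(2) CT(3) by auto
        with False show ?thesis by simp
      qed
    qed
  qed
qed

lemma AE_dA_of_lebesgue: "AE x in lebesgue. R x \<Longrightarrow> AE x in dA. R x"
  unfolding AE_dA_iff by (auto elim: eventually_mono)

lemma integrable_mult_continuous:
  fixes g :: "complex \<Rightarrow> complex"
  assumes E: "integrable dA E" and g: "continuous_on UNIV g"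
  shows "integrable dA (\<lambda>w. E w * g w)"
proof -
  have "compact (g ` cball 0 1)"
    using g by (intro compact_continuous_image) (auto intro: continuous_on_subset)
  then obtain b where "\<And>w. w \<in> cball 0 1 \<Longrightarrow> norm (g w) \<le> b"
    by (meson bounded_iff compact_imp_bounded image_eqI)
  then show ?thesis
    by (intro integrable_dA_mult_bounded[OF E, of _ b] borel_measurable_dA borel_measurable_continuous_onI g) auto
qed

text \<open>Having all moments equal to \<open>0\<close> is inherited by the product with a polynomial in the real and
  imaginary parts. Quantifying over all \<open>E\<close> in the induction makes the step for products of
  polynomials immediate, without ever writing a polynomial as a sum of monomials.\<close>

lemma moments_zero_mult_polynomial:
  assumes "real_polynomial_function p" "integrable dA E"
    and "\<And>n k. (\<integral>w. E w * (w ^ n * cnj w ^ k) \<partial>dA) = 0"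
  shows "(\<integral>w. E w * of_real (p w) * (w ^ n * cnj w ^ k) \<partial>dA) = 0"
  using assms
proof (induction p arbitrary: E n k rule: real_polynomial_function.induct)
  case (linear f)
  \<comment> \<open>a real linear functional has the form \<open>2 Re (\<alpha> w)\<close>\<close>
  define \<alpha> where "\<alpha> = (of_real (f 1) - \<i> * of_real (f \<i>)) / 2"
  have lin: "linear f" using linear.hyps by (rule bounded_linear.linear)
  have f: "complex_of_real (f w) = \<alpha> * w + cnj \<alpha> * cnj w" for w
  proof -
    have "w = Re w *\<^sub>R 1 + Im w *\<^sub>R \<i>" by (simp add: complex_eq_iff)
    then have "f w = Re w * f 1 + Im w * f \<i>"
      by (metis linear_add[OF lin] linear_scale[OF lin] real_scaleR_def)
    then show ?thesis by (simp add: \<alpha>_def complex_eq_iff field_simps)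
  qed
  have int: "integrable dA (\<lambda>w. E w * (w ^ n * cnj w ^ k))" for n k
    by (intro integrable_mult_continuous linear.prems continuous_intros)
  have "(\<integral>w. E w * of_real (f w) * (w ^ n * cnj w ^ k) \<partial>dA)
     = (\<integral>w. \<alpha> * (E w * (w ^ Suc n * cnj w ^ k)) + cnj \<alpha> * (E w * (w ^ n * cnj w ^ Suc k)) \<partial>dA)"
    unfolding f by (simp add: algebra_simps)
  also have "\<dots> = \<alpha> * (\<integral>w. E w * (w ^ Suc n * cnj w ^ k) \<partial>dA) + cnj \<alpha> * (\<integral>w. E w * (w ^ n * cnj w ^ Suc k) \<partial>dA)"
    by (subst Bochner_Integration.integral_add) (intro integrable_mult_right int | simp only: integral_mult_right_zero)+
  finally show ?case by (simp only: linear.prems(2) mult_zero_right add_0)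
next
  case (const c)
  have "(\<integral>w. E w * of_real c * (w ^ n * cnj w ^ k) \<partial>dA) = of_real c * (\<integral>w. E w * (w ^ n * cnj w ^ k) \<partial>dA)"
    by (subst integral_mult_right_zero[symmetric]) (simp only: mult_ac)
  then show ?case by (simp only: const.prems(2) mult_zero_right)
next
  case (add f g)
  have int: "integrable dA (\<lambda>w. E w * of_real (h w) * (w ^ n * cnj w ^ k))" if "real_polynomial_function h" for h
    unfolding mult.assoc
    by (intro integrable_mult_continuous add.prems continuous_intros
        continuous_on_polymonial_function that[unfolded real_polynomial_function_eq])
  have "(\<integral>w. E w * of_real (f w + g w) * (w ^ n * cnj w ^ k) \<partial>dA)
     = (\<integral>w. E w * of_real (f w) * (w ^ n * cnj w ^ k) + E w * of_real (g w) * (w ^ n * cnj w ^ k) \<partial>dA)"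
    by (simp add: algebra_simps)
  also have "\<dots> = 0"
    by (subst Bochner_Integration.integral_add[OF int int]) (use add in auto)
  finally show ?case .
next
  case (mult f g)
  have int: "integrable dA (\<lambda>w. E w * of_real (f w))"
    by (intro integrable_mult_continuous mult.prems continuous_intros
        continuous_on_polymonial_function mult.hyps(1)[unfolded real_polynomial_function_eq])
  have "(\<integral>w. E w * of_real (f w) * of_real (g w) * (w ^ n * cnj w ^ k) \<partial>dA) = 0"
    by (rule mult.IH(2)[OF int]) (rule mult.IH(1)[OF mult.prems])
  then show ?case by (simp add: mult.assoc)
qed

text \<open>Polynomials are uniformly dense on the closed disk by the Stone-Weierstrass theorem.\<close>

lemma moments_zero_mult_continuous:
  fixes g :: "complex \<Rightarrow> real"
  assumes E: "integrable dA E" and m: "\<And>n k. (\<integral>w. E w * (w ^ n * cnj w ^ k) \<partial>dA) = 0"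
    and g: "continuous_on UNIV g"
  shows "(\<integral>w. E w * of_real (g w) \<partial>dA) = 0"
proof -
  define c where "c = (\<integral>w. norm (E w) \<partial>dA)"
  have B: "norm (\<integral>w. E w * of_real (g w) \<partial>dA) \<le> e * c" if e: "e > 0" for e
  proof -
    have "\<exists>p. polynomial_function p \<and> (\<forall>x\<in>cball 0 1. norm (g x - p x) < e)"
      by (rule Stone_Weierstrass_polynomial_function[OF compact_cball continuous_on_subset[OF g subset_UNIV] e])
    then obtain p where p: "polynomial_function p" "\<And>x. x \<in> cball 0 1 \<Longrightarrow> norm (g x - p x) < e"
      by auto
    then have rp: "real_polynomial_function p" by (simp add: real_polynomial_function_eq)
    have ip: "integrable dA (\<lambda>w. E w * of_real (p w))"
      by (intro integrable_mult_continuous E continuous_intros continuous_on_polymonial_function p)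
    have ig: "integrable dA (\<lambda>w. E w * of_real (g w))"
      by (intro integrable_mult_continuous E continuous_intros g)
    have "(\<integral>w. E w * of_real (p w) * (w ^ 0 * cnj w ^ 0) \<partial>dA) = 0"
      by (rule moments_zero_mult_polynomial[OF rp E m])
    then have "(\<integral>w. E w * of_real (p w) \<partial>dA) = 0" by (simp only: power_0 mult_1_right)
    then have "(\<integral>w. E w * of_real (g w) \<partial>dA) = (\<integral>w. E w * of_real (g w) - E w * of_real (p w) \<partial>dA)"
      by (subst Bochner_Integration.integral_diff[OF ig ip]) simp
    also have "norm \<dots> \<le> (\<integral>w. norm (E w * of_real (g w) - E w * of_real (p w)) \<partial>dA)"
      by (rule integral_norm_bound)
    also have "\<dots> \<le> (\<integral>w. e * norm (E w) \<partial>dA)"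
    proof (rule integral_mono_AE)
      show "AE w in dA. norm (E w * of_real (g w) - E w * of_real (p w)) \<le> e * norm (E w)"
        using AE_dA_disk
      proof eventually_elim
        case (elim w)
        have "\<bar>g w - p w\<bar> \<le> e" using p(2)[of w] elim by simp
        then have "norm (E w) * \<bar>g w - p w\<bar> \<le> norm (E w) * e" by (rule mult_left_mono) simp
        moreover have "norm (E w * of_real (g w) - E w * of_real (p w)) = norm (E w) * \<bar>g w - p w\<bar>"
          by (simp add: right_diff_distrib[symmetric] norm_mult flip: of_real_diff)
        ultimately show ?case by (simp add: mult.commute)
      qed
      show "integrable dA (\<lambda>w. norm (E w * of_real (g w) - E w * of_real (p w)))"
        by (intro integrable_norm Bochner_Integration.integrable_diff ig ip)
      show "integrable dA (\<lambda>w. e * norm (E w))"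
        by (intro integrable_mult_right integrable_norm E)
    qed
    finally show ?thesis by (simp add: c_def)
  qed
  have c0: "c \<ge> 0" by (simp add: c_def)
  show ?thesis
  proof (rule ccontr)
    assume "(\<integral>w. E w * of_real (g w) \<partial>dA) \<noteq> 0"
    then have pos: "norm (\<integral>w. E w * of_real (g w) \<partial>dA) > 0" (is "?x > 0") by simp
    have "?x \<le> ?x / (c + 1) * c"
      by (rule B) (use pos c0 in simp)
    also have "\<dots> = ?x * (c / (c + 1))" by simp
    also have "\<dots> < ?x * 1"
      by (rule mult_strict_left_mono) (use pos c0 in simp_all)
    finally show False by simp
  qed
qed

text \<open>The vanishing of the integral against continuous functions passes to indicators of compact sets, then
  of measurable sets, by dominated convergence.\<close>

lemma moments_zero_imp_AE_zero:
  assumes E: "integrable dA E" and m: "\<And>n k. (\<integral>w. E w * (w ^ n * cnj w ^ k) \<partial>dA) = 0"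
  shows "AE w in dA. E w = 0"
proof -
  have Em: "E \<in> borel_measurable dA" using E by auto
  have cmp: "(\<integral>w. indicat_real K w *\<^sub>R E w \<partial>dA) = 0" if K: "compact K" for K
  proof (cases "K = {}")
    case False
    \<comment> \<open>continuous functions that decrease to the indicator of \<open>K\<close>\<close>
    define g where "g i x = max 0 (1 - real i * infdist x K)" for i x
    have cont: "continuous_on UNIV (g i)" for i
      unfolding g_def by (intro continuous_intros)
    have g_le: "\<bar>g i x\<bar> \<le> 1" for i x
      by (simp add: g_def infdist_nonneg)
    have lim: "(\<lambda>i. g i x) \<longlonglongrightarrow> indicat_real K x" for x
    proof (cases "x \<in> K")
      case True
      then show ?thesis by (simp add: g_def)
    next
      case False
      then have pos: "infdist x K > 0"
        using K \<open>K \<noteq> {}\<close> by (simp add: compact_imp_closed infdist_pos_not_in_closed)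
      obtain N where N: "real N * infdist x K > 1"
        using reals_Archimedean3[OF pos] by blast
      have "eventually (\<lambda>i. g i x = indicat_real K x) sequentially"
        using eventually_ge_at_top[of N]
      proof eventually_elim
        case (elim i)
        have "real N * infdist x K \<le> real i * infdist x K"
          using elim pos by (intro mult_right_mono) auto
        with N False show ?case by (simp add: g_def)
      qed
      then show ?thesis by (rule tendsto_eventually)
    qed
    have gm: "g i \<in> borel_measurable dA" for i
      by (intro borel_measurable_dA borel_measurable_continuous_onI cont)
    have "(\<lambda>i. \<integral>w. E w * of_real (g i w) \<partial>dA) \<longlonglongrightarrow> (\<integral>w. indicat_real K w *\<^sub>R E w \<partial>dA)"
    proof (rule integral_dominated_convergence[where w = "\<lambda>w. norm (E w)"])
      show "(\<lambda>w. indicat_real K w *\<^sub>R E w) \<in> borel_measurable dA"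
        by (intro borel_measurable_scaleR Em borel_measurable_dA borel_measurable_indicator)
           (use K in \<open>auto intro: borel_compact\<close>)
      show "(\<lambda>w. E w * of_real (g i w)) \<in> borel_measurable dA" for i
        by (intro borel_measurable_times Em measurable_compose[OF gm]) simp
      show "integrable dA (\<lambda>w. norm (E w))" using E by simp
      show "AE w in dA. (\<lambda>i. E w * of_real (g i w)) \<longlonglongrightarrow> indicat_real K w *\<^sub>R E w"
        unfolding scaleR_conv_of_real
        by (intro AE_I2) (subst mult.commute, intro tendsto_intros lim)
      show "AE w in dA. norm (E w * of_real (g i w)) \<le> norm (E w)" for i
        using g_le by (intro AE_I2) (simp add: norm_mult mult_left_le)
    qed
    then show ?thesis
      by (simp add: moments_zero_mult_continuous[OF E m cont] LIMSEQ_const_iff)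
  qed simp
  have meas: "(\<integral>w. indicat_real A w *\<^sub>R E w \<partial>dA) = 0" if A: "A \<in> sets dA" for A
  proof -
    have "A \<in> sets lebesgue" using A by (simp add: sets_dA)
    then obtain K where K: "\<And>m::nat. compact (K m)" "\<And>m. K m \<subseteq> A"
      "AE x in lebesgue. (\<lambda>m. indicat_real (K m) x) \<longlonglongrightarrow> indicat_real A x"
      using lebesgue_set_compact_approximation by metis
    have "(\<lambda>i. \<integral>w. indicat_real (K i) w *\<^sub>R E w \<partial>dA) \<longlonglongrightarrow> (\<integral>w. indicat_real A w *\<^sub>R E w \<partial>dA)"
    proof (rule integral_dominated_convergence[where w = "\<lambda>w. norm (E w)"])
      show "(\<lambda>w. indicat_real A w *\<^sub>R E w) \<in> borel_measurable dA"
        by (intro borel_measurable_scaleR Em borel_measurable_indicator A)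
      show "(\<lambda>w. indicat_real (K i) w *\<^sub>R E w) \<in> borel_measurable dA" for i
        by (intro borel_measurable_scaleR Em borel_measurable_dA borel_measurable_indicator)
           (use K in \<open>auto intro: borel_compact\<close>)
      show "integrable dA (\<lambda>w. norm (E w))" using E by simp
      show "AE w in dA. (\<lambda>i. indicat_real (K i) w *\<^sub>R E w) \<longlonglongrightarrow> indicat_real A w *\<^sub>R E w"
        using AE_dA_of_lebesgue[OF K(3)] by eventually_elim (intro tendsto_intros)
      show "AE w in dA. norm (indicat_real (K i) w *\<^sub>R E w) \<le> norm (E w)" for i
        by (intro AE_I2) (simp add: indicator_def)
    qed
    then show ?thesis by (simp add: cmp[OF K(1)] LIMSEQ_const_iff)
  qed
  have intA: "integrable dA (\<lambda>w. indicat_real A w *\<^sub>R E w)" if "A \<in> sets dA" for A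
    using integrable_mult_indicator[OF that E] .
  have "AE w in dA. Re (E w) = (\<lambda>_. 0) w"
  proof (rule density_unique_real)
    fix A assume A: "A \<in> sets dA"
    have "(\<integral>w\<in>A. Re (E w) \<partial>dA) = Re (\<integral>w. indicat_real A w *\<^sub>R E w \<partial>dA)"
      unfolding set_lebesgue_integral_def using integral_Re[OF intA[OF A]] by simp
    then show "(\<integral>w\<in>A. Re (E w) \<partial>dA) = (\<integral>w\<in>A. 0 \<partial>dA)" by (simp add: meas[OF A])
  qed (use E in \<open>auto intro: integrable_Re\<close>)
  moreover have "AE w in dA. Im (E w) = (\<lambda>_. 0) w"
  proof (rule density_unique_real)
    fix A assume A: "A \<in> sets dA"
    have "(\<integral>w\<in>A. Im (E w) \<partial>dA) = Im (\<integral>w. indicat_real A w *\<^sub>R E w \<partial>dA)"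
      unfolding set_lebesgue_integral_def using integral_Im[OF intA[OF A]] by simp
    then show "(\<integral>w\<in>A. Im (E w) \<partial>dA) = (\<integral>w\<in>A. 0 \<partial>dA)" by (simp add: meas[OF A])
  qed (use E in \<open>auto intro: integrable_Im\<close>)
  ultimately show ?thesis by eventually_elim (simp add: complex_eq_iff)
qed

section \<open>The Riemann-Lebesgue lemma\<close>

text \<open>The character \<open>e^(2 i Im (c w))\<close> of the plane, written as a holomorphic times an antiholomorphic
  exponential, which is how it arises below.\<close>

definition plane_wave :: "complex \<Rightarrow> complex \<Rightarrow> complex" where
  "plane_wave c w = exp (c * w) * cnj (exp (- c * w))"

lemma plane_wave_eq_cis: "plane_wave c w = cis (2 * Im (c * w))"
proof -
  have "plane_wave c w = exp (c * w + cnj (- c * w))"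
    by (simp add: plane_wave_def exp_cnj flip: exp_add)
  also have "c * w + cnj (- c * w) = \<i> * of_real (2 * Im (c * w))"
    by (simp add: complex_eq_iff)
  finally show ?thesis by (simp add: cis_conv_exp)
qed

lemma norm_plane_wave [simp]: "norm (plane_wave c w) = 1"
  by (simp add: plane_wave_eq_cis)

lemma plane_wave_add: "plane_wave c (w + h) = plane_wave c w * plane_wave c h"
  by (simp add: plane_wave_eq_cis cis_mult algebra_simps)

lemma measurable_plane_wave: "plane_wave c \<in> borel_measurable borel"
  unfolding plane_wave_def by (intro borel_measurable_continuous_onI continuous_intros)

lemma plane_wave_half_period:
  assumes "c \<noteq> 0"
  shows "plane_wave c (\<i> * pi / (2 * c)) = - 1"
proof -
  have eq: "c * (\<i> * pi / (2 * c)) = \<i> * of_real (pi / 2)" using assms by simp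
  show ?thesis unfolding plane_wave_eq_cis eq by simp
qed

lemma lborel_integral_translate:
  fixes f :: "complex \<Rightarrow> 'b::{banach, second_countable_topology}"
  assumes "f \<in> borel_measurable borel"
  shows "(\<integral>w. f (w + h) \<partial>lborel) = (\<integral>w. f w \<partial>lborel)"
  by (subst (2) lborel_distr_plus[of h, symmetric]) (simp add: integral_distr assms add.commute)

lemma integrable_lborel_compact:
  fixes f :: "complex \<Rightarrow> 'b::{banach, second_countable_topology}"
  assumes "compact K" "f \<in> borel_measurable borel" "\<And>w. norm (f w) \<le> indicat_real K w"
  shows "integrable lborel f"
proof (rule Bochner_Integration.integrable_bound)
  show "integrable lborel (indicat_real K)"
    using emeasure_bounded_finite[OF compact_imp_bounded[OF assms(1)]] borel_compact[OF assms(1)]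
    by (intro integrable_real_indicator) auto
qed (use assms in auto)

text \<open>Translating by half a period \<open>h\<close> reverses the sign of the character. So twice the integral is at most
  the area of the symmetric difference of \<open>K\<close> and its translate by \<open>h\<close>, and this tends to \<open>0\<close>
  with \<open>h\<close> since \<open>K\<close> is closed. The frequencies run through
  \<open>1, 2, 3, \<dots>\<close>, which is enough to find the value of a function already known to be constant.\<close>

lemma plane_wave_integral_compact_tendsto_0:
  assumes K: "compact K"
  shows "(\<lambda>n. \<integral>w. of_real (indicat_real K w) * plane_wave (of_nat (Suc n)) w \<partial>lborel) \<longlonglongrightarrow> 0"
proof -
  define h where "h n = \<i> * pi / (2 * complex_of_nat (Suc n))" for n
  let ?I = "\<lambda>n. \<integral>w. of_real (indicat_real K w) * plane_wave (of_nat (Suc n)) w \<partial>lborel"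
  let ?k = "indicat_real K"
  have Kb: "K \<in> sets borel" using K by (rule borel_compact)
  have km [measurable]: "?k \<in> borel_measurable borel" using Kb by (rule borel_measurable_indicator)
  note [measurable] = measurable_plane_wave
  have h0: "h \<longlonglongrightarrow> 0"
  proof -
    have "(\<lambda>n. \<i> * pi / 2 * (1 / complex_of_nat (Suc n))) \<longlonglongrightarrow> \<i> * pi / 2 * 0"
      by (intro tendsto_intros LIMSEQ_Suc lim_1_over_n)
    then show ?thesis by (simp add: h_def[abs_def] divide_simps)
  qed
  have h2: "norm (h n) \<le> 2" for n
  proof -
    have "norm (h n) = pi / (2 * real (Suc n))"
      by (simp only: h_def norm_divide norm_mult norm_of_nat norm_numeral) simp
    also have "\<dots> \<le> pi / 2" by (simp add: field_simps)
    also have "\<dots> \<le> 2" using pi_less_4 by simp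
    finally show ?thesis .
  qed
  obtain b where b: "\<And>w. w \<in> K \<Longrightarrow> norm w \<le> b"
    using compact_imp_bounded[OF K] by (auto simp: bounded_iff)
  \<comment> \<open>The indicator of the union of \<open>K\<close> and its translate: it converges to that of \<open>K\<close> at every point,
    whereas the indicators of the translates need not converge on the boundary of \<open>K\<close>.\<close>
  define u where "u n w = max (?k w) (?k (w + h n))" for n w
  have um [measurable]: "u n \<in> borel_measurable borel" for n
    unfolding u_def by measurable
  have u_le: "norm (u n w) \<le> indicat_real (cball 0 (b + 2)) w" for n w
  proof -
    have "norm w \<le> b + 2" if "w + h n \<in> K"
      using b[OF that] h2[of n] norm_triangle_ineq4[of "w + h n" "h n"] by simp
    then show ?thesis using b[of w] by (auto simp: u_def indicator_def max_def)
  qed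
  have ik: "integrable lborel ?k" by (rule integrable_lborel_compact[OF K]) auto
  have iu: "integrable lborel (u n)" for n
    by (rule integrable_lborel_compact[OF compact_cball um u_le])
  have khm [measurable]: "(\<lambda>w. ?k (w + h n)) \<in> borel_measurable borel" for n
    by (rule measurable_compose[OF _ km]) simp
  have kh_le: "norm (?k (w + h n)) \<le> indicat_real (cball 0 (b + 2)) w" for n w
    using u_le[of n w] by (simp add: u_def)
  have ikh: "integrable lborel (\<lambda>w. ?k (w + h n))" for n
    by (rule integrable_lborel_compact[OF compact_cball khm kh_le])
  have u_lim: "(\<lambda>n. u n w) \<longlonglongrightarrow> ?k w" for w
  proof (cases "w \<in> K")
    case True
    then have "u n w = ?k w" for n by (simp add: u_def indicator_def)
    then show ?thesis by simp
  next
    case False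
    have "open (- K)" using K by (simp add: compact_imp_closed open_Compl)
    moreover have "(\<lambda>n. w + h n) \<longlonglongrightarrow> w" using tendsto_add[OF tendsto_const h0, of w] by simp
    ultimately have "eventually (\<lambda>n. w + h n \<in> - K) sequentially"
      using False by (intro topological_tendstoD) auto
    then have "eventually (\<lambda>n. u n w = ?k w) sequentially"
      by eventually_elim (use False in \<open>simp add: u_def\<close>)
    then show ?thesis by (rule tendsto_eventually)
  qed
  have lim: "(\<lambda>n. \<integral>w. u n w \<partial>lborel) \<longlonglongrightarrow> (\<integral>w. ?k w \<partial>lborel)"
  proof (rule integral_dominated_convergence[where w = "indicat_real (cball 0 (b + 2))"])
    show "integrable lborel (indicat_real (cball 0 (b + 2)) :: complex \<Rightarrow> real)"
      by (rule integrable_lborel_compact[OF compact_cball[of 0 "b + 2"] borel_measurable_indicator[OF borel_closed[OF closed_cball]]])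
         simp
  qed (use u_lim u_le in auto)
  have bound: "norm (?I n) \<le> (\<integral>w. u n w \<partial>lborel) - (\<integral>w. ?k w \<partial>lborel)" for n
  proof -
    let ?e = "plane_wave (of_nat (Suc n))"
    have i1: "integrable lborel (\<lambda>w. of_real (?k w) * ?e w)"
      by (rule integrable_lborel_compact[OF K]) (measurable, simp add: norm_mult)
    have i2: "integrable lborel (\<lambda>w. of_real (?k (w + h n)) * ?e w)"
    proof (rule integrable_lborel_compact[OF compact_cball[of 0 "b + 2"]])
      show "norm (complex_of_real (?k (w + h n)) * ?e w) \<le> indicat_real (cball 0 (b + 2)) w" for w
        using kh_le[of w n] by (simp add: norm_mult)
      show "(\<lambda>w. complex_of_real (?k (w + h n)) * ?e w) \<in> borel_measurable borel"
        by (intro borel_measurable_times measurable_plane_wave measurable_compose[OF khm]) simp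
    qed
    have "?e (h n) = - 1"
      unfolding h_def by (rule plane_wave_half_period) (metis of_nat_neq_0)
    then have "?I n = - (\<integral>w. of_real (?k (w + h n)) * ?e w \<partial>lborel)"
      using lborel_integral_translate[of "\<lambda>w. of_real (?k w) * ?e w" "h n"]
      by (simp add: plane_wave_add del: of_nat_Suc)
    then have "2 * ?I n = ?I n - (\<integral>w. of_real (?k (w + h n)) * ?e w \<partial>lborel)" by simp
    also have "\<dots> = (\<integral>w. of_real (?k w) * ?e w - of_real (?k (w + h n)) * ?e w \<partial>lborel)"
      by (rule Bochner_Integration.integral_diff[OF i1 i2, symmetric])
    also have "norm \<dots> \<le> (\<integral>w. norm (of_real (?k w) * ?e w - of_real (?k (w + h n)) * ?e w) \<partial>lborel)"
      by (rule integral_norm_bound)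
    also have "\<dots> = (\<integral>w. 2 * u n w - ?k w - ?k (w + h n) \<partial>lborel)"
    proof (rule Bochner_Integration.integral_cong[OF refl])
      fix w
      have "norm (of_real (?k w) * ?e w - of_real (?k (w + h n)) * ?e w) = \<bar>?k w - ?k (w + h n)\<bar>"
        by (simp add: left_diff_distrib[symmetric] norm_mult del: of_nat_Suc flip: of_real_diff)
      then show "norm (of_real (?k w) * ?e w - of_real (?k (w + h n)) * ?e w) = 2 * u n w - ?k w - ?k (w + h n)"
        by (simp add: u_def max_def)
    qed
    also have "\<dots> = 2 * (\<integral>w. u n w \<partial>lborel) - (\<integral>w. ?k w \<partial>lborel) - (\<integral>w. ?k (w + h n) \<partial>lborel)"
      using iu ik ikh by simp
    also have "(\<integral>w. ?k (w + h n) \<partial>lborel) = (\<integral>w. ?k w \<partial>lborel)"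
      by (rule lborel_integral_translate) simp
    finally show ?thesis by (simp add: norm_mult del: of_nat_Suc)
  qed
  show ?thesis
  proof (rule Lim_null_comparison)
    show "eventually (\<lambda>n. norm (?I n) \<le> (\<integral>w. u n w \<partial>lborel) - (\<integral>w. ?k w \<partial>lborel)) sequentially"
      using bound by simp
    show "(\<lambda>n. (\<integral>w. u n w \<partial>lborel) - (\<integral>w. ?k w \<partial>lborel)) \<longlonglongrightarrow> 0"
      by (rule LIM_zero[OF lim])
  qed
qed

text \<open>The integrals against functions of modulus \<open>1\<close> depend on \<open>f\<close> continuously in \<open>L^1\<close>, uniformly in
  \<open>n\<close>. The factor \<open>2\<close> in the domination is the one supplied by induction over integrable functions.\<close>

lemma tendsto_0_L1_closure:
  fixes f :: "complex \<Rightarrow> complex" and e :: "nat \<Rightarrow> complex \<Rightarrow> complex"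
  assumes f: "integrable M f" and s: "\<And>i. s i \<in> borel_measurable M"
    and lim: "AE x in M. (\<lambda>i. s i x) \<longlonglongrightarrow> f x"
    and bound: "\<And>i. AE x in M. norm (s i x) \<le> 2 * norm (f x)"
    and e: "\<And>n. e n \<in> borel_measurable M" "\<And>n x. norm (e n x) = 1"
    and P: "\<And>i. (\<lambda>n. \<integral>x. s i x * e n x \<partial>M) \<longlonglongrightarrow> 0"
  shows "(\<lambda>n. \<integral>x. f x * e n x \<partial>M) \<longlonglongrightarrow> 0"
proof (rule LIMSEQ_I)
  fix r :: real assume r: "r > 0"
  have si: "integrable M (s i)" for i
    by (rule Bochner_Integration.integrable_bound[of M "\<lambda>x. 2 * norm (f x)"])
       (use f s bound in \<open>auto\<close>)
  have int: "integrable M (\<lambda>x. g x * e n x)" if g: "integrable M g" for g n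
    by (rule Bochner_Integration.integrable_bound[OF g borel_measurable_times[OF borel_measurable_integrable[OF g] e(1)]])
       (simp add: norm_mult e(2))
  have "(\<lambda>i. \<integral>x. norm (s i x - f x) \<partial>M) \<longlonglongrightarrow> (\<integral>x. 0 \<partial>M)"
  proof (rule integral_dominated_convergence[where w = "\<lambda>x. 3 * norm (f x)"])
    show "AE x in M. (\<lambda>i. norm (s i x - f x)) \<longlonglongrightarrow> 0"
      using lim by eventually_elim (simp add: LIM_zero tendsto_norm_zero)
    show "AE x in M. norm (norm (s i x - f x)) \<le> 3 * norm (f x)" for i
      using bound[of i]
    proof eventually_elim
      case (elim x)
      then show ?case using norm_triangle_ineq4[of "s i x" "f x"] by simp
    qed
    show "(\<lambda>x. norm (s i x - f x)) \<in> borel_measurable M" for i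
      using s[of i] borel_measurable_integrable[OF f] by simp
    show "integrable M (\<lambda>x. 3 * norm (f x))" using f by (intro integrable_mult_right integrable_norm)
  qed simp
  then have "eventually (\<lambda>i. (\<integral>x. norm (s i x - f x) \<partial>M) < r / 2) sequentially"
    using r by (intro order_tendstoD) auto
  then obtain i where i: "(\<integral>x. norm (s i x - f x) \<partial>M) < r / 2"
    by (auto simp: eventually_sequentially)
  have "eventually (\<lambda>n. norm (\<integral>x. s i x * e n x \<partial>M) < r / 2) sequentially"
    using tendsto_norm_zero[OF P[of i]] r by (intro order_tendstoD) auto
  then obtain m where m: "\<And>n. n \<ge> m \<Longrightarrow> norm (\<integral>x. s i x * e n x \<partial>M) < r / 2"
    by (auto simp: eventually_sequentially)
  have "norm ((\<integral>x. f x * e n x \<partial>M) - 0) < r" if n: "n \<ge> m" for n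
  proof -
    have "norm ((\<integral>x. s i x * e n x \<partial>M) - (\<integral>x. f x * e n x \<partial>M)) = norm (\<integral>x. s i x * e n x - f x * e n x \<partial>M)"
      by (subst Bochner_Integration.integral_diff[OF int[OF si] int[OF f]]) (rule refl)
    also have "\<dots> \<le> (\<integral>x. norm (s i x * e n x - f x * e n x) \<partial>M)"
      by (rule integral_norm_bound)
    also have "\<dots> = (\<integral>x. norm (s i x - f x) \<partial>M)"
      by (simp only: left_diff_distrib[symmetric] norm_mult e(2) mult_1_right)
    finally have "norm ((\<integral>x. s i x * e n x \<partial>M) - (\<integral>x. f x * e n x \<partial>M)) < r / 2" using i by simp
    moreover have "norm (\<integral>x. f x * e n x \<partial>M) \<le> norm (\<integral>x. s i x * e n x \<partial>M)
      + norm ((\<integral>x. s i x * e n x \<partial>M) - (\<integral>x. f x * e n x \<partial>M))"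
      by (metis norm_triangle_sub norm_minus_commute)
    ultimately show ?thesis using m[OF n] by simp
  qed
  then show "\<exists>no. \<forall>n\<ge>no. norm ((\<integral>x. f x * e n x \<partial>M) - 0) < r" by blast
qed

lemma borel_measurable_lebesgue: "f \<in> borel_measurable borel \<Longrightarrow> f \<in> borel_measurable lebesgue"
  by (rule measurable_completion) simp

lemma Riemann_Lebesgue_lebesgue:
  fixes f :: "complex \<Rightarrow> complex"
  assumes "integrable lebesgue f"
  shows "(\<lambda>n. \<integral>w. f w * plane_wave (of_nat (Suc n)) w \<partial>lebesgue) \<longlonglongrightarrow> 0"
  using assms
proof (induction rule: integrable_induct)
  case (base A c)
  note wave = borel_measurable_lebesgue[OF measurable_plane_wave]
  from base(1) obtain K where K: "\<And>m::nat. compact (K m)" "\<And>m. K m \<subseteq> A"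
    "AE x in lebesgue. (\<lambda>m. indicat_real (K m) x) \<longlonglongrightarrow> indicat_real A x"
    using lebesgue_set_compact_approximation by metis
  have Kb: "K i \<in> sets borel" for i by (rule borel_compact[OF K(1)])
  show ?case
  proof (rule tendsto_0_L1_closure[where s = "\<lambda>i x. indicat_real (K i) x *\<^sub>R c"])
    show "integrable lebesgue (\<lambda>x. indicat_real A x *\<^sub>R c)"
      using base by (intro integrable_scaleR_left integrable_real_indicator)
    show "(\<lambda>x. indicat_real (K i) x *\<^sub>R c) \<in> borel_measurable lebesgue" for i
      by (intro borel_measurable_scaleR borel_measurable_const borel_measurable_lebesgue borel_measurable_indicator Kb)
    show "AE x in lebesgue. (\<lambda>i. indicat_real (K i) x *\<^sub>R c) \<longlonglongrightarrow> indicat_real A x *\<^sub>R c"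
      using K(3) by eventually_elim (intro tendsto_intros)
    show "AE x in lebesgue. norm (indicat_real (K i) x *\<^sub>R c) \<le> 2 * norm (indicat_real A x *\<^sub>R c)" for i
      using K(2)[of i] by (intro AE_I2) (auto simp: indicator_def)
    show "(\<lambda>n. \<integral>x. (indicat_real (K i) x *\<^sub>R c) * plane_wave (of_nat (Suc n)) x \<partial>lebesgue) \<longlonglongrightarrow> 0" for i
    proof -
      have eq: "(\<integral>x. (indicat_real (K i) x *\<^sub>R c) * plane_wave d x \<partial>lebesgue)
        = c * (\<integral>x. of_real (indicat_real (K i) x) * plane_wave d x \<partial>lborel)" for d
      proof -
        have "(\<integral>x. (indicat_real (K i) x *\<^sub>R c) * plane_wave d x \<partial>lebesgue)
          = (\<integral>x. c * (of_real (indicat_real (K i) x) * plane_wave d x) \<partial>lborel)"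
        proof (subst integral_completion)
          have "(\<lambda>x. (indicat_real (K i) x *\<^sub>R c) * plane_wave d x) \<in> borel_measurable borel"
            by (intro borel_measurable_times borel_measurable_scaleR borel_measurable_const
                borel_measurable_indicator Kb measurable_plane_wave)
          then show "(\<lambda>x. (indicat_real (K i) x *\<^sub>R c) * plane_wave d x) \<in> borel_measurable lborel"
            by simp
        qed (simp add: scaleR_conv_of_real mult_ac)
        then show ?thesis by (simp only: integral_mult_right_zero)
      qed
      show ?thesis unfolding eq
        using tendsto_mult[OF tendsto_const plane_wave_integral_compact_tendsto_0[OF K(1)[of i]], of c] by simp
    qed
  qed (use wave in auto)
next
  case (add f g)
  have int: "integrable lebesgue (\<lambda>x. h x * plane_wave d x)" if h: "integrable lebesgue h" for h d
    by (rule Bochner_Integration.integrable_bound[OF h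
        borel_measurable_times[OF borel_measurable_integrable[OF h] borel_measurable_lebesgue[OF measurable_plane_wave]]])
       (simp add: norm_mult)
  have "(\<integral>w. (f w + g w) * plane_wave d w \<partial>lebesgue)
    = (\<integral>w. f w * plane_wave d w \<partial>lebesgue) + (\<integral>w. g w * plane_wave d w \<partial>lebesgue)" for d
    unfolding distrib_right by (rule Bochner_Integration.integral_add[OF int[OF add(1)] int[OF add(2)]])
  then show ?case using tendsto_add[OF add(3,4)] by (simp del: of_nat_Suc)
next
  case (lim f s)
  note wave = borel_measurable_lebesgue[OF measurable_plane_wave]
  show ?case
    by (rule tendsto_0_L1_closure[where s = s])
       (use lim wave in \<open>auto intro: AE_I2\<close>)
qed

text \<open>The measure on the disk has a bounded density, which is absorbed into the integrand.\<close>

lemma Riemann_Lebesgue_dA: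
  assumes E: "integrable dA E"
  shows "(\<lambda>n. \<integral>w. E w * plane_wave (of_nat (Suc n)) w \<partial>dA) \<longlonglongrightarrow> 0"
proof -
  let ?d = "\<lambda>w::complex. indicat_real (ball 0 1) w / pi"
  have dm: "?d \<in> borel_measurable lebesgue"
    by (intro borel_measurable_lebesgue borel_measurable_divide borel_measurable_indicator) auto
  have dens: "dA = density lebesgue (\<lambda>w. ennreal (?d w))"
    unfolding dA_def uniform_measure_def emeasure_unit_disk
  proof (rule density_cong)
    show "(\<lambda>w::complex. indicator (ball 0 1) w / ennreal pi) \<in> borel_measurable lebesgue"
      by (intro borel_measurable_lebesgue borel_measurable_divide_ennreal borel_measurable_indicator) auto
    show "(\<lambda>w. ennreal (?d w)) \<in> borel_measurable lebesgue"
      using dm by simp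
    show "AE w in lebesgue. indicator (ball 0 1) w / ennreal pi = ennreal (?d w)"
      by (intro AE_I2) (auto simp: indicator_def divide_ennreal simp flip: ennreal_1)
  qed
  have Em: "E \<in> borel_measurable lebesgue"
    using borel_measurable_integrable[OF E] by (simp cong: measurable_cong_sets add: sets_dA)
  have "integrable lebesgue (\<lambda>w. ?d w *\<^sub>R E w)"
    using E Em dm unfolding dens by (subst (asm) integrable_density) auto
  from Riemann_Lebesgue_lebesgue[OF this]
  have "(\<lambda>n. \<integral>w. (?d w *\<^sub>R E w) * plane_wave (of_nat (Suc n)) w \<partial>lebesgue) \<longlonglongrightarrow> 0" .
  moreover have "(\<integral>w. (?d w *\<^sub>R E w) * plane_wave c w \<partial>lebesgue) = (\<integral>w. E w * plane_wave c w \<partial>dA)" for c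
  proof -
    have "(\<integral>w. E w * plane_wave c w \<partial>dA) = (\<integral>w. ?d w *\<^sub>R (E w * plane_wave c w) \<partial>lebesgue)"
      unfolding dens
      by (rule integral_density)
         (intro borel_measurable_times Em borel_measurable_lebesgue[OF measurable_plane_wave] dm, use dm in auto)
    then show ?thesis by simp
  qed
  ultimately show ?thesis by simp
qed

section \<open>Matrices of finite rank\<close>

text \<open>The determinant of the leading \<open>s \<times> s\<close> block of a matrix given as a function; minors of other
  rows and columns are obtained by composing with the functions that select them.\<close>

definition minor_det :: "nat \<Rightarrow> (nat \<Rightarrow> nat \<Rightarrow> complex) \<Rightarrow> complex" where
  "minor_det s f = Determinant.det (Matrix.mat s s (\<lambda>(i, j). f i j))"

lemma minor_det_expand:
  "minor_det s f = (\<Sum>p | p permutes {0..<s}. signof p * (\<Prod>i = 0..<s. f i (p i)))"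
  unfolding minor_det_def
  by (subst det_def') (auto intro!: sum.cong prod.cong simp: permutes_in_image)

lemma minor_det_mult:
  "minor_det s (\<lambda>i j. \<Sum>l<s. f i l * g l j) = minor_det s f * minor_det s g"
proof -
  have "Matrix.mat s s (\<lambda>(i, j). \<Sum>l<s. f i l * g l j)
    = Matrix.mat s s (\<lambda>(i, j). f i j) * Matrix.mat s s (\<lambda>(i, j). g i j)"
    by (rule eq_matI) (auto simp: scalar_prod_def lessThan_atLeast0 intro!: sum.cong)
  then show ?thesis
    unfolding minor_det_def by (simp add: Determinant.det_mult[of _ s])
qed

lemma minor_det_zero_column:
  assumes "r < s" "\<And>i. i < s \<Longrightarrow> f i r = 0"
  shows "minor_det s f = 0"
  unfolding minor_det_expand
proof (rule sum.neutral, clarify)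
  fix p assume p: "p permutes {0..<s}"
  then obtain i where "i \<in> {0..<s}" "p i = r"
    using assms(1) by (metis permutes_image imageE atLeastLessThan_iff le0)
  then have "(\<Prod>i = 0..<s. f i (p i)) = 0"
    using assms(2)[of i] by (intro prod_zero bexI[of _ i]) auto
  then show "signof p * (\<Prod>i = 0..<s. f i (p i)) = 0" by simp
qed

text \<open>The submatrix is a product of an \<open>s \<times> r\<close> and an \<open>r \<times> s\<close> matrix with \<open>r < s\<close>. Padding the first one
  with zero columns makes both factors square.\<close>

lemma minor_det_vanishes_above_rank:
  assumes "finite I" "\<And>n k. m n k = (\<Sum>i\<in>I. x i n * y i k)" "card I < s"
  shows "minor_det s (\<lambda>i j. m (ns i) (ks j)) = 0"
proof -
  obtain g where g: "bij_betw g {..<card I} I"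
    using ex_bij_betw_nat_finite[OF assms(1)] by (auto simp: lessThan_atLeast0)
  let ?X = "\<lambda>i l. if l < card I then x (g l) (ns i) else 0"
  let ?Y = "\<lambda>l j. y (g l) (ks j)"
  have "m (ns i) (ks j) = (\<Sum>l<s. ?X i l * ?Y l j)" for i j
  proof -
    have "(\<Sum>l<s. ?X i l * ?Y l j) = (\<Sum>l<card I. x (g l) (ns i) * ?Y l j)"
      using assms(3) by (intro sum.mono_neutral_cong_right) auto
    also have "\<dots> = m (ns i) (ks j)"
      unfolding assms(2) by (rule sum.reindex_bij_betw[OF g])
    finally show ?thesis by simp
  qed
  then have "minor_det s (\<lambda>i j. m (ns i) (ks j)) = minor_det s ?X * minor_det s ?Y"
    by (simp only: minor_det_mult)
  also have "minor_det s ?X = 0"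
    by (rule minor_det_zero_column[OF assms(3)]) simp
  finally show ?thesis by simp
qed

text \<open>Border the nonvanishing minor by row \<open>n\<close> and column \<open>k\<close>. The resulting determinant is \<open>0\<close>, and
  its expansion along the new row expresses \<open>m n k\<close> through the entries of row \<open>n\<close>, with
  cofactors that do not involve \<open>n\<close>.\<close>

lemma bordered_minor_expansion:
  fixes m :: "nat \<Rightarrow> nat \<Rightarrow> complex"
  assumes M: "minor_det s (\<lambda>i j. m (ns i) (ks j)) \<noteq> 0"
    and van: "\<And>N K. minor_det (Suc s) (\<lambda>i j. m (N i) (K j)) = (0 :: complex)"
  shows "\<exists>d. \<forall>n. m n k = (\<Sum>j<s. m n (ks j) * d j)"
proof -
  let ?K = "\<lambda>j. if j < s then ks j else k"
  define A where "A n = Matrix.mat (Suc s) (Suc s) (\<lambda>(i, j). m (if i < s then ns i else n) (?K j))" for n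
  let ?c = "\<lambda>j. cofactor (A 0) s j"
  let ?D = "minor_det s (\<lambda>i j. m (ns i) (ks j))"
  have del: "mat_delete (A n) s j = mat_delete (A 0) s j" if "j \<le> s" for n j
    using that by (intro eq_matI) (auto simp: mat_delete_def A_def)
  have cof: "cofactor (A n) s j = ?c j" if "j \<le> s" for n j
    by (simp only: cofactor_def del[OF that, of n])
  have "mat_delete (A 0) s s = Matrix.mat s s (\<lambda>(i, j). m (ns i) (ks j))"
    by (rule eq_matI) (auto simp: mat_delete_def A_def)
  then have last: "?c s = ?D" by (simp add: cofactor_def minor_det_def)
  have "m n k = (\<Sum>j<s. m n (ks j) * (- ?c j / ?D))" for n
  proof -
    have "0 = Determinant.det (A n)"
      using van[of "\<lambda>i. if i < s then ns i else n" ?K] by (simp add: minor_det_def A_def)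
    also have "\<dots> = (\<Sum>j<Suc s. A n $$ (s, j) * cofactor (A n) s j)"
      by (rule laplace_expansion_row) (auto simp: A_def)
    also have "\<dots> = (\<Sum>j<Suc s. m n (?K j) * ?c j)"
    proof (rule sum.cong[OF refl])
      fix j assume j: "j \<in> {..<Suc s}"
      then have "A n $$ (s, j) = m n (?K j)" by (simp add: A_def)
      then show "A n $$ (s, j) * cofactor (A n) s j = m n (?K j) * ?c j"
        using cof[of j n] j by simp
    qed
    also have "\<dots> = (\<Sum>j<s. m n (ks j) * ?c j) + m n k * ?D"
      by (simp add: last)
    finally have "m n k * ?D = - (\<Sum>j<s. m n (ks j) * ?c j)"
      by (simp add: eq_neg_iff_add_eq_0 add.commute)
    then have "m n k = - (\<Sum>j<s. m n (ks j) * ?c j) / ?D"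
      using M by (metis nonzero_mult_div_cancel_right)
    then show ?thesis
      by (simp add: sum_divide_distrib sum_negf[symmetric])
  qed
  then show ?thesis by (intro exI[of _ "\<lambda>j. - ?c j / ?D"] allI)
qed

text \<open>A matrix of finite rank is recovered from the rows and columns of a maximal nonvanishing minor, \<open>C\<close>
  being the inverse of the minor. In contrast to an arbitrary factorization, the factors here are
  entries of the matrix itself, and so they inherit its analytic properties.\<close>

lemma finite_rank_matrix_skeleton:
  fixes m :: "nat \<Rightarrow> nat \<Rightarrow> complex"
  assumes I: "finite I" and m: "\<And>n k. m n k = (\<Sum>i\<in>I. x i n * y i k)"
  obtains s ns ks C where "minor_det s (\<lambda>i j. m (ns i) (ks j)) \<noteq> 0"
    and "\<And>n k. m n k = (\<Sum>b<s. m n (ks b) * (\<Sum>a<s. C b a * m (ns a) k))"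
proof -
  define R where "R = {s. \<exists>ns ks. minor_det s (\<lambda>i j. m (ns i) (ks j)) \<noteq> 0}"
  have "R \<subseteq> {..card I}"
  proof
    fix s assume "s \<in> R"
    then obtain ns ks where "minor_det s (\<lambda>i j. m (ns i) (ks j)) \<noteq> 0" by (auto simp: R_def)
    with minor_det_vanishes_above_rank[of I m x y s ns ks] I m show "s \<in> {..card I}"
      by (meson atMost_iff not_le)
  qed
  then have finR: "finite R" by (rule finite_subset) simp
  have "0 \<in> R" by (simp add: R_def minor_det_expand)
  then have "Max R \<in> R" using finR by (intro Max_in) auto
  then obtain ns ks where M: "minor_det (Max R) (\<lambda>i j. m (ns i) (ks j)) \<noteq> 0"
    by (auto simp: R_def)
  define s where "s = Max R"
  have "Suc s \<notin> R" using Max_ge[OF finR, of "Suc s"] by (auto simp: s_def)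
  then have van: "minor_det (Suc s) (\<lambda>i j. m (N i) (K j)) = 0" for N K
    by (auto simp: R_def)
  let ?D = "minor_det s (\<lambda>i j. m (ns i) (ks j))"
  have D: "?D \<noteq> 0" using M by (simp add: s_def)
  have "\<exists>d. \<forall>n. m n k = (\<Sum>j<s. m n (ks j) * d j)" for k
    by (rule bordered_minor_expansion[where m = m and ns = ns, OF D]) (rule van)
  then obtain d where d: "\<And>k n. m n k = (\<Sum>j<s. m n (ks j) * d k j)" by metis
  define A where "A = Matrix.mat s s (\<lambda>(i, j). m (ns i) (ks j))"
  have A: "A \<in> carrier_mat s s" by (simp add: A_def)
  define C where "C b a = adj_mat A $$ (b, a) / ?D" for b a
  have "(\<Sum>a<s. C b a * m (ns a) k) = d k b" if b: "b < s" for b k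
  proof -
    have id: "(\<Sum>a<s. adj_mat A $$ (b, a) * m (ns a) (ks l)) = (if b = l then ?D else 0)" if l: "l < s" for l
    proof -
      have "(adj_mat A * A) $$ (b, l) = (\<Sum>a<s. adj_mat A $$ (b, a) * m (ns a) (ks l))"
        using b l adj_mat(1)[OF A] by (auto simp: A_def scalar_prod_def lessThan_atLeast0 intro!: sum.cong)
      moreover have "(adj_mat A * A) $$ (b, l) = (if b = l then ?D else 0)"
        unfolding adj_mat(3)[OF A] using b l by (simp add: A_def minor_det_def)
      ultimately show ?thesis by simp
    qed
    have "(\<Sum>a<s. C b a * m (ns a) k) = (\<Sum>a<s. \<Sum>l<s. C b a * (m (ns a) (ks l) * d k l))"
      by (subst d[of _ k]) (simp add: sum_distrib_left)
    also have "\<dots> = (\<Sum>l<s. \<Sum>a<s. C b a * (m (ns a) (ks l) * d k l))"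
      by (rule sum.swap)
    also have "\<dots> = (\<Sum>l<s. (\<Sum>a<s. adj_mat A $$ (b, a) * m (ns a) (ks l)) * (d k l / ?D))"
      by (simp add: C_def sum_distrib_left sum_distrib_right sum_divide_distrib mult_ac)
    also have "\<dots> = (\<Sum>l<s. (if b = l then d k l else 0))"
      using D by (intro sum.cong refl) (simp add: id)
    also have "\<dots> = d k b" using b by simp
    finally show ?thesis .
  qed
  then have "m n k = (\<Sum>b<s. m n (ks b) * (\<Sum>a<s. C b a * m (ns a) k))" for n k
    by (subst d) (auto intro!: sum.cong)
  with D show thesis by (rule that)
qed

section \<open>Toeplitz operators of finite rank with integrable symbol\<close>

text \<open>It is applied to \<open>g w = w\<close> and to \<open>g w = cnj w\<close>; the bound on \<open>g\<close> permits termwise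
  integration of the exponential series over the disk.\<close>

lemma integral_exp_sums:
  fixes E g :: "complex \<Rightarrow> complex"
  assumes E: "integrable dA E" and g: "continuous_on UNIV g" "\<And>w. norm (g w) \<le> norm w"
  shows "(\<lambda>n. (\<integral>w. E w * g w ^ n \<partial>dA) / fact n * c ^ n) sums (\<integral>w. E w * exp (c * g w) \<partial>dA)"
proof -
  let ?f = "\<lambda>n w. E w * ((c * g w) ^ n /\<^sub>R fact n)"
  have eq: "?f n w = (E w * g w ^ n) * (c ^ n / fact n)" for n w
    by (simp add: scaleR_conv_of_real power_mult_distrib divide_inverse)
  have int: "integrable dA (?f n)" for n
    unfolding eq by (intro integrable_mult_left integrable_mult_continuous[OF E] continuous_intros g)
  have bound: "norm (?f n w) \<le> norm (E w) * (norm c ^ n /\<^sub>R fact n)" if "norm w < 1" for n w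
  proof -
    have "norm (g w) ^ n \<le> 1" using g(2)[of w] that by (intro power_le_one) auto
    then have "(norm c ^ n /\<^sub>R fact n) * norm (g w) ^ n \<le> (norm c ^ n /\<^sub>R fact n) * 1"
      by (intro mult_left_mono) auto
    then have "norm (E w) * ((norm c ^ n /\<^sub>R fact n) * norm (g w) ^ n) \<le> norm (E w) * (norm c ^ n /\<^sub>R fact n)"
      by (intro mult_left_mono) auto
    then show ?thesis
      by (simp add: norm_mult norm_power power_mult_distrib mult_ac)
  qed
  have ex: "summable (\<lambda>n. norm c ^ n /\<^sub>R fact n)"
    using exp_converges[of "norm c"] by (rule sums_summable)
  have "(\<lambda>n. integral\<^sup>L dA (?f n)) sums (\<integral>w. (\<Sum>n. ?f n w) \<partial>dA)"
  proof (rule sums_integral[OF int])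
    show "AE w in dA. summable (\<lambda>n. norm (?f n w))"
      using AE_dA_disk
    proof eventually_elim
      case (elim w)
      show ?case
        by (rule summable_comparison_test[OF _ summable_mult[OF ex, of "norm (E w)"]])
           (use bound[OF elim] in auto)
    qed
    have "norm (LINT w|dA. norm (?f n w)) \<le> (LINT w|dA. norm (E w)) * (norm c ^ n /\<^sub>R fact n)" for n
    proof -
      have "(LINT w|dA. norm (?f n w)) \<le> (LINT w|dA. norm (E w) * (norm c ^ n /\<^sub>R fact n))"
      proof (rule integral_mono_AE)
        show "integrable dA (\<lambda>w. norm (?f n w))" using int by (rule integrable_norm)
        show "integrable dA (\<lambda>w. norm (E w) * (norm c ^ n /\<^sub>R fact n))"
          by (intro integrable_mult_left integrable_norm E)
        show "AE w in dA. norm (?f n w) \<le> norm (E w) * (norm c ^ n /\<^sub>R fact n)"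
          using AE_dA_disk by eventually_elim (rule bound)
      qed
      then show ?thesis by simp
    qed
    then show "summable (\<lambda>n. LINT w|dA. norm (?f n w))"
      by (intro summable_comparison_test[OF _ summable_mult[OF ex, of "LINT w|dA. norm (E w)"]]) blast
  qed
  also have "(\<lambda>w. (\<Sum>n. ?f n w)) = (\<lambda>w. E w * exp (c * g w))"
  proof
    fix w
    show "(\<Sum>n. ?f n w) = E w * exp (c * g w)"
      using sums_mult[OF exp_converges[of "c * g w"], of "E w"] by (rule sums_unique[symmetric])
  qed
  also have "(\<lambda>n. integral\<^sup>L dA (?f n)) = (\<lambda>n. (\<integral>w. E w * g w ^ n \<partial>dA) / fact n * c ^ n)"
  proof
    fix n
    have "integral\<^sup>L dA (?f n) = (\<integral>w. E w * g w ^ n \<partial>dA) * (c ^ n / fact n)"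
      unfolding eq by (rule integral_mult_left_zero)
    then show "integral\<^sup>L dA (?f n) = (\<integral>w. E w * g w ^ n \<partial>dA) / fact n * c ^ n" by simp
  qed
  finally show ?thesis .
qed

lemma exp_moments_zero:
  fixes E g :: "complex \<Rightarrow> complex"
  assumes E: "integrable dA E" and g: "continuous_on UNIV g" "\<And>w. norm (g w) \<le> norm w"
    and z: "\<And>n. (\<integral>w. E w * g w ^ n \<partial>dA) = 0"
  shows "(\<integral>w. E w * (g w ^ n * exp (c * g w)) \<partial>dA) = 0"
proof -
  have int: "integrable dA (\<lambda>w. E w * g w ^ n)"
    by (intro integrable_mult_continuous[OF E] continuous_intros g)
  have "(\<integral>w. E w * g w ^ n * g w ^ k \<partial>dA) = 0" for k
    using z[of "n + k"] by (simp only: power_add mult.assoc)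
  then have "(\<lambda>k. 0) sums (\<integral>w. E w * g w ^ n * exp (c * g w) \<partial>dA)"
    using integral_exp_sums[OF int g, of c] by simp
  then have "(\<integral>w. E w * g w ^ n * exp (c * g w) \<partial>dA) = 0"
    by (rule sums_unique2) (rule sums_zero)
  then show ?thesis by (simp only: mult.assoc)
qed

lemma holomorphic_integral_exp:
  fixes E g :: "complex \<Rightarrow> complex"
  assumes E: "integrable dA E" and g: "continuous_on UNIV g" "\<And>w. norm (g w) \<le> norm w"
  shows "(\<lambda>c. \<integral>w. E w * exp (c * g w) \<partial>dA) holomorphic_on UNIV"
proof -
  have "(\<lambda>c. \<integral>w. E w * exp (c * g w) \<partial>dA) holomorphic_on ball 0 r" for r
  proof (rule power_series_holomorphic)
    show "(\<lambda>n. (\<integral>w. E w * g w ^ n \<partial>dA) / fact n * (c - 0) ^ n) sums (\<integral>w. E w * exp (c * g w) \<partial>dA)" for c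
      unfolding diff_0_right by (rule integral_exp_sums[OF E g])
  qed
  then have "(\<lambda>c. \<integral>w. E w * exp (c * g w) \<partial>dA) field_differentiable at z" for z
    by (rule holomorphic_on_imp_differentiable_at[of _ "ball 0 (norm z + 1)"]) auto
  then show ?thesis by (simp add: holomorphic_on_def)
qed

definition exp_moment :: "(complex \<Rightarrow> complex) \<Rightarrow> complex \<Rightarrow> complex \<Rightarrow> nat \<Rightarrow> nat \<Rightarrow> complex" where
  "exp_moment F \<xi> \<eta> n k =
     (\<integral>w. F w * ((w ^ n * exp (\<xi> * w)) * (cnj w ^ k * exp (\<eta> * cnj w))) \<partial>dA)"

lemma exp_moment_0: "exp_moment F 0 0 n k = (\<integral>w. F w * (w ^ n * cnj w ^ k) \<partial>dA)"
  by (simp add: exp_moment_def)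

lemma integral_diff_sum:
  fixes s :: nat and F u :: "complex \<Rightarrow> complex" and v :: "nat \<Rightarrow> complex \<Rightarrow> complex"
  assumes F: "integrable dA F" and u: "continuous_on UNIV u" and v: "\<And>b. continuous_on UNIV (v b)"
  shows "(\<integral>w. F w * (u w - (\<Sum>b<s. d b * v b w)) \<partial>dA)
    = (\<integral>w. F w * u w \<partial>dA) - (\<Sum>b<s. d b * (\<integral>w. F w * v b w \<partial>dA))"
proof -
  have iu: "integrable dA (\<lambda>w. F w * u w)" and iv: "integrable dA (\<lambda>w. F w * v b w)" for b
    by (intro integrable_mult_continuous F u v)+
  have ivs: "integrable dA (\<lambda>w. \<Sum>b<s. d b * (F w * v b w))"
    by (intro Bochner_Integration.integrable_sum integrable_mult_right iv)
  have "(\<integral>w. F w * (u w - (\<Sum>b<s. d b * v b w)) \<partial>dA)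
    = (\<integral>w. F w * u w - (\<Sum>b<s. d b * (F w * v b w)) \<partial>dA)"
    by (simp add: right_diff_distrib sum_distrib_left mult_ac)
  also have "\<dots> = (\<integral>w. F w * u w \<partial>dA) - (\<integral>w. (\<Sum>b<s. d b * (F w * v b w)) \<partial>dA)"
    by (rule Bochner_Integration.integral_diff[OF iu ivs])
  also have "(\<integral>w. (\<Sum>b<s. d b * (F w * v b w)) \<partial>dA) = (\<Sum>b<s. \<integral>w. d b * (F w * v b w) \<partial>dA)"
    by (intro Bochner_Integration.integral_sum integrable_mult_right iv)
  finally show ?thesis by (simp only: integral_mult_right_zero)
qed

text \<open>For fixed \<open>k\<close> the finite-rank identity says that a certain integrable function has zero integral
  against all \<open>w^n\<close>. It then has zero integral against \<open>w^n e^(\<xi> w)\<close>, so that the identity persists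
  with \<open>\<xi>\<close> inserted. The same argument in the conjugate variable inserts \<open>\<eta>\<close>.\<close>

lemma exp_moment_factorization:
  fixes s :: nat
  assumes F: "integrable dA F"
    and skel: "\<And>n k. exp_moment F 0 0 n k =
      (\<Sum>b<s. exp_moment F 0 0 n (ks b) * (\<Sum>a<s. C b a * exp_moment F 0 0 (ns a) k))"
  shows "exp_moment F \<xi> \<eta> n k =
      (\<Sum>b<s. exp_moment F \<xi> 0 n (ks b) * (\<Sum>a<s. C b a * exp_moment F 0 \<eta> (ns a) k))"
proof -
  have cid: "continuous_on UNIV (\<lambda>w::complex. w)" "continuous_on UNIV cnj"
    by (intro continuous_intros)+
  have step1: "exp_moment F \<xi> 0 n k =
      (\<Sum>b<s. exp_moment F \<xi> 0 n (ks b) * (\<Sum>a<s. C b a * exp_moment F 0 0 (ns a) k))" for n k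
  proof -
    define d where "d b = (\<Sum>a<s. C b a * exp_moment F 0 0 (ns a) k)" for b
    let ?p = "\<lambda>w. cnj w ^ k - (\<Sum>b<s. d b * cnj w ^ ks b)"
    have iE: "integrable dA (\<lambda>w. F w * ?p w)"
      by (intro integrable_mult_continuous[OF F] continuous_intros)
    have expand: "(\<integral>w. F w * ?p w * t w \<partial>dA)
      = (\<integral>w. F w * (t w * cnj w ^ k) \<partial>dA) - (\<Sum>b<s. d b * (\<integral>w. F w * (t w * cnj w ^ ks b) \<partial>dA))"
      if t: "continuous_on UNIV t" for t
    proof -
      have "(\<integral>w. F w * ?p w * t w \<partial>dA)
        = (\<integral>w. F w * (t w * cnj w ^ k - (\<Sum>b<s. d b * (t w * cnj w ^ ks b))) \<partial>dA)"
        by (rule Bochner_Integration.integral_cong[OF refl])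
           (simp add: right_diff_distrib left_diff_distrib sum_distrib_left sum_distrib_right mult_ac)
      also have "\<dots> = (\<integral>w. F w * (t w * cnj w ^ k) \<partial>dA)
        - (\<Sum>b<s. d b * (\<integral>w. F w * (t w * cnj w ^ ks b) \<partial>dA))"
        by (intro integral_diff_sum F continuous_intros t)
      finally show ?thesis .
    qed
    have "(\<integral>w. F w * ?p w * w ^ n \<partial>dA) = 0" for n
    proof -
      have "(\<integral>w. F w * ?p w * w ^ n \<partial>dA)
        = exp_moment F 0 0 n k - (\<Sum>b<s. d b * exp_moment F 0 0 n (ks b))"
        unfolding exp_moment_0 by (intro expand continuous_intros)
      also have "exp_moment F 0 0 n k = (\<Sum>b<s. d b * exp_moment F 0 0 n (ks b))"
        unfolding d_def by (subst skel) (simp only: mult.commute)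
      finally show ?thesis by simp
    qed
    then have "(\<integral>w. F w * ?p w * (w ^ n * exp (\<xi> * w)) \<partial>dA) = 0"
      by (intro exp_moments_zero[OF iE cid(1)]) simp_all
    moreover have "(\<integral>w. F w * ?p w * (w ^ n * exp (\<xi> * w)) \<partial>dA)
      = exp_moment F \<xi> 0 n k - (\<Sum>b<s. d b * exp_moment F \<xi> 0 n (ks b))"
      by (subst expand) (auto intro!: continuous_intros simp: exp_moment_def)
    ultimately show ?thesis by (simp add: d_def mult.commute)
  qed
  define e where "e a = (\<Sum>b<s. exp_moment F \<xi> 0 n (ks b) * C b a)" for a
  have swap: "(\<Sum>b<s. exp_moment F \<xi> 0 n (ks b) * (\<Sum>a<s. C b a * M a)) = (\<Sum>a<s. e a * M a)" for M
  proof -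
    have "(\<Sum>b<s. exp_moment F \<xi> 0 n (ks b) * (\<Sum>a<s. C b a * M a))
      = (\<Sum>b<s. \<Sum>a<s. exp_moment F \<xi> 0 n (ks b) * C b a * M a)"
      by (simp only: sum_distrib_left mult.assoc)
    also have "\<dots> = (\<Sum>a<s. \<Sum>b<s. exp_moment F \<xi> 0 n (ks b) * C b a * M a)" by (rule sum.swap)
    finally show ?thesis by (simp only: e_def sum_distrib_right)
  qed
  let ?q = "\<lambda>w. w ^ n * exp (\<xi> * w) - (\<Sum>a<s. e a * w ^ ns a)"
  have iE: "integrable dA (\<lambda>w. F w * ?q w)"
    by (intro integrable_mult_continuous[OF F] continuous_intros)
  have expand: "(\<integral>w. F w * ?q w * t w \<partial>dA)
      = (\<integral>w. F w * (w ^ n * exp (\<xi> * w) * t w) \<partial>dA) - (\<Sum>a<s. e a * (\<integral>w. F w * (w ^ ns a * t w) \<partial>dA))"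
    if t: "continuous_on UNIV t" for t
  proof -
    have "(\<integral>w. F w * ?q w * t w \<partial>dA)
      = (\<integral>w. F w * (w ^ n * exp (\<xi> * w) * t w - (\<Sum>a<s. e a * (w ^ ns a * t w))) \<partial>dA)"
      by (rule Bochner_Integration.integral_cong[OF refl])
         (simp add: right_diff_distrib left_diff_distrib sum_distrib_left sum_distrib_right mult_ac)
    also have "\<dots> = (\<integral>w. F w * (w ^ n * exp (\<xi> * w) * t w) \<partial>dA)
      - (\<Sum>a<s. e a * (\<integral>w. F w * (w ^ ns a * t w) \<partial>dA))"
      by (intro integral_diff_sum F continuous_intros t)
    finally show ?thesis .
  qed
  have "(\<integral>w. F w * ?q w * cnj w ^ k \<partial>dA) = 0" for k
  proof -
    have "(\<integral>w. F w * ?q w * cnj w ^ k \<partial>dA)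
      = exp_moment F \<xi> 0 n k - (\<Sum>a<s. e a * exp_moment F 0 0 (ns a) k)"
      by (subst expand) (auto intro!: continuous_intros simp: exp_moment_def)
    then show ?thesis by (subst (asm) step1) (simp add: swap)
  qed
  then have "(\<integral>w. F w * ?q w * (cnj w ^ k * exp (\<eta> * cnj w)) \<partial>dA) = 0"
    by (intro exp_moments_zero[OF iE cid(2)]) simp_all
  moreover have "(\<integral>w. F w * ?q w * (cnj w ^ k * exp (\<eta> * cnj w)) \<partial>dA)
    = exp_moment F \<xi> \<eta> n k - (\<Sum>a<s. e a * exp_moment F 0 \<eta> (ns a) k)"
    by (subst expand) (auto intro!: continuous_intros simp: exp_moment_def)
  ultimately show ?thesis by (simp add: swap)
qed

lemma exp_moment_conj_diag:
  "exp_moment F \<xi> (- cnj \<xi>) n k = (\<integral>w. F w * (w ^ n * cnj w ^ k) * plane_wave \<xi> w \<partial>dA)"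
proof -
  have "exp (- cnj \<xi> * cnj w) = cnj (exp (- \<xi> * w))" for w by (simp add: exp_cnj)
  then show ?thesis unfolding exp_moment_def plane_wave_def by (simp only: mult_ac)
qed

lemma norm_exp_moment_conj_diag_le:
  assumes F: "integrable dA F"
  shows "norm (exp_moment F \<xi> (- cnj \<xi>) n k) \<le> (\<integral>w. norm (F w) \<partial>dA)"
proof -
  have "norm (exp_moment F \<xi> (- cnj \<xi>) n k) \<le> (\<integral>w. norm (F w * (w ^ n * cnj w ^ k) * plane_wave \<xi> w) \<partial>dA)"
    unfolding exp_moment_conj_diag by (rule integral_norm_bound)
  also have "\<dots> \<le> (\<integral>w. norm (F w) \<partial>dA)"
  proof (rule integral_mono_AE)
    have "integrable dA (\<lambda>w. F w * ((w ^ n * cnj w ^ k) * plane_wave \<xi> w))"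
      unfolding plane_wave_def by (intro integrable_mult_continuous[OF F] continuous_intros)
    then show "integrable dA (\<lambda>w. norm (F w * (w ^ n * cnj w ^ k) * plane_wave \<xi> w))"
      by (simp only: mult.assoc integrable_norm)
    show "integrable dA (\<lambda>w. norm (F w))" using F by simp
    show "AE w in dA. norm (F w * (w ^ n * cnj w ^ k) * plane_wave \<xi> w) \<le> norm (F w)"
      using AE_dA_disk
    proof eventually_elim
      case (elim w)
      have "norm (w ^ n * cnj w ^ k) \<le> 1"
        using elim by (simp add: norm_mult norm_power mult_le_one power_le_one)
      then have "norm (F w) * norm (w ^ n * cnj w ^ k) \<le> norm (F w)" by (rule mult_left_le) simp
      then show ?case by (simp only: norm_mult norm_plane_wave mult_1_right)
    qed
  qed
  finally show ?thesis .
qed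

lemma exp_moment_conj_diag_tendsto_0:
  assumes F: "integrable dA F"
  shows "(\<lambda>N. exp_moment F (of_nat (Suc N)) (- cnj (of_nat (Suc N))) n k) \<longlonglongrightarrow> 0"
  unfolding exp_moment_conj_diag
  by (intro Riemann_Lebesgue_dA integrable_mult_continuous[OF F] continuous_intros)

lemma norm_minor_det_le:
  assumes "\<And>i j. norm (f i j) \<le> B"
  shows "norm (minor_det s f) \<le> (\<Sum>p | p permutes {0..<s}. B ^ s)"
  unfolding minor_det_expand
proof (rule order_trans[OF norm_sum sum_mono])
  fix p
  have "norm (\<Prod>i = 0..<s. f i (p i)) \<le> (\<Prod>i = 0..<s. B)"
    unfolding prod_norm[symmetric] by (rule prod_mono) (use assms in auto)
  then show "norm (signof p * (\<Prod>i = 0..<s. f i (p i))) \<le> B ^ s"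
    by (cases p rule: sign_cases) (simp_all add: norm_mult)
qed

lemma minor_det_tendsto_0:
  assumes "s > 0" "\<And>i j. (\<lambda>N. f N i j) \<longlonglongrightarrow> 0"
  shows "(\<lambda>N. minor_det s (f N)) \<longlonglongrightarrow> 0"
proof -
  have "(\<lambda>N. minor_det s (f N)) \<longlonglongrightarrow> (\<Sum>p | p permutes {0..<s}. signof p * (\<Prod>i = 0..<s. 0))"
    unfolding minor_det_expand by (intro tendsto_intros assms)
  also have "(\<Sum>p | p permutes {0..<s}. signof p * (\<Prod>i = 0..<s. 0)) = (0 :: complex)"
    using assms(1) by (intro sum.neutral) simp
  finally show ?thesis .
qed

lemma holomorphic_minor_det:
  assumes "\<And>i j. (\<lambda>z. f z i j) holomorphic_on A"
  shows "(\<lambda>z. minor_det s (f z)) holomorphic_on A"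
  unfolding minor_det_expand by (intro holomorphic_intros assms)

text \<open>Luecking's theorem for absolutely continuous measures. The determinants \<open>u\<close> and \<open>v\<close> are entire,
  and their product along \<open>\<eta> = - cnj \<xi>\<close> is, up to the constant determinant of \<open>C\<close>, a determinant
  of integrals of \<open>F w^n cnj w^k\<close> against plane waves. These are bounded and tend to \<open>0\<close> along a
  sequence, which contradicts Liouville's theorem unless the determinants are empty.\<close>

theorem finite_rank_moments_imp_AE_zero:
  assumes F: "integrable dA F" and I: "finite I"
    and rank: "\<And>n k. (\<integral>w. F w * (w ^ n * cnj w ^ k) \<partial>dA) = (\<Sum>i\<in>I. x i n * y i k)"
  shows "AE w in dA. F w = 0"
proof -
  have rank0: "exp_moment F 0 0 n k = (\<Sum>i\<in>I. x i n * y i k)" for n k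
    unfolding exp_moment_0 by (rule rank)
  show ?thesis
  proof (rule finite_rank_matrix_skeleton[of I "exp_moment F 0 0" x y, OF I rank0])
    fix s :: nat and ns ks :: "nat \<Rightarrow> nat" and C :: "nat \<Rightarrow> nat \<Rightarrow> complex"
    assume D: "minor_det s (\<lambda>i j. exp_moment F 0 0 (ns i) (ks j)) \<noteq> 0"
      and skel: "\<And>n k. exp_moment F 0 0 n k =
        (\<Sum>b<s. exp_moment F 0 0 n (ks b) * (\<Sum>a<s. C b a * exp_moment F 0 0 (ns a) k))"
    define u where "u \<xi> = minor_det s (\<lambda>i j. exp_moment F \<xi> 0 (ns i) (ks j))" for \<xi>
    define v where "v \<eta> = minor_det s (\<lambda>i j. exp_moment F 0 \<eta> (ns i) (ks j))" for \<eta>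
    \<comment> \<open>Conjugation makes the second factor holomorphic in \<open>\<xi>\<close> without changing the modulus.\<close>
    define h where "h \<xi> = u \<xi> * cnj (v (- cnj \<xi>))" for \<xi>
    let ?full = "\<lambda>\<xi>. minor_det s (\<lambda>i j. exp_moment F \<xi> (- cnj \<xi>) (ns i) (ks j))"
    have det: "minor_det s (\<lambda>i j. exp_moment F \<xi> \<eta> (ns i) (ks j)) = u \<xi> * (minor_det s C * v \<eta>)" for \<xi> \<eta>
      unfolding exp_moment_factorization[OF F skel, of \<xi> \<eta>] u_def v_def by (simp only: minor_det_mult)
    have u0: "u 0 \<noteq> 0" "v 0 \<noteq> 0" using D by (simp_all add: u_def v_def)
    have C: "minor_det s C \<noteq> 0"
      using det[of 0 0] D by auto
    have norm_h: "norm (h \<xi>) = norm (?full \<xi>) / norm (minor_det s C)" for \<xi>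
      unfolding det h_def using C by (simp add: norm_mult)
    have hol_u: "u holomorphic_on UNIV"
    proof -
      have "(\<lambda>\<xi>. exp_moment F \<xi> 0 n k) holomorphic_on UNIV" for n k
      proof -
        have "(\<lambda>\<xi>. \<integral>w. F w * (w ^ n * cnj w ^ k) * exp (\<xi> * w) \<partial>dA) holomorphic_on UNIV"
          by (intro holomorphic_integral_exp integrable_mult_continuous[OF F] continuous_intros) simp
        then show ?thesis by (simp add: exp_moment_def mult_ac)
      qed
      then show ?thesis unfolding u_def by (rule holomorphic_minor_det)
    qed
    have hol_v: "v holomorphic_on UNIV"
    proof -
      have "(\<lambda>\<eta>. exp_moment F 0 \<eta> n k) holomorphic_on UNIV" for n k
      proof -
        have "(\<lambda>\<eta>. \<integral>w. F w * (w ^ n * cnj w ^ k) * exp (\<eta> * cnj w) \<partial>dA) holomorphic_on UNIV"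
          by (intro holomorphic_integral_exp integrable_mult_continuous[OF F] continuous_intros) simp
        then show ?thesis by (simp add: exp_moment_def mult_ac)
      qed
      then show ?thesis unfolding v_def by (rule holomorphic_minor_det)
    qed
    have "(v \<circ> uminus) holomorphic_on UNIV"
      by (intro holomorphic_on_compose holomorphic_on_minus holomorphic_on_ident
          holomorphic_on_subset[OF hol_v]) simp
    then have "(cnj \<circ> (v \<circ> uminus) \<circ> cnj) holomorphic_on UNIV"
      by (intro holomorphic_on_compose_cnj_cnj) auto
    then have hol_h: "h holomorphic_on UNIV"
      unfolding h_def using hol_u by (intro holomorphic_on_mult) (simp_all add: o_def)
    have "bounded (range h)"
    proof -
      have "norm (h \<xi>) \<le> (\<Sum>p | p permutes {0..<s}. (\<integral>w. norm (F w) \<partial>dA) ^ s) / norm (minor_det s C)" for \<xi>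
        unfolding norm_h by (intro divide_right_mono norm_minor_det_le norm_exp_moment_conj_diag_le F) simp
      then show ?thesis by (auto simp: bounded_iff)
    qed
    then obtain c where c: "\<And>\<xi>. h \<xi> = c"
      using Liouville_theorem[OF hol_h] by (auto simp: constant_on_def)
    have "h 0 \<noteq> 0" using u0 by (simp add: h_def)
    have "s = 0"
    proof (rule ccontr)
      assume "s \<noteq> 0"
      then have lim: "(\<lambda>N. ?full (of_nat (Suc N))) \<longlonglongrightarrow> 0"
        by (intro minor_det_tendsto_0 exp_moment_conj_diag_tendsto_0 F) simp
      have "(\<lambda>N. norm (h (of_nat (Suc N)))) \<longlonglongrightarrow> norm (0 :: complex) / norm (minor_det s C)"
        unfolding norm_h by (rule tendsto_divide[OF tendsto_norm[OF lim] tendsto_const]) (use C in simp)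
      then have "(\<lambda>N::nat. norm c) \<longlonglongrightarrow> 0"
        by (simp only: c norm_zero div_0)
      then have "c = 0" by (simp add: LIMSEQ_const_iff)
      with c \<open>h 0 \<noteq> 0\<close> show False by simp
    qed
    then have "exp_moment F 0 0 n k = 0" for n k
      by (subst skel) simp
    then show ?thesis
      unfolding exp_moment_0 by (rule moments_zero_imp_AE_zero[OF F])
  qed
qed

section \<open>The finite-rank criterion\<close>

lemma sum_fun_apply: "(\<Sum>v\<in>A. f v) z = (\<Sum>v\<in>A. f v z)"
  by (induction A rule: infinite_finite_induct) auto

text \<open>Elements of \<open>B\<close> are arbitrary functions, about whose power series nothing is known. Passing to a basis
  of the range that consists of images \<open>toeplitz F w^n\<close> turns linear dependence of the images into
  linear dependence of their Taylor coefficients, that is, of the rows of the moment matrix.\<close>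

lemma toeplitz_range_in_span_imp_finite_rank_moments:
  assumes F: "integrable dA F" and B: "finite B"
    and sp: "\<And>n. toeplitz F (\<lambda>w. w ^ n) \<in> module.span fun_scale B"
  obtains I :: "(complex \<Rightarrow> complex) set" and x y where "finite I"
    "\<And>n k. (\<integral>w. F w * (w ^ n * cnj w ^ k) \<partial>dA) = (\<Sum>i\<in>I. x i n * y i k)"
proof -
  interpret fs: vector_space fun_scale by (rule vector_space_fun_scale)
  let ?T = "\<lambda>n. toeplitz F (\<lambda>w. w ^ n)"
  let ?m = "\<lambda>n k. \<integral>w. F w * (w ^ n * cnj w ^ k) \<partial>dA"
  obtain I where I: "I \<subseteq> range ?T" "\<not> fs.dependent I" "range ?T \<subseteq> fs.span I"
    using fs.maximal_independent_subset by blast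
  have "I \<subseteq> fs.span B" using I(1) sp by auto
  then have finI: "finite I" using fs.independent_span_bound[OF B I(2)] by blast
  have "\<exists>n. i = ?T n" if "i \<in> I" for i using I(1) that by auto
  then obtain \<nu> where \<nu>: "\<And>i. i \<in> I \<Longrightarrow> i = ?T (\<nu> i)" by metis
  have "\<exists>u. ?T n = (\<Sum>i\<in>I. fun_scale (u i) i)" for n
  proof -
    have "?T n \<in> fs.span I" using I(3) by auto
    then show ?thesis unfolding fs.span_finite[OF finI] by auto
  qed
  then obtain u where u: "\<And>n. ?T n = (\<Sum>i\<in>I. fun_scale (u n i) i)" by metis
  have series: "(\<lambda>k. (of_nat (Suc k) * ?m n k) * z ^ k) sums ?T n z" if z: "norm z < 1" for n z
    using bergman_integral_sums[OF integrable_mult_power[OF F, of n] z]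
    by (simp only: toeplitz_eq_bergman_integral[OF z] mult.assoc)
  have "?m n k = (\<Sum>i\<in>I. u n i * ?m (\<nu> i) k)" for n k
  proof -
    have "of_nat (Suc k) * (?m n k - (\<Sum>i\<in>I. u n i * ?m (\<nu> i) k)) = 0"
    proof (rule power_series_eq_0[of "\<lambda>k. of_nat (Suc k) * (?m n k - (\<Sum>i\<in>I. u n i * ?m (\<nu> i) k))"])
      fix z :: complex assume z: "norm z < 1"
      have "(\<lambda>k. \<Sum>i\<in>I. u n i * ((of_nat (Suc k) * ?m (\<nu> i) k) * z ^ k)) sums (\<Sum>i\<in>I. u n i * ?T (\<nu> i) z)"
        by (intro sums_sum sums_mult series z)
      then have "(\<lambda>k. (of_nat (Suc k) * ?m n k) * z ^ k - (\<Sum>i\<in>I. u n i * ((of_nat (Suc k) * ?m (\<nu> i) k) * z ^ k)))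
        sums (?T n z - (\<Sum>i\<in>I. u n i * ?T (\<nu> i) z))"
        by (rule sums_diff[OF series[OF z]])
      moreover have "?T n z = (\<Sum>i\<in>I. u n i * ?T (\<nu> i) z)"
        by (subst u) (auto simp: sum_fun_apply fun_scale_def \<nu>[symmetric] intro!: sum.cong)
      moreover have "(of_nat (Suc k) * ?m n k) * z ^ k - (\<Sum>i\<in>I. u n i * ((of_nat (Suc k) * ?m (\<nu> i) k) * z ^ k))
        = of_nat (Suc k) * (?m n k - (\<Sum>i\<in>I. u n i * ?m (\<nu> i) k)) * z ^ k" for k
        by (simp only: right_diff_distrib left_diff_distrib sum_distrib_left sum_distrib_right mult_ac)
      ultimately show "(\<lambda>k. of_nat (Suc k) * (?m n k - (\<Sum>i\<in>I. u n i * ?m (\<nu> i) k)) * z ^ k) sums 0"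
        by simp
    qed
    then show ?thesis using of_nat_neq_0[of k, where 'a = complex] by simp
  qed
  then show thesis by (rule that[OF finI, of "\<lambda>i n. u n i" "\<lambda>i k. ?m (\<nu> i) k"])
qed

lemma toeplitz_linear:
  assumes "\<And>i. i \<in> X \<Longrightarrow> integrable dA (\<lambda>w. f w * h i w)"
  shows "toeplitz f (\<lambda>w. \<Sum>i\<in>X. c i * h i w) z = (\<Sum>i\<in>X. c i * toeplitz f (h i) z)"
proof (cases "norm z < 1")
  case True
  have "toeplitz f (\<lambda>w. \<Sum>i\<in>X. c i * h i w) z = bergman_integral (\<lambda>w. \<Sum>i\<in>X. c i * (f w * h i w)) z"
    by (simp add: toeplitz_eq_bergman_integral[OF True] sum_distrib_left mult_ac)
  also have "\<dots> = (\<Sum>i\<in>X. c i * bergman_integral (\<lambda>w. f w * h i w) z)"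
    by (rule bergman_integral_linear[OF assms True])
  finally show ?thesis by (simp add: toeplitz_eq_bergman_integral[OF True])
qed (simp add: toeplitz_outside)

text \<open>The moments of high order vanish because every monomial in the integrand is then bounded and
  off-diagonal. That the image is a polynomial on the disk makes its product with \<open>P\<close> integrable, so
  that the operator product is linear on polynomials.\<close>

lemma toeplitz_cnj_laurent_power_polynomial:
  assumes R: "finite R" and Q: "integrable dA (laurent R q)"
  obtains K c where
    "toeplitz (\<lambda>w. cnj (laurent R q w)) (\<lambda>w. w ^ n) = (\<lambda>z. if norm z < 1 then \<Sum>k<K. c k * z ^ k else 0)"
proof -
  let ?f = "\<lambda>w. cnj (laurent R q w) * w ^ n"
  define K where "K = n + nat (\<Sum>b\<in>R. \<bar>b\<bar>) + 1"
  have int: "integrable dA ?f"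
    using integrable_mult_power[of "\<lambda>w. cnj (laurent R q w)" n] Q by simp
  have zero: "(\<integral>w. ?f w * cnj w ^ k \<partial>dA) = 0" if k: "k \<ge> K" for k
  proof -
    have b: "b + int k \<ge> 0" "int n \<noteq> b + int k" if "b \<in> R" for b
    proof -
      have "\<bar>b\<bar> \<le> (\<Sum>b\<in>R. \<bar>b\<bar>)" using R that by (intro member_le_sum) auto
      then show "b + int k \<ge> 0" "int n \<noteq> b + int k" using k by (auto simp: K_def)
    qed
    have "(\<integral>w. ?f w * cnj w ^ k \<partial>dA)
      = (\<integral>w. (\<Sum>b\<in>R. cnj (q b) * (w powi int n * cnj w powi (b + int k))) \<partial>dA)"
    proof (rule integral_cong_AE)
      show "AE w in dA. ?f w * cnj w ^ k = (\<Sum>b\<in>R. cnj (q b) * (w powi int n * cnj w powi (b + int k)))"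
        using AE_dA_nonzero
        by eventually_elim (simp add: laurent_def sum_distrib_left sum_distrib_right power_int_add mult_ac)
      show "(\<lambda>w. ?f w * cnj w ^ k) \<in> borel_measurable dA"
        using integrable_mult_cnj_power[OF int] by (rule borel_measurable_integrable)
      show "(\<lambda>w. \<Sum>b\<in>R. cnj (q b) * (w powi int n * cnj w powi (b + int k))) \<in> borel_measurable dA"
        by (intro borel_measurable_sum borel_measurable_times borel_measurable_const measurable_monomial)
    qed
    also have "\<dots> = (\<Sum>b\<in>R. \<integral>w. cnj (q b) * (w powi int n * cnj w powi (b + int k)) \<partial>dA)"
      by (intro Bochner_Integration.integral_sum integrable_mult_right integrable_monomial) (use b in force)
    also have "\<dots> = 0"
    proof (rule sum.neutral, rule ballI)
      fix b assume "b \<in> R"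
      then have "(\<integral>w. w powi int n * cnj w powi (b + int k) \<partial>dA) = 0"
        using b[of b] by (subst moment_monomial) auto
      then show "(\<integral>w. cnj (q b) * (w powi int n * cnj w powi (b + int k)) \<partial>dA) = 0"
        by (simp only: integral_mult_right_zero mult_zero_right)
    qed
    finally show ?thesis .
  qed
  let ?c = "\<lambda>k. of_nat (Suc k) * (\<integral>w. ?f w * cnj w ^ k \<partial>dA)"
  have "toeplitz (\<lambda>w. cnj (laurent R q w)) (\<lambda>w. w ^ n) z = (\<Sum>k<K. ?c k * z ^ k)" if z: "norm z < 1" for z
  proof -
    have "(\<lambda>k. ?c k * z ^ k) sums (\<Sum>k<K. ?c k * z ^ k)"
      by (rule sums_finite) (use zero in \<open>auto simp: not_less\<close>)
    with bergman_integral_sums[OF int z] show ?thesis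
      unfolding toeplitz_eq_bergman_integral[OF z] by (rule sums_unique2)
  qed
  then have "toeplitz (\<lambda>w. cnj (laurent R q w)) (\<lambda>w. w ^ n) = (\<lambda>z. if norm z < 1 then \<Sum>k<K. ?c k * z ^ k else 0)"
    using toeplitz_outside by (intro ext) auto
  then show thesis by (rule that)
qed

lemma integrable_mult_toeplitz_cnj_laurent_power:
  assumes "finite R" "integrable dA (laurent R q)" "integrable dA P"
  shows "integrable dA (\<lambda>w. P w * toeplitz (\<lambda>w. cnj (laurent R q w)) (\<lambda>w. w ^ n) w)"
proof -
  obtain K c where eq:
    "toeplitz (\<lambda>w. cnj (laurent R q w)) (\<lambda>w. w ^ n) = (\<lambda>z. if norm z < 1 then \<Sum>k<K. c k * z ^ k else 0)"
    using toeplitz_cnj_laurent_power_polynomial[OF assms(1,2), of n] by blast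
  show ?thesis
    unfolding eq
  proof (rule integrable_dA_mult_bounded[OF assms(3)])
    show "(\<lambda>z. if norm z < 1 then \<Sum>k<K. c k * z ^ k else 0) \<in> borel_measurable dA"
      by (rule borel_measurable_dA) simp
    fix z :: complex assume "norm z < 1"
    then have "norm (\<Sum>k<K. c k * z ^ k) \<le> (\<Sum>k<K. norm (c k))"
      by (intro order_trans[OF norm_sum] sum_mono)
         (simp add: norm_mult norm_power mult_left_le power_le_one)
    with \<open>norm z < 1\<close> show "norm (if norm z < 1 then \<Sum>k<K. c k * z ^ k else 0) \<le> (\<Sum>k<K. norm (c k))"
      by simp
  qed
qed

definition toeplitz_defect ::
  "nat \<Rightarrow> (nat \<Rightarrow> complex \<Rightarrow> complex) \<Rightarrow> (nat \<Rightarrow> complex \<Rightarrow> complex) \<Rightarrow> (complex \<Rightarrow> complex) \<Rightarrow>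
    (complex \<Rightarrow> complex) \<Rightarrow> complex \<Rightarrow> complex" where
  "toeplitz_defect N P Q H h z =
     (\<Sum>j=1..N. toeplitz (P j) (toeplitz (\<lambda>w. cnj (Q j w)) h) z) - toeplitz H h z"

lemma toeplitz_defect_poly:
  assumes lau: "\<And>j. j \<in> {1..N} \<Longrightarrow> finite (R j) \<and> Q j = laurent (R j) (q j)"
    and P: "\<And>j. j \<in> {1..N} \<Longrightarrow> integrable dA (P j)"
    and Q: "\<And>j. j \<in> {1..N} \<Longrightarrow> integrable dA (Q j)" and H: "integrable dA H"
  shows "toeplitz_defect N P Q H (poly p) =
    (\<Sum>i\<le>degree p. fun_scale (coeff p i) (toeplitz_defect N P Q H (\<lambda>w. w ^ i)))"
proof
  fix z
  have p: "poly p = (\<lambda>w. \<Sum>i\<le>degree p. coeff p i * w ^ i)"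
    by (rule ext) (rule poly_altdef)
  have PQ: "toeplitz (P j) (toeplitz (\<lambda>w. cnj (Q j w)) (poly p)) z
    = (\<Sum>i\<le>degree p. coeff p i * toeplitz (P j) (toeplitz (\<lambda>w. cnj (Q j w)) (\<lambda>w. w ^ i)) z)"
    if j: "j \<in> {1..N}" for j
  proof -
    have "toeplitz (\<lambda>w. cnj (Q j w)) (poly p)
      = (\<lambda>z. \<Sum>i\<le>degree p. coeff p i * toeplitz (\<lambda>w. cnj (Q j w)) (\<lambda>w. w ^ i) z)"
      unfolding p by (intro ext toeplitz_linear integrable_mult_power) (use Q[OF j] in simp)
    moreover have "integrable dA (\<lambda>w. P j w * toeplitz (\<lambda>w. cnj (Q j w)) (\<lambda>w. w ^ i) w)" for i
      using integrable_mult_toeplitz_cnj_laurent_power[of "R j" "q j" "P j" i] lau[OF j] P[OF j] Q[OF j] by simp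
    ultimately show ?thesis by (simp only: toeplitz_linear)
  qed
  have "toeplitz H (poly p) z = (\<Sum>i\<le>degree p. coeff p i * toeplitz H (\<lambda>w. w ^ i) z)"
    unfolding p by (intro toeplitz_linear integrable_mult_power H)
  then have "toeplitz_defect N P Q H (poly p) z
    = (\<Sum>j=1..N. \<Sum>i\<le>degree p. coeff p i * toeplitz (P j) (toeplitz (\<lambda>w. cnj (Q j w)) (\<lambda>w. w ^ i)) z)
      - (\<Sum>i\<le>degree p. coeff p i * toeplitz H (\<lambda>w. w ^ i) z)"
    unfolding toeplitz_defect_def by (simp only: PQ cong: sum.cong)
  also have "\<dots> = (\<Sum>i\<le>degree p. coeff p i * toeplitz_defect N P Q H (\<lambda>w. w ^ i) z)"
    by (subst sum.swap) (simp add: toeplitz_defect_def right_diff_distrib sum_subtractf sum_distrib_left)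
  finally show "toeplitz_defect N P Q H (poly p) z
    = (\<Sum>i\<le>degree p. fun_scale (coeff p i) (toeplitz_defect N P Q H (\<lambda>w. w ^ i))) z"
    by (simp add: sum_fun_apply fun_scale_def)
qed

text \<open>The solution of the system with the value at \<open>1\<close> prescribed by the constraint.\<close>

definition defect_symbol :: "nat \<Rightarrow> (nat \<Rightarrow> int set) \<Rightarrow> (nat \<Rightarrow> int \<Rightarrow> complex) \<Rightarrow>
    (nat \<Rightarrow> int set) \<Rightarrow> (nat \<Rightarrow> int \<Rightarrow> complex) \<Rightarrow> complex \<Rightarrow> complex" where
  "defect_symbol N S p R q w = (\<Sum>j=1..N. product_symbol (S j) (p j) (R j) (q j) w)"

text \<open>The two bounds on \<open>n\<close> are those of \<open>toeplitz_product_power\<close>, required for all \<open>j\<close> at once.\<close>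

lemma toeplitz_defect_power:
  assumes fin: "\<And>j. j \<in> {1..N} \<Longrightarrow> finite (S j)" "\<And>j. j \<in> {1..N} \<Longrightarrow> finite (R j)"
    and P: "\<And>j. j \<in> {1..N} \<Longrightarrow> P j = laurent (S j) (p j)"
    and Q: "\<And>j. j \<in> {1..N} \<Longrightarrow> Q j = laurent (R j) (q j)"
    and H: "integrable dA H"
    and n: "\<And>j a b. j \<in> {1..N} \<Longrightarrow> a \<in> S j \<Longrightarrow> b \<in> R j \<Longrightarrow> int n \<ge> \<bar>a\<bar> + \<bar>b\<bar> + 1"
      "\<And>j b. j \<in> {1..N} \<Longrightarrow> b \<in> R j \<Longrightarrow> int n \<ge> \<bar>b\<bar>"
  shows "integrable dA (\<lambda>w. (defect_symbol N S p R q w - H w) * w ^ n)"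
    and "toeplitz_defect N P Q H (\<lambda>w. w ^ n) = toeplitz (\<lambda>w. defect_symbol N S p R q w - H w) (\<lambda>w. w ^ n)"
proof -
  let ?s = "\<lambda>j w. product_symbol (S j) (p j) (R j) (q j) w * w ^ n"
  have int_s: "integrable dA (?s j)" if "j \<in> {1..N}" for j
    by (rule integrable_product_symbol_power) (use fin n that in auto)
  have iS: "integrable dA (\<lambda>w. \<Sum>j=1..N. 1 * ?s j w)"
    by (intro Bochner_Integration.integrable_sum integrable_mult_right int_s)
  have iH: "integrable dA (\<lambda>w. H w * w ^ n)" by (rule integrable_mult_power[OF H])
  have eq: "(\<lambda>w. (defect_symbol N S p R q w - H w) * w ^ n)
    = (\<lambda>w. 1 * (\<Sum>j=1..N. 1 * ?s j w) + - 1 * (H w * w ^ n))"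
    by (simp add: defect_symbol_def left_diff_distrib sum_distrib_right)
  show "integrable dA (\<lambda>w. (defect_symbol N S p R q w - H w) * w ^ n)"
    unfolding eq by (intro Bochner_Integration.integrable_add integrable_mult_right iS iH)
  show "toeplitz_defect N P Q H (\<lambda>w. w ^ n) = toeplitz (\<lambda>w. defect_symbol N S p R q w - H w) (\<lambda>w. w ^ n)"
  proof
    fix z
    show "toeplitz_defect N P Q H (\<lambda>w. w ^ n) z = toeplitz (\<lambda>w. defect_symbol N S p R q w - H w) (\<lambda>w. w ^ n) z"
    proof (cases "norm z < 1")
      case True
      have "toeplitz (\<lambda>w. defect_symbol N S p R q w - H w) (\<lambda>w. w ^ n) z
        = 1 * bergman_integral (\<lambda>w. \<Sum>j=1..N. 1 * ?s j w) z + - 1 * bergman_integral (\<lambda>w. H w * w ^ n) z"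
        unfolding toeplitz_eq_bergman_integral[OF True] eq by (rule bergman_integral_add[OF iS iH True])
      also have "bergman_integral (\<lambda>w. \<Sum>j=1..N. 1 * ?s j w) z = (\<Sum>j=1..N. 1 * bergman_integral (?s j) z)"
        by (rule bergman_integral_linear[OF int_s True])
      also have "\<dots> = (\<Sum>j=1..N. toeplitz (P j) (toeplitz (\<lambda>w. cnj (Q j w)) (\<lambda>w. w ^ n)) z)"
      proof (rule sum.cong[OF refl])
        fix j assume j: "j \<in> {1..N}"
        have "toeplitz (laurent (S j) (p j)) (toeplitz (\<lambda>w. cnj (laurent (R j) (q j) w)) (\<lambda>w. w ^ n)) z
          = bergman_integral (?s j) z"
          by (rule toeplitz_product_power) (use fin n j True in auto)
        then show "1 * bergman_integral (?s j) z = toeplitz (P j) (toeplitz (\<lambda>w. cnj (Q j w)) (\<lambda>w. w ^ n)) z"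
          by (simp add: P[OF j] Q[OF j])
      qed
      finally show ?thesis by (simp add: toeplitz_defect_def toeplitz_eq_bergman_integral[OF True])
    qed (simp add: toeplitz_defect_def toeplitz_outside)
  qed
qed

lemma defect_symbol_solves:
  assumes P: "\<And>j. j \<in> {1..N} \<Longrightarrow> P j = laurent (S j) (p j)"
    and Q: "\<And>j. j \<in> {1..N} \<Longrightarrow> Q j = laurent (R j) (q j)" and z: "z \<noteq> 0"
  shows "defect_symbol N S p R q differentiable (at z)"
    and "wirtinger_z (defect_symbol N S p R q) z = (\<Sum>j=1..N. deriv (P j) z * cnj (Q j (1 / cnj z)))"
    and "wirtinger_zbar (defect_symbol N S p R q) z = (\<Sum>j=1..N. P j (1 / cnj z) * cnj (deriv (Q j) z))"
proof -
  have "((\<lambda>w. \<Sum>j=1..N. product_symbol (S j) (p j) (R j) (q j) w) has_derivative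
    (\<lambda>h. \<Sum>j=1..N. (deriv (P j) z * cnj (Q j (1 / cnj z))) * h + (P j (1 / cnj z) * cnj (deriv (Q j) z)) * cnj h)) (at z)"
  proof (rule has_derivative_sum)
    fix j assume j: "j \<in> {1..N}"
    show "(product_symbol (S j) (p j) (R j) (q j) has_derivative
      (\<lambda>h. (deriv (P j) z * cnj (Q j (1 / cnj z))) * h + (P j (1 / cnj z) * cnj (deriv (Q j) z)) * cnj h)) (at z)"
      unfolding P[OF j] Q[OF j] by (rule has_derivative_product_symbol[OF z])
  qed
  then have *: "(defect_symbol N S p R q has_derivative
    (\<lambda>h. (\<Sum>j=1..N. deriv (P j) z * cnj (Q j (1 / cnj z))) * h
      + (\<Sum>j=1..N. P j (1 / cnj z) * cnj (deriv (Q j) z)) * cnj h)) (at z)"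
    by (simp add: defect_symbol_def[abs_def] sum.distrib sum_distrib_right)
  show "defect_symbol N S p R q differentiable (at z)"
    "wirtinger_z (defect_symbol N S p R q) z = (\<Sum>j=1..N. deriv (P j) z * cnj (Q j (1 / cnj z)))"
    "wirtinger_zbar (defect_symbol N S p R q) z = (\<Sum>j=1..N. P j (1 / cnj z) * cnj (deriv (Q j) z))"
    using wirtinger_of_has_derivative[OF *] by this
qed

theorem theoremB:
  fixes N :: nat
    and P Q :: "nat \<Rightarrow> complex \<Rightarrow> complex"
    and H :: "complex \<Rightarrow> complex"
  assumes "N \<ge> 1"
    and "\<And>j. j \<in> {1..N} \<Longrightarrow> laurent_polynomial (P j)"
    and "\<And>j. j \<in> {1..N} \<Longrightarrow> integrable dA (P j)"
    and "\<And>j. j \<in> {1..N} \<Longrightarrow> laurent_polynomial (Q j)"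
    and "\<And>j. j \<in> {1..N} \<Longrightarrow> integrable dA (Q j)"
    and "integrable dA H"
  shows "finite_rank (\<lambda>h z. (\<Sum>j=1..N. toeplitz (P j) (toeplitz (\<lambda>w. cnj (Q j w)) h) z)
                             - toeplitz H h z)
    \<longleftrightarrow>
    (\<exists>G :: complex \<Rightarrow> complex.
        (AE w in dA. H w = G w) \<and>
        (\<forall>z. z \<noteq> 0 \<longrightarrow>
           G differentiable (at z) \<and>
           wirtinger_z G z = (\<Sum>j=1..N. deriv (P j) z * cnj (Q j (1 / cnj z))) \<and>
           wirtinger_zbar G z = (\<Sum>j=1..N. P j (1 / cnj z) * cnj (deriv (Q j) z))) \<and>
        G 1 = (\<Sum>j=1..N. P j 1 * cnj (Q j 1)))"
    (is "finite_rank ?L \<longleftrightarrow> (\<exists>G. ?sol G)")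
proof -
  have "\<forall>j\<in>{1..N}. \<exists>S p. finite S \<and> P j = laurent S p" "\<forall>j\<in>{1..N}. \<exists>R q. finite R \<and> Q j = laurent R q"
    using assms(2,4) by (auto simp: laurent_polynomial_def laurent_def[abs_def])
  then obtain S p R q where SR: "\<And>j. j \<in> {1..N} \<Longrightarrow> finite (S j) \<and> P j = laurent (S j) (p j)"
    "\<And>j. j \<in> {1..N} \<Longrightarrow> finite (R j) \<and> Q j = laurent (R j) (q j)"
    by metis
  then have fin: "\<And>j. j \<in> {1..N} \<Longrightarrow> finite (S j)" "\<And>j. j \<in> {1..N} \<Longrightarrow> finite (R j)"
    and PS: "\<And>j. j \<in> {1..N} \<Longrightarrow> P j = laurent (S j) (p j)"
    and QR: "\<And>j. j \<in> {1..N} \<Longrightarrow> Q j = laurent (R j) (q j)" by blast+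
  interpret fs: vector_space fun_scale by (rule vector_space_fun_scale)
  let ?L' = "toeplitz_defect N P Q H"
  have L: "?L = ?L'" by (intro ext) (simp add: toeplitz_defect_def)
  let ?G = "defect_symbol N S p R q"
  \<comment> \<open>beyond \<open>n0\<close> the operator acts on \<open>z^n\<close> as the Toeplitz operator with symbol \<open>?G - H\<close>\<close>
  define n0 where "n0 = nat (\<Sum>j=1..N. (\<Sum>a\<in>S j. \<bar>a\<bar>) + (\<Sum>b\<in>R j. \<bar>b\<bar>)) + 1"
  have n0: "int n \<ge> \<bar>a\<bar> + \<bar>b\<bar> + 1" if "n \<ge> n0" "j \<in> {1..N}" "a \<in> insert 0 (S j)" "b \<in> R j" for n j a b
  proof -
    have "\<bar>a\<bar> \<le> (\<Sum>a\<in>S j. \<bar>a\<bar>)"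
    proof (cases "a = 0")
      case False
      then show ?thesis using fin(1)[OF that(2)] that(3) by (intro member_le_sum) auto
    qed (simp add: sum_nonneg)
    moreover have "\<bar>b\<bar> \<le> (\<Sum>b\<in>R j. \<bar>b\<bar>)"
      using fin(2)[OF that(2)] that(4) by (intro member_le_sum) auto
    moreover have "(\<Sum>a\<in>S j. \<bar>a\<bar>) + (\<Sum>b\<in>R j. \<bar>b\<bar>) \<le> (\<Sum>j=1..N. (\<Sum>a\<in>S j. \<bar>a\<bar>) + (\<Sum>b\<in>R j. \<bar>b\<bar>))"
      using that(2) by (intro member_le_sum[of j "{1..N}" "\<lambda>j. (\<Sum>a\<in>S j. \<bar>a\<bar>) + (\<Sum>b\<in>R j. \<bar>b\<bar>)"]) (auto intro: add_nonneg_nonneg sum_nonneg)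
    ultimately show ?thesis using that(1) by (auto simp: n0_def)
  qed
  have power: "integrable dA (\<lambda>w. (?G w - H w) * w ^ n)"
    "?L' (\<lambda>w. w ^ n) = toeplitz (\<lambda>w. ?G w - H w) (\<lambda>w. w ^ n)" if n: "n \<ge> n0" for n
  proof -
    have 1: "int n \<ge> \<bar>a\<bar> + \<bar>b\<bar> + 1" if "j \<in> {1..N}" "a \<in> S j" "b \<in> R j" for j a b
      using n0[OF n that(1) _ that(3)] that(2) by blast
    have 2: "int n \<ge> \<bar>b\<bar>" if "j \<in> {1..N}" "b \<in> R j" for j b
      using n0[OF n that(1) _ that(2), of 0] by simp
    show "integrable dA (\<lambda>w. (?G w - H w) * w ^ n)"
      "?L' (\<lambda>w. w ^ n) = toeplitz (\<lambda>w. ?G w - H w) (\<lambda>w. w ^ n)"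
      by (rule toeplitz_defect_power[where N = N and S = S and R = R and P = P and p = p
        and Q = Q and q = q and H = H and n = n, OF fin PS QR assms(6) 1 2]; assumption)+
  qed
  have poly: "?L' (poly r) = (\<Sum>i\<le>degree r. fun_scale (coeff r i) (?L' (\<lambda>w. w ^ i)))" for r
    by (rule toeplitz_defect_poly[OF SR(2) assms(3,5,6)])
  have sol: "?G differentiable (at z)"
    "wirtinger_z ?G z = (\<Sum>j=1..N. deriv (P j) z * cnj (Q j (1 / cnj z)))"
    "wirtinger_zbar ?G z = (\<Sum>j=1..N. P j (1 / cnj z) * cnj (deriv (Q j) z))" if "z \<noteq> 0" for z
    using defect_symbol_solves[where N = N and S = S and R = R and P = P and p = p
        and Q = Q and q = q, OF PS QR that] by simp_all
  have G1: "?G 1 = (\<Sum>j=1..N. P j 1 * cnj (Q j 1))"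
    by (simp add: defect_symbol_def product_symbol_1 PS QR)
  show ?thesis
    unfolding L
  proof
    assume "finite_rank ?L'"
    then obtain B where B: "finite B" "?L' ` range poly \<subseteq> fs.span B"
      by (auto simp: finite_rank_def)
    let ?F = "\<lambda>w. (?G w - H w) * w ^ n0"
    have F: "integrable dA ?F" by (rule power(1)) simp
    have "toeplitz ?F (\<lambda>w. w ^ n) \<in> fs.span B" for n
    proof -
      have "toeplitz ?F (\<lambda>w. w ^ n) = toeplitz (\<lambda>w. ?G w - H w) (\<lambda>w. w ^ (n0 + n))"
        by (intro ext) (simp add: toeplitz_def power_add mult.assoc)
      also have "\<dots> = ?L' (\<lambda>w. w ^ (n0 + n))" by (rule power(2)[symmetric]) simp
      also have "(\<lambda>w::complex. w ^ (n0 + n)) = poly (monom 1 (n0 + n))"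
        by (intro ext) (simp add: Polynomial.poly_monom)
      finally show ?thesis using B(2) by auto
    qed
    then have "AE w in dA. ?F w = 0"
    proof (rule toeplitz_range_in_span_imp_finite_rank_moments[OF F B(1)])
      fix I :: "(complex \<Rightarrow> complex) set" and x y
      assume "finite I"
        and "\<And>n k. (\<integral>w. ?F w * (w ^ n * cnj w ^ k) \<partial>dA) = (\<Sum>i\<in>I. x i n * y i k)"
      then show ?thesis by (rule finite_rank_moments_imp_AE_zero[OF F])
    qed
    then have "AE w in dA. H w = ?G w"
      using AE_dA_nonzero by eventually_elim simp
    then show "\<exists>G. ?sol G" using sol G1 by blast
  next
    assume "\<exists>G. ?sol G"
    then obtain G where G: "?sol G" by blast
    have "G z = ?G z" if "z \<noteq> 0" for z
      by (rule wirtinger_determines_function) (use G sol G1 that in auto)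
    then have HG: "AE w in dA. H w = ?G w"
    proof -
      have "AE w in dA. H w = G w" using G by (rule conjunct1)
      then show ?thesis using AE_dA_nonzero
        by eventually_elim (simp add: \<open>\<And>z. z \<noteq> 0 \<Longrightarrow> G z = ?G z\<close>)
    qed
    have zero: "?L' (\<lambda>w. w ^ n) = 0" if n: "n \<ge> n0" for n
    proof
      fix z
      show "?L' (\<lambda>w. w ^ n) z = 0 z"
      proof (cases "norm z < 1")
        case True
        have "bergman_integral (\<lambda>w. (?G w - H w) * w ^ n) z = bergman_integral (\<lambda>w. 0) z"
          by (rule bergman_integral_cong)
             (use HG borel_measurable_integrable[OF power(1)[OF n]] in \<open>auto elim: eventually_mono\<close>)
        then show ?thesis
          by (simp add: power(2)[OF n] toeplitz_eq_bergman_integral[OF True] bergman_integral_def)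
      qed (simp add: power(2)[OF n] toeplitz_outside)
    qed
    let ?B = "(\<lambda>n. ?L' (\<lambda>w. w ^ n)) ` {..<n0}"
    have "?L' (\<lambda>w. w ^ n) \<in> fs.span ?B" for n
    proof (cases "n < n0")
      case True
      then show ?thesis by (intro fs.span_base) auto
    next
      case False
      then show ?thesis using zero[of n] fs.span_zero by simp
    qed
    then have "?L' (poly r) \<in> fs.span ?B" for r
      unfolding poly by (intro fs.span_sum fs.span_scale)
    then show "finite_rank ?L'"
      unfolding finite_rank_def by (intro exI[of _ ?B]) auto
  qed
qed

end
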